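(* Consider the almost periodic Nicholson system $$y_i'(t)=-\tilde d_i(t)\,y_i(t)+\sum_{j=1}^n \tilde a_{ij}(t)\,y_j(t)+\tilde\beta_i(t)\,y_i(t-\tau_i)\,e^{-\tilde c_i(t)\,y_i(t-\tau_i)},\quad t\ge 0,\; i=1,\dots,n, \qquad (N)$$ with delays $\tau_i>0$, under the following assumptions: (a1) $\tilde d_i,\tilde a_{ij},\tilde c_i,\tilde\beta_i:\mathbb{R}\to\mathbb{R}$ are almost periodic; (a2) there is $d_0>0$ with $\tilde d_i(t)\ge d_0$ for all $t\in\mathbb{R}$ and all $i$; (a3) all $\tilde a_{ij}$ are nonnegative and $\tilde a_{ii}\equiv 0$; (a4) $\tilde\beta_i(t)>0$ for all $t\ge 0$ and all $i$; (a5) there is $c_0>0$ with $\tilde c_i(t)\ge c_0$ for all $t\ge 0$ and all $i$; (a6) $\tilde d_i(t)-\sum_{j=1}^n\tilde a_{ji}(t)>0$ for all $t\ge 0$ and all $i$. Let $\bar A=[\bar a_{ij}]$ be the constant matrix with $\bar a_{ij}=\sup_{t\in\mathbb{R}}\tilde a_{ij}(t)$ for $i\ne j$ and $\bar a_{ii}=0$, and assume (without loss of generality, after a permutation of the variables) that $\bar A$ has a block lower triangular structure $$\begin{bmatrix}\bar A_{11}&0&\cdots&0\\ \bar A_{21}&\bar A_{22}&\cdots&0\\ \vdots&\vdots&\ddots&\vdots\\ \bar A_{k1}&\bar A_{k2}&\cdots&\bar A_{kk}\end{bmatrix}$$ with irreducible diagonal blocks $\bar A_{jj}$ of dimension $n_j$,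 $j=1,\dots,k$, $n_1+\cdots+n_k=n$. For each $j=1,\dots,k$ let $I_j\subset\{1,\dots,n\}$ be the set of indices corresponding to the rows of the block $\bar A_{jj}$, consider the $n_j$-dimensional almost periodic linear delay system $$z_i'(t)=-\tilde d_i(t)\,z_i(t)+\sum_{l\in I_j}\tilde a_{il}(t)\,z_l(t)+\tilde\beta_i(t)\,z_i(t-\tau_i),\quad t\ge0,\ i\in I_j,$$ and let $z^j(t,\bar 1)$ be its solution whose initial map $\bar 1\in X^{(j)}=\prod_{i\in I_j}C([-\tau_i,0])$ has all components identically equal to $1$. Let $$\tilde\lambda_j=\lim_{t\to\infty}\frac{\log\|z^j_t(\bar 1)\|}{t}$$ (the existence of this limit being part of the assertion). If $k=1$ (i.e. $\bar A$ is irreducible) let $I=J=\{1\}$; otherwise let $$I=\{j\in\{1,\dots,k\}: \bar A_{ji}=0\text{ for all } i\ne j\},\qquad J=\{j\in\{1,\dots,k\}: \bar A_{ij}=0\text{ for all } i\ne j\}.$$ Then: (i) System $(N)$ is uniformly persistent at $0$ if and only if $\tilde\lambda_j>0$ for every $j\in I$. (ii) System $(N)$ is strictly persistent at $0$ if and only if $\tilde\lambda_j>0$ for every $j\in J$.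
   Context: Almost periodic: a continuous $g:\mathbb{R}\to\mathbb{R}$ is almost periodic if for every $\varepsilon>0$ the set $\{r\in\mathbb{R}: |g(t+r)-g(t)|<\varepsilon \text{ for all } t\in\mathbb{R}\}$ is relatively dense in $\mathbb{R}$. A square matrix is reducible if a simultaneous permutation of rows and columns brings it to the form $\begin{bmatrix} A_{11} & 0 \\ A_{21} & A_{22} \end{bmatrix}$ with $A_{11},A_{22}$ square, and irreducible otherwise ($1\times1$ matrices are irreducible, including the zero one). Phase space and order: $X=C([-\tau_1,0])\times\cdots\times C([-\tau_n,0])$ (real-valued continuous functions); for $\varphi=(\varphi_1,\dots,\varphi_n)\in X$, $\varphi\ge0$ means all $\varphi_i\ge0$ pointwise, and $\varphi(0)=(\varphi_1(0),\dots,\varphi_n(0))$. In $\mathbb{R}^n$, $x>0$ means all components are nonnegative and $x\ne0$; $x\gg0$ means all components are positive. $y(t,\varphi)$ denotes the solution of $(N)$ with initial map $\varphi\ge 0$, i.e. $y_i(s)=\varphi_i(s)$ for $s\in[-\tau_i,0]$; under (a1)-(a6) it is nonnegative and defined for all $t\ge0$. For the block linear system, $z^j_t(\bar 1)\in X^{(j)}$ is the segment $(z^j_t(\bar 1))_i(s)=z^j_i(t+s,\bar 1)$, $s\in[-\tau_i,0]$, $i\in I_j$, and $\|\cdot\|$ is the sup-norm on $X^{(j)}$. - $(N)$ is uniformly persistent at $0$ if there exists $m>0$ such that for every $\varphi\ge0$ with $\varphi(0)\gg0$ there is $t_0=t_0(\varphi)$ with $y_i(t,\varphi)\ge m$ for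 all $t\ge t_0$ and all $i=1,\dots,n$. - $(N)$ is strictly persistent at $0$ if there exists $m>0$ such that for every $\varphi\ge0$ with $\varphi(0)>0$ there is $t_0=t_0(\varphi)$ such that for at least one component $i$, $y_i(t,\varphi)\ge m$ for all $t\ge t_0$. *)

theory Defs
  imports "HOL-Analysis.Analysis"
begin

definition relatively_dense :: "real set \<Rightarrow> bool" where
  "relatively_dense R \<longleftrightarrow> (\<exists>L>0. \<forall>x. \<exists>r\<in>R. x \<le> r \<and> r \<le> x + L)"

definition almost_periodic :: "(real \<Rightarrow> real) \<Rightarrow> bool" where
  "almost_periodic g \<longleftrightarrow> continuous_on UNIV g \<and>
     (\<forall>\<epsilon>>0. relatively_dense {r. \<forall>t. \<bar>g (t + r) - g t\<bar> < \<epsilon>})"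


text \<open>An \<open>m\<close> by \<open>m\<close> matrix is a function on indices of which only the values on
  \<open>{1..m} \<times> {1..m}\<close> matter. In the definition of reducibility both diagonal blocks are
  nonempty, so every 1 by 1 matrix is irreducible.\<close>

definition reducible_mat :: "nat \<Rightarrow> (nat \<Rightarrow> nat \<Rightarrow> real) \<Rightarrow> bool" where
  "reducible_mat m A \<longleftrightarrow> (\<exists>p r. p permutes {1..m} \<and> 1 \<le> r \<and> r < m \<and>
     (\<forall>i\<in>{1..r}. \<forall>j\<in>{r+1..m}. A (p i) (p j) = 0))"

abbreviation irreducible_mat :: "nat \<Rightarrow> (nat \<Rightarrow> nat \<Rightarrow> real) \<Rightarrow> bool" where
  "irreducible_mat m A \<equiv> \<not> reducible_mat m A"

definition sup_matrix :: "(nat \<Rightarrow> nat \<Rightarrow> real \<Rightarrow> real) \<Rightarrow> nat \<Rightarrow> nat \<Rightarrow> real" where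
  "sup_matrix a i j = (if i = j then 0 else (SUP t. a i j t))"

text \<open>Block partitions are given by the sequence \<open>ns 1, \<dots>, ns k\<close> of block dimensions.\<close>

definition block_offset :: "(nat \<Rightarrow> nat) \<Rightarrow> nat \<Rightarrow> nat" where
  "block_offset ns j = (\<Sum>l\<in>{1..<j}. ns l)"

definition block_indices :: "(nat \<Rightarrow> nat) \<Rightarrow> nat \<Rightarrow> nat set" where
  "block_indices ns j = {block_offset ns j + 1..block_offset ns j + ns j}"

definition mat_block ::
  "(nat \<Rightarrow> nat) \<Rightarrow> (nat \<Rightarrow> nat \<Rightarrow> real) \<Rightarrow> nat \<Rightarrow> nat \<Rightarrow> nat \<Rightarrow> nat \<Rightarrow> real" where
  "mat_block ns A i j = (\<lambda>p q. A (block_offset ns i + p) (block_offset ns j + q))"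

definition block_zero :: "(nat \<Rightarrow> nat) \<Rightarrow> (nat \<Rightarrow> nat \<Rightarrow> real) \<Rightarrow> nat \<Rightarrow> nat \<Rightarrow> bool" where
  "block_zero ns A i j \<longleftrightarrow> (\<forall>p\<in>{1..ns i}. \<forall>q\<in>{1..ns j}. mat_block ns A i j p q = 0)"

definition block_lower_triangular ::
  "nat \<Rightarrow> (nat \<Rightarrow> nat) \<Rightarrow> (nat \<Rightarrow> nat \<Rightarrow> real) \<Rightarrow> bool" where
  "block_lower_triangular k ns A \<longleftrightarrow>
     (\<forall>i\<in>{1..k}. \<forall>j\<in>{1..k}. i < j \<longrightarrow> block_zero ns A i j)"

definition I_set :: "nat \<Rightarrow> (nat \<Rightarrow> nat) \<Rightarrow> (nat \<Rightarrow> nat \<Rightarrow> real) \<Rightarrow> nat set" where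
  "I_set k ns A = (if k = 1 then {1}
     else {j\<in>{1..k}. \<forall>i\<in>{1..k}. i \<noteq> j \<longrightarrow> block_zero ns A j i})"

definition J_set :: "nat \<Rightarrow> (nat \<Rightarrow> nat) \<Rightarrow> (nat \<Rightarrow> nat \<Rightarrow> real) \<Rightarrow> nat set" where
  "J_set k ns A = (if k = 1 then {1}
     else {j\<in>{1..k}. \<forall>i\<in>{1..k}. i \<noteq> j \<longrightarrow> block_zero ns A i j})"


text \<open>Elements of the product over \<open>i \<in> S\<close> of \<open>C([-\<tau> i, 0])\<close> are represented by functions
  \<open>\<phi>\<close> of which only the values \<open>\<phi> i s\<close> with \<open>i \<in> S\<close> and \<open>s \<in> {-\<tau> i..0}\<close> matter.\<close>

definition phase_space :: "nat set \<Rightarrow> (nat \<Rightarrow> real) \<Rightarrow> (nat \<Rightarrow> real \<Rightarrow> real) set" where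
  "phase_space S \<tau> = {\<phi>. \<forall>i\<in>S. continuous_on {-\<tau> i..0} (\<phi> i)}"

definition phase_nonneg :: "nat set \<Rightarrow> (nat \<Rightarrow> real) \<Rightarrow> (nat \<Rightarrow> real \<Rightarrow> real) \<Rightarrow> bool" where
  "phase_nonneg S \<tau> \<phi> \<longleftrightarrow> (\<forall>i\<in>S. \<forall>s\<in>{-\<tau> i..0}. 0 \<le> \<phi> i s)"

definition phase_norm :: "nat set \<Rightarrow> (nat \<Rightarrow> real) \<Rightarrow> (nat \<Rightarrow> real \<Rightarrow> real) \<Rightarrow> real" where
  "phase_norm S \<tau> \<phi> = Max ((\<lambda>i. SUP s\<in>{-\<tau> i..0}. \<bar>\<phi> i s\<bar>) ` S)"

definition segment :: "(nat \<Rightarrow> real \<Rightarrow> real) \<Rightarrow> real \<Rightarrow> nat \<Rightarrow> real \<Rightarrow> real" where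
  "segment z t = (\<lambda>i s. z i (t + s))"

definition vec_gt0 :: "nat set \<Rightarrow> (nat \<Rightarrow> real) \<Rightarrow> bool" where
  "vec_gt0 S x \<longleftrightarrow> (\<forall>i\<in>S. 0 \<le> x i) \<and> (\<exists>i\<in>S. x i \<noteq> 0)"

definition vec_gg0 :: "nat set \<Rightarrow> (nat \<Rightarrow> real) \<Rightarrow> bool" where
  "vec_gg0 S x \<longleftrightarrow> (\<forall>i\<in>S. 0 < x i)"


text \<open>\<open>y\<close> solves \<open>y i' t = f i t (y(t)) (the vector of all y l (t - \<tau> l))\<close> for \<open>t \<ge> 0\<close>, \<open>i \<in> S\<close>,
  with initial map \<open>\<phi>\<close>; the derivative at \<open>t = 0\<close> is one-sided. The solution lives on
  \<open>[-\<tau> i, \<infinity>)\<close> in component \<open>i \<in> S\<close>; the last clause gives it a fixed value elsewhere, so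
  that uniqueness on that domain is uniqueness as a function.\<close>

definition is_delay_solution ::
  "nat set \<Rightarrow> (nat \<Rightarrow> real) \<Rightarrow> (nat \<Rightarrow> real \<Rightarrow> (nat \<Rightarrow> real) \<Rightarrow> (nat \<Rightarrow> real) \<Rightarrow> real) \<Rightarrow>
   (nat \<Rightarrow> real \<Rightarrow> real) \<Rightarrow> (nat \<Rightarrow> real \<Rightarrow> real) \<Rightarrow> bool" where
  "is_delay_solution S \<tau> f \<phi> y \<longleftrightarrow>
     (\<forall>i\<in>S. \<forall>s\<in>{-\<tau> i..0}. y i s = \<phi> i s) \<and>
     (\<forall>i\<in>S. \<forall>t\<ge>0. (y i has_real_derivative
         f i t (\<lambda>l. y l t) (\<lambda>l. y l (t - \<tau> l))) (at t within {0..})) \<and>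
     (\<forall>i t. i \<notin> S \<or> t < -\<tau> i \<longrightarrow> y i t = 0)"

text \<open>Both systems below are affine in the undelayed variables. If the delays are positive and
  the coefficients and \<open>\<phi>\<close> are continuous, the method of steps therefore gives exactly one
  solution, and the description is proper.\<close>

definition delay_solution ::
  "nat set \<Rightarrow> (nat \<Rightarrow> real) \<Rightarrow> (nat \<Rightarrow> real \<Rightarrow> (nat \<Rightarrow> real) \<Rightarrow> (nat \<Rightarrow> real) \<Rightarrow> real) \<Rightarrow>
   (nat \<Rightarrow> real \<Rightarrow> real) \<Rightarrow> nat \<Rightarrow> real \<Rightarrow> real" where
  "delay_solution S \<tau> f \<phi> = (THE y. is_delay_solution S \<tau> f \<phi> y)"

definition nicholson_rhs ::
  "nat \<Rightarrow> (nat \<Rightarrow> real \<Rightarrow> real) \<Rightarrow> (nat \<Rightarrow> nat \<Rightarrow> real \<Rightarrow> real) \<Rightarrow> (nat \<Rightarrow> real \<Rightarrow> real) \<Rightarrow>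
   (nat \<Rightarrow> real \<Rightarrow> real) \<Rightarrow> nat \<Rightarrow> real \<Rightarrow> (nat \<Rightarrow> real) \<Rightarrow> (nat \<Rightarrow> real) \<Rightarrow> real" where
  "nicholson_rhs n d a \<beta> c i t x w =
     - d i t * x i + (\<Sum>j=1..n. a i j t * x j) + \<beta> i t * w i * exp (- c i t * w i)"

definition linear_rhs ::
  "nat set \<Rightarrow> (nat \<Rightarrow> real \<Rightarrow> real) \<Rightarrow> (nat \<Rightarrow> nat \<Rightarrow> real \<Rightarrow> real) \<Rightarrow> (nat \<Rightarrow> real \<Rightarrow> real) \<Rightarrow>
   nat \<Rightarrow> real \<Rightarrow> (nat \<Rightarrow> real) \<Rightarrow> (nat \<Rightarrow> real) \<Rightarrow> real" where
  "linear_rhs S d a \<beta> i t x w =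
     - d i t * x i + (\<Sum>l\<in>S. a i l t * x l) + \<beta> i t * w i"

definition nicholson_solution ::
  "nat \<Rightarrow> (nat \<Rightarrow> real) \<Rightarrow> (nat \<Rightarrow> real \<Rightarrow> real) \<Rightarrow> (nat \<Rightarrow> nat \<Rightarrow> real \<Rightarrow> real) \<Rightarrow>
   (nat \<Rightarrow> real \<Rightarrow> real) \<Rightarrow> (nat \<Rightarrow> real \<Rightarrow> real) \<Rightarrow> (nat \<Rightarrow> real \<Rightarrow> real) \<Rightarrow> nat \<Rightarrow> real \<Rightarrow> real"
  where
  "nicholson_solution n \<tau> d a \<beta> c = delay_solution {1..n} \<tau> (nicholson_rhs n d a \<beta> c)"

definition linear_solution ::
  "nat set \<Rightarrow> (nat \<Rightarrow> real) \<Rightarrow> (nat \<Rightarrow> real \<Rightarrow> real) \<Rightarrow> (nat \<Rightarrow> nat \<Rightarrow> real \<Rightarrow> real) \<Rightarrow>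
   (nat \<Rightarrow> real \<Rightarrow> real) \<Rightarrow> (nat \<Rightarrow> real \<Rightarrow> real) \<Rightarrow> nat \<Rightarrow> real \<Rightarrow> real" where
  "linear_solution S \<tau> d a \<beta> = delay_solution S \<tau> (linear_rhs S d a \<beta>)"

definition uniformly_persistent ::
  "nat \<Rightarrow> (nat \<Rightarrow> real) \<Rightarrow> (nat \<Rightarrow> real \<Rightarrow> real) \<Rightarrow> (nat \<Rightarrow> nat \<Rightarrow> real \<Rightarrow> real) \<Rightarrow>
   (nat \<Rightarrow> real \<Rightarrow> real) \<Rightarrow> (nat \<Rightarrow> real \<Rightarrow> real) \<Rightarrow> bool" where
  "uniformly_persistent n \<tau> d a \<beta> c \<longleftrightarrow>
     (\<exists>m>0. \<forall>\<phi>\<in>phase_space {1..n} \<tau>.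
        phase_nonneg {1..n} \<tau> \<phi> \<and> vec_gg0 {1..n} (\<lambda>i. \<phi> i 0) \<longrightarrow>
        (\<exists>t0\<ge>0. \<forall>t\<ge>t0. \<forall>i\<in>{1..n}. m \<le> nicholson_solution n \<tau> d a \<beta> c \<phi> i t))"

definition strictly_persistent ::
  "nat \<Rightarrow> (nat \<Rightarrow> real) \<Rightarrow> (nat \<Rightarrow> real \<Rightarrow> real) \<Rightarrow> (nat \<Rightarrow> nat \<Rightarrow> real \<Rightarrow> real) \<Rightarrow>
   (nat \<Rightarrow> real \<Rightarrow> real) \<Rightarrow> (nat \<Rightarrow> real \<Rightarrow> real) \<Rightarrow> bool" where
  "strictly_persistent n \<tau> d a \<beta> c \<longleftrightarrow>
     (\<exists>m>0. \<forall>\<phi>\<in>phase_space {1..n} \<tau>.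
        phase_nonneg {1..n} \<tau> \<phi> \<and> vec_gt0 {1..n} (\<lambda>i. \<phi> i 0) \<longrightarrow>
        (\<exists>t0\<ge>0. \<exists>i\<in>{1..n}. \<forall>t\<ge>t0. m \<le> nicholson_solution n \<tau> d a \<beta> c \<phi> i t))"

end

theory Submission
  imports Defs "HOL-Probability.Discrete_Topology"
begin

text \<open>
  Within an irreducible block, the undelayed coupling terms bounded below on relatively dense
  windows spread positivity, so positive solutions of the linear block system satisfy a Harnack
  inequality that is uniform in time. Let \<open>\<sigma> t\<close> be the sum of the components of the solution \<open>z\<close>
  starting from 1. If all coefficients change by at most \<open>\<epsilon>\<close> under a translation, then by the
  Harnack inequality the solution multiplied by \<open>exp (A \<epsilon> t)\<close> is a supersolution of the translated
  system; as such translations are relatively dense, \<open>ln \<sigma>\<close> is additive up to \<open>\<epsilon> T + O(1)\<close> for every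
  \<open>\<epsilon> > 0\<close>, and hence has an asymptotic slope, uniformly with respect to the starting time.

  If the slope is positive, it remains positive after replacing \<open>\<beta>\<close> by \<open>\<gamma> \<beta>\<close> with \<open>\<gamma> < 1\<close> close to 1, and
  solutions of the Nicholson system that are small and bounded dominate those of the damped linear
  system, so they double over a fixed time span. If the slope is not positive, a solution bounded
  away from zero would satisfy \<open>y \<le> B exp (- \<theta> M t) z t\<close> with \<open>M\<close> growing linearly, because the
  nonlinearity then loses a fixed fraction of the birth term; this is absurd. Blocks without inputs
  decide uniform persistence since positivity spreads from them to all the others; blocks without
  outputs decide strict persistence since they can be populated in isolation and are reached from
  everywhere.
\<close>

section \<open>Almost periodic functions\<close>

text \<open>\<open>\<beta>\<close> and the dissipativity margin may come arbitrarily close to 0 and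
  the couplings may vanish at times, so no estimate can start from positive lower bounds for them.
  Positivity at one time recurs on relatively dense windows of fixed length instead, and an
  antiderivative that gains a fixed amount per window takes over the role of a constant rate, both
  for dissipation and for the loss in the extinction argument. The Harnack inequality is what makes
  small changes of the coefficients harmless: an error \<epsilon> times another component or a
  delayed value is at most a constant times \<epsilon> times the present component of the same
  equation, so a change of order \<epsilon> in the exponential rate absorbs it. The damping of
  births by \<open>\<gamma>\<close> is paid for in the same way. The exponent 0 is the delicate
  case, because comparison with the linear system alone then excludes nothing; the contradiction has
  to come from the births lost at a fixed positive level.\<close>

lemma relatively_denseE:
  assumes "relatively_dense R"
  obtains L where "L > 0" "\<And>x. \<exists>r\<in>R. x \<le> r \<and> r \<le> x + L"
  using assms unfolding relatively_dense_def by blast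

lemma relatively_dense_mono: "relatively_dense R \<Longrightarrow> R \<subseteq> R' \<Longrightarrow> relatively_dense R'"
  unfolding relatively_dense_def by blast

lemma relatively_dense_UNIV: "relatively_dense UNIV"
proof -
  have "\<forall>x. \<exists>r\<in>UNIV. x \<le> r \<and> r \<le> x + (1::real)"
    by (intro allI, rule_tac x = x in bexI) auto
  then show ?thesis unfolding relatively_dense_def by (intro exI[of _ 1]) simp
qed

lemma almost_periodic_continuous: "almost_periodic g \<Longrightarrow> continuous_on S g"
  unfolding almost_periodic_def using continuous_on_subset by blast

lemma almost_periodic_periods:
  assumes "almost_periodic g" "\<epsilon> > 0"
  shows "\<exists>L>0. \<forall>x. \<exists>r. x \<le> r \<and> r \<le> x + L \<and> (\<forall>t. \<bar>g (t + r) - g t\<bar> < \<epsilon>)"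
proof -
  have "relatively_dense {r. \<forall>t. \<bar>g (t + r) - g t\<bar> < \<epsilon>}"
    using assms unfolding almost_periodic_def by simp
  then show ?thesis unfolding relatively_dense_def Bex_def mem_Collect_eq by metis
qed

text \<open>An almost period for the tolerance 1 moves any time into \<open>{0..L}\<close>, where
  compactness bounds \<open>g\<close>.\<close>

lemma almost_periodic_bounded:
  assumes "almost_periodic g"
  shows "\<exists>K. \<forall>t. \<bar>g t\<bar> \<le> K"
proof -
  have cont: "continuous_on UNIV g" using assms by (rule almost_periodic_continuous)
  obtain L where L: "L > 0"
    and ex: "\<And>x. \<exists>r. x \<le> r \<and> r \<le> x + L \<and> (\<forall>t. \<bar>g (t + r) - g t\<bar> < 1)"
    using almost_periodic_periods[OF assms, of 1] by auto
  have "compact (g ` {0..L})"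
    by (intro compact_continuous_image continuous_on_subset[OF cont]) auto
  then obtain B where B: "\<And>x. x \<in> {0..L} \<Longrightarrow> \<bar>g x\<bar> \<le> B"
    using compact_imp_bounded bounded_iff by (metis (no_types) image_eqI real_norm_def)
  have "\<bar>g t\<bar> \<le> B + 1" for t
  proof -
    obtain r where r: "\<bar>g (t + r) - g t\<bar> < 1" "-t \<le> r" "r \<le> -t + L"
      using ex[of "-t"] by auto
    then show ?thesis using B[of "t + r"] by auto
  qed
  then show ?thesis by blast
qed

text \<open>One almost period moves two nearby times together into a fixed compact interval, where
  uniform continuity holds; the two translations and the estimate on the interval each cost a third
  of \<epsilon>.\<close>

lemma almost_periodic_uniformly_continuous:
  assumes "almost_periodic g" and "\<epsilon> > 0"
  shows "\<exists>\<eta>>0. \<forall>s t. \<bar>s - t\<bar> \<le> \<eta> \<longrightarrow> \<bar>g s - g t\<bar> < \<epsilon>"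
proof -
  have cont: "continuous_on UNIV g" using assms(1) by (rule almost_periodic_continuous)
  have \<epsilon>3: "\<epsilon> / 3 > 0" using assms(2) by simp
  obtain L where L: "L > 0"
    and ex: "\<And>x. \<exists>r. x \<le> r \<and> r \<le> x + L \<and> (\<forall>t. \<bar>g (t + r) - g t\<bar> < \<epsilon> / 3)"
    using almost_periodic_periods[OF assms(1) \<epsilon>3] by blast
  have "uniformly_continuous_on {-1..L + 1} g"
    by (intro compact_uniformly_continuous continuous_on_subset[OF cont]) auto
  then obtain e where e: "e > 0"
    "\<And>x y. x \<in> {-1..L + 1} \<Longrightarrow> y \<in> {-1..L + 1} \<Longrightarrow> \<bar>y - x\<bar> < e \<Longrightarrow> \<bar>g y - g x\<bar> < \<epsilon> / 3"
    using \<epsilon>3 unfolding uniformly_continuous_on_def dist_real_def by metis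
  \<comment> \<open>The 1 keeps both translated times in \<open>{-1..L + 1}\<close>; halving
    \<open>e\<close> turns the non-strict bound into a strict one.\<close>
  have "\<bar>g s - g t\<bar> < \<epsilon>" if "\<bar>s - t\<bar> \<le> min 1 (e / 2)" for s t
  proof -
    obtain r where r: "\<And>u. \<bar>g (u + r) - g u\<bar> < \<epsilon> / 3" "-t \<le> r" "r \<le> -t + L"
      using ex[of "-t"] by auto
    have "\<bar>g (s + r) - g (t + r)\<bar> < \<epsilon> / 3"
    proof (intro e(2))
      show "s + r \<in> {- 1..L + 1}" "t + r \<in> {- 1..L + 1}" "\<bar>s + r - (t + r)\<bar> < e"
        using that e(1) r(2,3) by (simp_all add: abs_le_iff)
    qed
    then show ?thesis using r(1)[of s] r(1)[of t] by linarith
  qed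
  then show ?thesis using e(1) by (intro exI[of _ "min 1 (e / 2)"]) auto
qed

text \<open>Pigeonhole on the differences of an almost period of the family and one of the new function:
  if two such differences are close, subtracting the pairs gives a common almost period.\<close>

lemma common_almost_periods_insert:
  fixes F :: "(real \<Rightarrow> real) set"
  assumes F: "\<And>\<epsilon>. \<epsilon> > 0 \<Longrightarrow> relatively_dense {r. \<forall>f\<in>F. \<forall>t. \<bar>f (t + r) - f t\<bar> < \<epsilon>}"
    and g: "almost_periodic g" and "\<epsilon> > 0"
  shows "relatively_dense {r. \<forall>f\<in>insert g F. \<forall>t. \<bar>f (t + r) - f t\<bar> < \<epsilon>}"
proof -
  define e where "e = \<epsilon> / 3"
  have e: "e > 0" using \<open>\<epsilon> > 0\<close> by (simp add: e_def)
  define P where "P r \<longleftrightarrow> (\<forall>f\<in>F. \<forall>t. \<bar>f (t + r) - f t\<bar> < e)" for r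
  define Q where "Q r \<longleftrightarrow> (\<forall>t. \<bar>g (t + r) - g t\<bar> < e)" for r
  obtain L1 where L1: "L1 > 0" "\<And>x. \<exists>r. P r \<and> x \<le> r \<and> r \<le> x + L1"
    using F[OF e] unfolding relatively_dense_def P_def Bex_def mem_Collect_eq by blast
  obtain L2 where L2: "L2 > 0" "\<And>x. \<exists>r. Q r \<and> x \<le> r \<and> r \<le> x + L2"
    using almost_periodic_periods[OF g e] unfolding Q_def by metis
  obtain \<eta> where \<eta>: "\<eta> > 0" "\<And>s t. \<bar>s - t\<bar> \<le> \<eta> \<Longrightarrow> \<bar>g s - g t\<bar> < e"
    using almost_periodic_uniformly_continuous[OF g e] by blast
  define L where "L = max L1 L2"
  have "\<exists>p q. P p \<and> Q q \<and> x \<le> p \<and> p \<le> x + L \<and> x \<le> q \<and> q \<le> x + L" for x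
  proof -
    obtain p q where "P p" "x \<le> p" "p \<le> x + L1" "Q q" "x \<le> q" "q \<le> x + L2"
      using L1(2)[of x] L2(2)[of x] by blast
    moreover have "L1 \<le> L" "L2 \<le> L" by (auto simp: L_def)
    ultimately have "P p \<and> Q q \<and> x \<le> p \<and> p \<le> x + L \<and> x \<le> q \<and> q \<le> x + L" by simp
    then show ?thesis by blast
  qed
  then obtain p q where pq: "\<And>x. P (p x)" "\<And>x. Q (q x)" "\<And>x. x \<le> p x" "\<And>x. p x \<le> x + L"
    "\<And>x. x \<le> q x" "\<And>x. q x \<le> x + L" by metis
  \<comment> \<open>The differences \<open>p x - q x\<close> lie between \<open>- L\<close> and
    \<open>L\<close>; sorted into cells of length \<open>\<eta>\<close>, they occupy finitely
    many.\<close>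
  define cell where "cell x = \<lfloor>(p x - q x) / \<eta>\<rfloor>" for x
  have "cell x \<in> {\<lfloor>-L / \<eta>\<rfloor>..\<lfloor>L / \<eta>\<rfloor>}" for x
  proof -
    have "-L \<le> p x - q x" "p x - q x \<le> L" using pq(3-6)[of x] by linarith+
    then have "-L / \<eta> \<le> (p x - q x) / \<eta>" "(p x - q x) / \<eta> \<le> L / \<eta>"
      using \<eta>(1) divide_right_mono by (meson less_imp_le)+
    then show ?thesis unfolding cell_def atLeastAtMost_iff by (intro conjI floor_mono)
  qed
  then have "finite (range cell)" by (intro finite_subset[OF _ finite_atLeastAtMost_int]) blast
  from finite_subset_image[OF this subset_refl]
  obtain X where X: "finite X" "range cell = cell ` X" by blast
  \<comment> \<open>\<open>X\<close> represents every occupied cell, and \<open>R\<close> bounds the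
    almost periods belonging to the representatives.\<close>
  define R where "R = Max (insert 0 ((\<lambda>x. \<bar>p x\<bar>) ` X))"
  have R: "\<bar>p x\<bar> \<le> R" if "x \<in> X" for x
    using X(1) that unfolding R_def by (intro Max_ge) auto
  have R0: "R \<ge> 0" using X(1) unfolding R_def by (intro Max_ge) auto
  have "\<exists>r\<in>{r. \<forall>f\<in>insert g F. \<forall>t. \<bar>f (t + r) - f t\<bar> < \<epsilon>}. x \<le> r \<and> r \<le> x + (L + 2 * R)" for x
  proof -
    \<comment> \<open>Starting at \<open>x + R\<close> keeps \<open>p y - p z\<close> at least
      \<open>x\<close>.\<close>
    define y where "y = x + R"
    obtain z where z: "z \<in> X" "cell z = cell y" using X(2) by (metis image_iff rangeI)
    define r where "r = p y - p z"
    have "x \<le> r" "r \<le> x + (L + 2 * R)" using R[OF z(1)] pq(3,4)[of y] unfolding r_def y_def by linarith+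
    moreover have "\<bar>f (t + r) - f t\<bar> < \<epsilon>" if "f \<in> F" for f t
    proof -
      have "\<bar>f ((t - p z) + p y) - f (t - p z)\<bar> < e" "\<bar>f ((t - p z) + p z) - f (t - p z)\<bar> < e"
        using pq(1) that unfolding P_def by blast+
      moreover have "t - p z + p y = t + r" "t - p z + p z = t" by (simp_all add: r_def)
      ultimately have "\<bar>f (t + r) - f (t - p z)\<bar> < e" "\<bar>f t - f (t - p z)\<bar> < e" by simp_all
      then have "\<bar>f (t + r) - f t\<bar> < 2 * e" by linarith
      then show ?thesis using \<open>\<epsilon> > 0\<close> unfolding e_def by linarith
    qed
    \<comment> \<open>The almost periods of \<open>g\<close> are the values of \<open>q\<close>.
      Replacing the difference of two values of \<open>p\<close> by that of \<open>q\<close> moves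
      the argument by at most \<open>\<eta>\<close>, because \<open>y\<close> and \<open>z\<close>
      share a cell.\<close>
    moreover have "\<bar>g (t + r) - g t\<bar> < \<epsilon>" for t
    proof -
      have 1: "\<bar>g ((t - q z) + q y) - g (t - q z)\<bar> < e" "\<bar>g ((t - q z) + q z) - g (t - q z)\<bar> < e"
        using pq(2) unfolding Q_def by blast+
      have "\<bar>(p y - q y) / \<eta> - (p z - q z) / \<eta>\<bar> \<le> 1"
        using z(2) unfolding cell_def by linarith
      then have "\<bar>((p y - q y) - (p z - q z)) / \<eta>\<bar> \<le> 1" by (simp only: diff_divide_distrib)
      then have "\<bar>(p y - q y) - (p z - q z)\<bar> \<le> \<eta>"
        using \<eta>(1) by (simp only: abs_divide abs_of_pos pos_divide_le_eq mult_1)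
      then have "\<bar>(t + r) - (t - q z + q y)\<bar> \<le> \<eta>" unfolding r_def by (simp add: algebra_simps)
      then have "\<bar>g (t + r) - g (t - q z + q y)\<bar> < e" by (rule \<eta>(2))
      moreover have "t - q z + q z = t" by simp
      ultimately have "\<bar>g (t + r) - g t\<bar> < 3 * e" using 1 by (simp only:)
      then show ?thesis unfolding e_def by simp
    qed
    ultimately show ?thesis by blast
  qed
  moreover have "L + 2 * R > 0" using L1(1) L2(1) R0 unfolding L_def by (auto simp: max_def)
  ultimately show ?thesis unfolding relatively_dense_def by (intro exI[of _ "L + 2 * R"]) simp
qed

lemma common_almost_periods:
  assumes "finite F" "\<And>f. f \<in> F \<Longrightarrow> almost_periodic f" "\<epsilon> > 0"
  shows "relatively_dense {r. \<forall>f\<in>F. \<forall>t. \<bar>f (t + r) - f t\<bar> < \<epsilon>}"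
  using assms
proof (induction F arbitrary: \<epsilon> rule: finite_induct)
  case empty
  show ?case using relatively_dense_UNIV by simp
next
  case (insert g F)
  then show ?case by (intro common_almost_periods_insert) auto
qed

text \<open>This rests on common almost periods: those of \<open>f\<close> alone need not work for
  \<open>g\<close>.\<close>

lemma almost_periodic_add:
  assumes "almost_periodic f" "almost_periodic g"
  shows "almost_periodic (\<lambda>t. f t + g t)"
  unfolding almost_periodic_def
proof (intro conjI allI impI)
  show "continuous_on UNIV (\<lambda>t. f t + g t)"
    using assms by (intro continuous_intros almost_periodic_continuous)
  fix \<epsilon> :: real assume "\<epsilon> > 0"
  then have "relatively_dense {r. \<forall>k\<in>{f, g}. \<forall>t. \<bar>k (t + r) - k t\<bar> < \<epsilon> / 2}"
    using assms by (intro common_almost_periods) auto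
  then show "relatively_dense {r. \<forall>t. \<bar>f (t + r) + g (t + r) - (f t + g t)\<bar> < \<epsilon>}"
  proof (rule relatively_dense_mono)
    show "{r. \<forall>k\<in>{f, g}. \<forall>t. \<bar>k (t + r) - k t\<bar> < \<epsilon> / 2}
        \<subseteq> {r. \<forall>t. \<bar>f (t + r) + g (t + r) - (f t + g t)\<bar> < \<epsilon>}"
    proof clarify
      fix r t assume r: "\<forall>k\<in>{f, g}. \<forall>t. \<bar>k (t + r) - k t\<bar> < \<epsilon> / 2"
      have "\<bar>f (t + r) - f t\<bar> < \<epsilon> / 2" "\<bar>g (t + r) - g t\<bar> < \<epsilon> / 2" using r by auto
      then show "\<bar>f (t + r) + g (t + r) - (f t + g t)\<bar> < \<epsilon>" by linarith
    qed
  qed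
qed

lemma almost_periodic_uminus:
  assumes "almost_periodic f"
  shows "almost_periodic (\<lambda>t. - f t)"
proof -
  have "\<bar>- f (t + r) - - f t\<bar> = \<bar>f (t + r) - f t\<bar>" for t r by linarith
  then show ?thesis using assms by (auto simp: almost_periodic_def intro: continuous_intros)
qed

lemma almost_periodic_diff:
  assumes "almost_periodic f" "almost_periodic g"
  shows "almost_periodic (\<lambda>t. f t - g t)"
  using almost_periodic_add[OF assms(1) almost_periodic_uminus[OF assms(2)]] by simp

lemma almost_periodic_sum:
  assumes "finite F" "\<And>i. i \<in> F \<Longrightarrow> almost_periodic (f i)"
  shows "almost_periodic (\<lambda>t. \<Sum>i\<in>F. f i t)"
  using assms
proof (induction F rule: finite_induct)
  case empty
  have "almost_periodic (\<lambda>t. 0)"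
    unfolding almost_periodic_def using relatively_dense_UNIV by simp
  then show ?case by simp
next
  case (insert i F)
  then show ?case by (simp add: almost_periodic_add)
qed

text \<open>Positivity at one common time recurs along common almost periods, and uniform continuity
  widens each recurrence to a window whose length and lower bound do not depend on its
  location.\<close>

lemma almost_periodic_windows:
  assumes F: "finite F" "\<And>f. f \<in> F \<Longrightarrow> almost_periodic f" and pos: "\<And>f. f \<in> F \<Longrightarrow> 0 < f t0"
  shows "\<exists>\<epsilon>>0. \<exists>\<eta>>0. \<exists>L>0. \<forall>x. \<exists>r. x \<le> r \<and> r \<le> x + L \<and> (\<forall>f\<in>F. \<forall>t\<in>{r..r + \<eta>}. \<epsilon> \<le> f t)"
proof -
  \<comment> \<open>One third is lost to the almost period, one third to moving inside the window,
    and one third remains; the 1 covers an empty \<open>F\<close>.\<close>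
  define \<epsilon> where "\<epsilon> = Min (insert 1 ((\<lambda>f. f t0) ` F)) / 3"
  have \<epsilon>: "\<epsilon> > 0" using F(1) pos unfolding \<epsilon>_def by auto
  have \<epsilon>2: "3 * \<epsilon> \<le> f t0" if "f \<in> F" for f using F(1) that unfolding \<epsilon>_def by auto
  have "\<exists>h>0. \<forall>f\<in>F. \<forall>s t. \<bar>s - t\<bar> \<le> h \<longrightarrow> \<bar>f s - f t\<bar> < \<epsilon>"
    using F
  proof (induction F rule: finite_induct)
    case empty show ?case by (rule exI[of _ 1]) simp
  next
    case (insert g F)
    obtain h where h: "h > 0" "\<forall>f\<in>F. \<forall>s t. \<bar>s - t\<bar> \<le> h \<longrightarrow> \<bar>f s - f t\<bar> < \<epsilon>"
      using insert by auto
    obtain h' where "h' > 0" "\<forall>s t. \<bar>s - t\<bar> \<le> h' \<longrightarrow> \<bar>g s - g t\<bar> < \<epsilon>"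
      using almost_periodic_uniformly_continuous[OF _ \<epsilon>] insert.prems by (meson insertI1)
    then show ?case using h by (intro exI[of _ "min h h'"]) auto
  qed
  then obtain \<eta> where \<eta>: "\<eta> > 0" "\<forall>f\<in>F. \<forall>s t. \<bar>s - t\<bar> \<le> \<eta> \<longrightarrow> \<bar>f s - f t\<bar> < \<epsilon>" by blast
  obtain L where L: "L > 0" "\<And>x. \<exists>r\<in>{r. \<forall>f\<in>F. \<forall>t. \<bar>f (t + r) - f t\<bar> < \<epsilon>}. x \<le> r \<and> r \<le> x + L"
    using relatively_denseE[OF common_almost_periods[OF F \<epsilon>]] by blast
  have "\<exists>r. x \<le> r \<and> r \<le> x + L \<and> (\<forall>f\<in>F. \<forall>t\<in>{r..r + \<eta>}. \<epsilon> \<le> f t)" for x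
  proof -
    obtain r where r: "\<forall>f\<in>F. \<forall>t. \<bar>f (t + r) - f t\<bar> < \<epsilon>" "x - t0 \<le> r" "r \<le> x - t0 + L"
      using L(2)[of "x - t0"] by blast
    have "\<epsilon> \<le> f t" if "f \<in> F" "t \<in> {t0 + r..t0 + r + \<eta>}" for f t
    proof -
      have "\<bar>f t - f (t0 + r)\<bar> < \<epsilon>" using \<eta>(2) that by auto
      moreover have "\<bar>f (t0 + r) - f t0\<bar> < \<epsilon>" using r(1) that(1) by blast
      ultimately show ?thesis using \<epsilon>2[OF that(1)] by linarith
    qed
    then show ?thesis using r by (intro exI[of _ "t0 + r"]) auto
  qed
  then show ?thesis using \<epsilon> \<eta>(1) L(1) by blast
qed

section \<open>Differential inequalities\<close>

lemma has_real_derivative_nonneg_mono: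
  fixes f :: "real \<Rightarrow> real"
  assumes "0 \<le> a" "a \<le> b"
    and der: "\<And>t. a \<le> t \<Longrightarrow> t \<le> b \<Longrightarrow> (f has_real_derivative f' t) (at t within {0..})"
    and nn: "\<And>t. a \<le> t \<Longrightarrow> t \<le> b \<Longrightarrow> 0 \<le> f' t"
  shows "f a \<le> f b"
proof -
  have "\<exists>x\<in>{a..b}. f b - f a = f' x * (b - a)"
  proof (rule mvt_very_simple[OF assms(2)])
    fix x assume "a \<le> x" "x \<le> b"
    then have "(f has_real_derivative f' x) (at x within {a..b})"
      using der[of x] assms(1) by (meson DERIV_subset atLeastAtMost_iff atLeast_iff order_trans subsetI)
    then show "(f has_derivative (*) (f' x)) (at x within {a..b})"
      by (simp add: has_field_derivative_def)
  qed
  then obtain x where "x \<in> {a..b}" "f b - f a = f' x * (b - a)" by blast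
  then show ?thesis using nn[of x] assms(2) by (smt (verit) atLeastAtMost_iff mult_nonneg_nonneg)
qed

text \<open>The integrating factor \<open>exp (- k * (t - a))\<close> makes the weighted function
  nondecreasing, whatever the sign of \<open>k\<close>.\<close>

lemma differential_inequality_lower:
  fixes f :: "real \<Rightarrow> real"
  assumes ab: "0 \<le> a" "a \<le> b"
    and der: "\<And>t. a \<le> t \<Longrightarrow> t \<le> b \<Longrightarrow> (f has_real_derivative f' t) (at t within {0..})"
    and le: "\<And>t. a \<le> t \<Longrightarrow> t \<le> b \<Longrightarrow> k * f t \<le> f' t"
  shows "exp (k * (b - a)) * f a \<le> f b"
proof -
  have "exp (-k * (a - a)) * f a \<le> exp (-k * (b - a)) * f b"
  proof (rule has_real_derivative_nonneg_mono[OF ab,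
        where f' = "\<lambda>t. exp (-k * (t - a)) * (f' t - k * f t)"])
    fix t assume t: "a \<le> t" "t \<le> b"
    show "((\<lambda>t. exp (- k * (t - a)) * f t) has_real_derivative exp (- k * (t - a)) * (f' t - k * f t))
         (at t within {0..})"
      by (rule derivative_eq_intros der[OF t] refl)+ (simp add: algebra_simps)
    show "0 \<le> exp (- k * (t - a)) * (f' t - k * f t)" using le[OF t] by simp
  qed
  then have "exp (k * (b - a)) * f a \<le> exp (k * (b - a)) * (exp (-k * (b - a)) * f b)" by simp
  also have "\<dots> = f b" by (simp add: mult.assoc[symmetric] exp_add[symmetric])
  finally show ?thesis .
qed

lemma differential_inequality_upper:
  fixes f :: "real \<Rightarrow> real"
  assumes ab: "0 \<le> a" "a \<le> b"
    and der: "\<And>t. a \<le> t \<Longrightarrow> t \<le> b \<Longrightarrow> (f has_real_derivative f' t) (at t within {0..})"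
    and le: "\<And>t. a \<le> t \<Longrightarrow> t \<le> b \<Longrightarrow> f' t \<le> k * f t"
  shows "f b \<le> exp (k * (b - a)) * f a"
proof -
  have "exp (k * (b - a)) * - f a \<le> - f b"
    by (rule differential_inequality_lower[OF ab, where f' = "\<lambda>t. - f' t"])
      (auto intro: DERIV_minus der simp: le)
  then show ?thesis by simp
qed

lemma has_real_derivative_shift:
  fixes f :: "real \<Rightarrow> real"
  assumes "(f has_real_derivative D) (at (p + t) within {0..})" "0 \<le> p"
  shows "((\<lambda>t. f (p + t)) has_real_derivative D) (at t within {0..})"
proof -
  have "(f has_real_derivative D) (at (p + t) within (\<lambda>t. p + t) ` {0..})"
    by (rule DERIV_subset[OF assms(1)]) (use assms(2) in auto)
  moreover have "((\<lambda>t. p + t) has_real_derivative 1) (at t within {0..})"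
    by (auto intro!: derivative_eq_intros)
  ultimately show ?thesis using DERIV_image_chain[of f D "\<lambda>t. p + t" t "{0..}" 1] by (simp add: o_def)
qed

text \<open>Every interval of length \<open>L + \<eta>\<close> contains a full window, on which
  \<open>M\<close> gains at least \<open>\<epsilon> * \<eta>\<close>, and \<open>M\<close> loses
  nothing elsewhere. The incomplete last interval is paid for by \<open>C\<close>.\<close>

lemma linear_growth_of_windows:
  fixes M g :: "real \<Rightarrow> real"
  assumes der: "\<And>t. 0 \<le> t \<Longrightarrow> (M has_real_derivative g t) (at t within {0..})"
    and nn: "\<And>t. 0 \<le> t \<Longrightarrow> 0 \<le> g t"
    and pos: "\<epsilon> > 0" "\<eta> > 0" "L > 0"
    and win: "\<And>x. \<exists>r. x \<le> r \<and> r \<le> x + L \<and> (\<forall>t\<in>{r..r + \<eta>}. \<epsilon> \<le> g t)"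
  shows "\<exists>\<alpha>>0. \<exists>C. \<forall>s\<ge>0. \<forall>t\<ge>s. \<alpha> * (t - s) - C \<le> M t - M s"
proof -
  have mono: "M s \<le> M t" if "0 \<le> s" "s \<le> t" for s t
    using has_real_derivative_nonneg_mono[OF that, of M g] der nn that by auto
  define P where "P = L + \<eta>"
  have P: "P > 0" using pos unfolding P_def by simp
  have step: "M x + \<epsilon> * \<eta> \<le> M (x + P)" if x: "0 \<le> x" for x
  proof -
    obtain r where r: "x \<le> r" "r \<le> x + L" "\<And>t. r \<le> t \<Longrightarrow> t \<le> r + \<eta> \<Longrightarrow> \<epsilon> \<le> g t"
      using win[of x] by auto
    have "M r - \<epsilon> * r \<le> M (r + \<eta>) - \<epsilon> * (r + \<eta>)"
      by (rule has_real_derivative_nonneg_mono[where f' = "\<lambda>t. g t - \<epsilon>"])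
        (use x r pos in \<open>auto intro!: derivative_eq_intros der\<close>)
    moreover have "M x \<le> M r" "M (r + \<eta>) \<le> M (x + P)"
      using x r(1,2) pos by (auto intro!: mono simp: P_def)
    ultimately show ?thesis by (simp add: algebra_simps)
  qed
  have steps: "M x + real k * (\<epsilon> * \<eta>) \<le> M (x + real k * P)" if x: "0 \<le> x" for x k
  proof (induction k)
    case (Suc k)
    then show ?case using step[of "x + real k * P"] x P by (simp add: algebra_simps)
  qed simp
  have "\<epsilon> * \<eta> / P * (t - s) - \<epsilon> * \<eta> \<le> M t - M s" if st: "0 \<le> s" "s \<le> t" for s t
  proof -
    define k where "k = nat \<lfloor>(t - s) / P\<rfloor>"
    have q: "0 \<le> (t - s) / P" using st P by simp
    then have k: "real k \<le> (t - s) / P" "(t - s) / P < real k + 1" unfolding k_def by linarith+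
    have "real k * P \<le> t - s" using k(1) P by (simp add: pos_le_divide_eq)
    then have "M (s + real k * P) \<le> M t" using st P by (intro mono) auto
    moreover have "\<epsilon> * \<eta> * ((t - s) / P) \<le> \<epsilon> * \<eta> * (real k + 1)"
      using k(2) pos by (intro mult_left_mono) auto
    ultimately show ?thesis using steps[OF st(1), of k] by (simp add: algebra_simps)
  qed
  moreover have "\<epsilon> * \<eta> / P > 0" using pos P by simp
  ultimately show ?thesis by blast
qed

section \<open>Nonnegativity for cooperative systems and the method of steps\<close>

text \<open>The square of the negative part is differentiable even at 0, so it measures the failure
  of nonnegativity without any smoothing.\<close>

lemma has_real_derivative_min_zero_square:
  "((\<lambda>x::real. (min x 0)\<^sup>2) has_real_derivative 2 * min x 0) (at x)"
proof -
  consider "x < 0" | "x > 0" | "x = 0" by linarith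
  then show ?thesis
  proof cases
    case 1
    have "((\<lambda>x::real. x\<^sup>2) has_real_derivative 2 * min x 0) (at x)"
      using 1 by (auto intro!: derivative_eq_intros)
    then show ?thesis
      by (rule has_field_derivative_transform_within_open[of _ _ _ "{..<0}"]) (use 1 in auto)
  next
    case 2
    have "((\<lambda>x::real. 0) has_real_derivative 2 * min x 0) (at x)" using 2 by simp
    then show ?thesis
      by (rule has_field_derivative_transform_within_open[of _ _ _ "{0<..}"]) (use 2 in auto)
  next
    case 3
    have "((\<lambda>y::real. ((min y 0)\<^sup>2 - (min 0 0)\<^sup>2) / (y - 0)) \<longlongrightarrow> 0) (at 0)"
    proof (rule Lim_null_comparison[OF _ tendsto_norm_zero[OF tendsto_ident_at]])
      show "\<forall>\<^sub>F y in at (0::real). norm (((min y 0)\<^sup>2 - (min 0 0)\<^sup>2) / (y - 0)) \<le> norm y"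
        by (rule always_eventually) (auto simp: power2_eq_square min_def)
    qed
    then show ?thesis using 3 by (simp add: has_field_derivative_iff)
  qed
qed

text \<open>Gronwall's inequality for the sum of the squared negative parts. Cooperativity enters
  through \<open>v i * u l \<le> v i * v l\<close>: a positive component can only push a negative
  one upwards.\<close>

lemma cooperative_ode_nonneg:
  fixes u u' :: "'i \<Rightarrow> real \<Rightarrow> real"
  assumes S: "finite S" and pq: "0 \<le> p" "p \<le> q"
    and der: "\<And>i t. i \<in> S \<Longrightarrow> p \<le> t \<Longrightarrow> t \<le> q \<Longrightarrow> (u i has_real_derivative u' i t) (at t within {0..})"
    and ini: "\<And>i. i \<in> S \<Longrightarrow> 0 \<le> u i p"
    and ineq: "\<And>i t. i \<in> S \<Longrightarrow> p \<le> t \<Longrightarrow> t \<le> q \<Longrightarrow>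
        - d i t * u i t + (\<Sum>l\<in>S. a i l t * u l t) \<le> u' i t"
    and d: "\<And>i t. i \<in> S \<Longrightarrow> p \<le> t \<Longrightarrow> t \<le> q \<Longrightarrow> \<bar>d i t\<bar> \<le> K"
    and a: "\<And>i l t. i \<in> S \<Longrightarrow> l \<in> S \<Longrightarrow> p \<le> t \<Longrightarrow> t \<le> q \<Longrightarrow> 0 \<le> a i l t \<and> a i l t \<le> K"
    and it: "i \<in> S" "p \<le> t" "t \<le> q"
  shows "0 \<le> u i t"
proof -
  have K: "0 \<le> K" using d[OF it(1) _ pq(2)] pq by (meson abs_ge_zero order_refl order_trans)
  define v where "v i t = min (u i t) 0" for i t
  define P where "P t = (\<Sum>i\<in>S. (v i t)\<^sup>2)" for t
  define C where "C = 2 * K + 2 * K * real (card S)"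
  have summand: "2 * v i s * u' i s \<le> 2 * K * (v i s)\<^sup>2 + K * (\<Sum>l\<in>S. (v i s)\<^sup>2 + (v l s)\<^sup>2)"
    if i: "i \<in> S" and s: "p \<le> s" "s \<le> q" for i s
  proof -
    have v0: "v i s \<le> 0" by (simp add: v_def)
    have "v i s * u' i s \<le> v i s * (- d i s * u i s + (\<Sum>l\<in>S. a i l s * u l s))"
      using ineq[OF i s] v0 by (rule mult_left_mono_neg)
    also have "\<dots> = - d i s * (v i s)\<^sup>2 + (\<Sum>l\<in>S. a i l s * (v i s * u l s))"
      by (auto simp: v_def min_def algebra_simps sum_distrib_left power2_eq_square)
    also have "\<dots> \<le> K * (v i s)\<^sup>2 + (\<Sum>l\<in>S. K * (((v i s)\<^sup>2 + (v l s)\<^sup>2) / 2))"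
    proof (intro add_mono sum_mono mult_right_mono)
      show "- d i s \<le> K" using d[OF i s] by auto
      fix l assume l: "l \<in> S"
      have "v i s * u l s \<le> v i s * v l s" using v0 by (intro mult_left_mono_neg) (auto simp: v_def)
      also have "\<dots> \<le> ((v i s)\<^sup>2 + (v l s)\<^sup>2) / 2" using sum_squares_bound[of "v i s" "v l s"] by simp
      finally show "a i l s * (v i s * u l s) \<le> K * (((v i s)\<^sup>2 + (v l s)\<^sup>2) / 2)"
        using a[OF i l s] by (meson mult_left_mono mult_right_mono order_trans sum_power2_ge_zero divide_nonneg_pos zero_less_numeral)
    qed simp
    finally show ?thesis
      by (simp add: sum_distrib_left[symmetric] sum_divide_distrib[symmetric])
  qed
  have "P t \<le> exp (C * (t - p)) * P p"
  proof (rule differential_inequality_upper[OF pq(1) it(2), where f' = "\<lambda>t. \<Sum>i\<in>S. 2 * v i t * u' i t"])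
    fix s assume s: "p \<le> s" "s \<le> t"
    then have sq: "s \<le> q" using it by simp
    show "(P has_real_derivative (\<Sum>i\<in>S. 2 * v i s * u' i s)) (at s within {0..})"
      unfolding P_def
    proof (rule DERIV_sum)
      fix i assume "i \<in> S"
      from DERIV_chain2[OF has_real_derivative_min_zero_square der[OF this s(1) sq]]
      show "((\<lambda>x. (v i x)\<^sup>2) has_real_derivative 2 * v i s * u' i s) (at s within {0..})"
        by (simp add: v_def)
    qed
    have "(\<Sum>i\<in>S. 2 * v i s * u' i s) \<le> (\<Sum>i\<in>S. 2 * K * (v i s)\<^sup>2 + K * (\<Sum>l\<in>S. (v i s)\<^sup>2 + (v l s)\<^sup>2))"
      using summand s(1) sq by (intro sum_mono) auto
    also have "\<dots> = C * P s"
      by (simp add: C_def P_def sum.distrib sum_distrib_left[symmetric] algebra_simps)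
    finally show "(\<Sum>i\<in>S. 2 * v i s * u' i s) \<le> C * P s" .
  qed
  also have "P p = 0" using ini by (auto simp: P_def v_def intro!: sum.neutral)
  finally have "P t \<le> 0" by simp
  have "(v i t)\<^sup>2 \<le> P t" unfolding P_def by (rule member_le_sum[OF it(1) _ S]) simp
  then have "(v i t)\<^sup>2 \<le> 0" using \<open>P t \<le> 0\<close> by linarith
  then show ?thesis unfolding v_def by (auto simp: min_def split: if_splits)
qed

text \<open>The method of steps as an induction rule. With steps no longer than the smallest delay,
  all delayed arguments lie in the part up to \<open>r\<close>, where \<open>Q\<close> is already
  known.\<close>

lemma step_induct:
  fixes \<tau> :: "'i \<Rightarrow> real"
  assumes S: "finite S" and \<tau>: "\<And>i. i \<in> S \<Longrightarrow> 0 < \<tau> i"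
    and base: "\<And>i t. i \<in> S \<Longrightarrow> p - \<tau> i \<le> t \<Longrightarrow> t \<le> p \<Longrightarrow> Q i t"
    and step: "\<And>r i t. p \<le> r \<Longrightarrow> r \<le> q \<Longrightarrow> (\<And>i t. i \<in> S \<Longrightarrow> p - \<tau> i \<le> t \<Longrightarrow> t \<le> r \<Longrightarrow> Q i t) \<Longrightarrow>
       i \<in> S \<Longrightarrow> r \<le> t \<Longrightarrow> t \<le> q \<Longrightarrow> (\<And>i. i \<in> S \<Longrightarrow> t - \<tau> i \<le> r) \<Longrightarrow> Q i t"
    and it: "i \<in> S" "p - \<tau> i \<le> t" "t \<le> q"
  shows "Q i t"
proof -
  define \<delta> where "\<delta> = Min (\<tau> ` S)"
  have "S \<noteq> {}" using it(1) by blast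
  then have \<delta>: "0 < \<delta>" "\<And>i. i \<in> S \<Longrightarrow> \<delta> \<le> \<tau> i"
    using S \<tau> unfolding \<delta>_def by simp_all
  have "\<forall>i\<in>S. \<forall>t. p - \<tau> i \<le> t \<and> t \<le> min q (p + real k * \<delta>) \<longrightarrow> Q i t" for k
  proof (induction k)
    case 0
    then show ?case using base by auto
  next
    case (Suc k)
    define r where "r = p + real k * \<delta>"
    show ?case
    proof (intro ballI allI impI)
      fix i t assume i: "i \<in> S" and t: "p - \<tau> i \<le> t \<and> t \<le> min q (p + real (Suc k) * \<delta>)"
      show "Q i t"
      proof (cases "t \<le> r")
        case True then show ?thesis using Suc i t by (auto simp: r_def)
      next
        case False
        have tr: "t \<le> r + \<delta>" using t by (simp add: r_def algebra_simps)
        show ?thesis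
        proof (rule step[of r])
          show "p \<le> r" using \<delta> by (simp add: r_def)
          show "r \<le> q" "r \<le> t" "t \<le> q" using False t by auto
          show "Q j s" if "j \<in> S" "p - \<tau> j \<le> s" "s \<le> r" for j s
            using Suc that \<open>r \<le> q\<close> by (auto simp: r_def)
          show "t - \<tau> j \<le> r" if "j \<in> S" for j using \<delta>(2)[OF that] tr by simp
        qed (rule i)
      qed
    qed
  qed
  moreover obtain k where "(q - p) / \<delta> \<le> real k" using real_arch_simple by blast
  then have "q \<le> p + real k * \<delta>" using \<delta>(1) by (simp add: pos_divide_le_eq)
  ultimately show ?thesis using it by (metis min.absorb1)
qed

text \<open>On each step the delayed values are already nonnegative, so the differential inequality
  is required only under that hypothesis and shows no delayed term. This admits every delayed
  feedback that is nonnegative at nonnegative values. The growth, doubling and extinction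
  comparisons apply it to a difference of two functions.\<close>

lemma cooperative_delay_nonneg:
  fixes u u' :: "'i \<Rightarrow> real \<Rightarrow> real"
  assumes S: "finite S" and p: "0 \<le> p" and \<tau>: "\<And>i. i \<in> S \<Longrightarrow> 0 < \<tau> i"
    and der: "\<And>i t. i \<in> S \<Longrightarrow> p \<le> t \<Longrightarrow> t \<le> q \<Longrightarrow> (u i has_real_derivative u' i t) (at t within {0..})"
    and ini: "\<And>i t. i \<in> S \<Longrightarrow> p - \<tau> i \<le> t \<Longrightarrow> t \<le> p \<Longrightarrow> 0 \<le> u i t"
    and ineq: "\<And>i t. i \<in> S \<Longrightarrow> p \<le> t \<Longrightarrow> t \<le> q \<Longrightarrow> 0 \<le> u i (t - \<tau> i) \<Longrightarrow>
        - d i t * u i t + (\<Sum>l\<in>S. a i l t * u l t) \<le> u' i t"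
    and d: "\<And>i t. i \<in> S \<Longrightarrow> p \<le> t \<Longrightarrow> t \<le> q \<Longrightarrow> \<bar>d i t\<bar> \<le> K"
    and a: "\<And>i l t. i \<in> S \<Longrightarrow> l \<in> S \<Longrightarrow> p \<le> t \<Longrightarrow> t \<le> q \<Longrightarrow> 0 \<le> a i l t \<and> a i l t \<le> K"
    and it: "i \<in> S" "p - \<tau> i \<le> t" "t \<le> q"
  shows "0 \<le> u i t"
proof (rule step_induct[where S = S and \<tau> = \<tau> and Q = "\<lambda>i t. 0 \<le> u i t" and p = p and q = q, OF S \<tau> ini _ it])
  fix r i t
  assume r: "p \<le> r" "r \<le> q" and Q: "\<And>i t. i \<in> S \<Longrightarrow> p - \<tau> i \<le> t \<Longrightarrow> t \<le> r \<Longrightarrow> 0 \<le> u i t"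
    and i: "i \<in> S" and t: "r \<le> t" "t \<le> q" and del: "\<And>i. i \<in> S \<Longrightarrow> t - \<tau> i \<le> r"
  show "0 \<le> u i t"
  proof (rule cooperative_ode_nonneg[where S = S and u = u and p = r and q = t and d = d and a = a and K = K and u' = u', OF S])
    show "0 \<le> u i r" if "i \<in> S" for i using Q[OF that, of r] \<tau>[OF that] r by simp
    fix i s assume i: "i \<in> S" and s: "r \<le> s" "s \<le> t"
    show "(u i has_real_derivative u' i s) (at s within {0..})" "\<bar>d i s\<bar> \<le> K"
      using der d i s r t by auto
    show "0 \<le> a i l s \<and> a i l s \<le> K" if "l \<in> S" for l using a[OF i that, of s] s r t by auto
    have "0 \<le> u i (s - \<tau> i)" using s r del[OF i] by (intro Q i) auto
    then show "- d i s * u i s + (\<Sum>l\<in>S. a i l s * u l s) \<le> u' i s"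
      using ineq[OF i, of s] s r t by auto
  qed (use p r t i in auto)
qed

text \<open>Within one step the delayed values of two solutions agree, so the terms with
  \<open>g\<close> cancel for an arbitrary \<open>g\<close>. The difference then solves a linear
  cooperative system without delay, with either order of the two solutions, and is nonnegative both
  times.\<close>

lemma affine_delay_solution_unique:
  assumes S: "finite S" and \<tau>: "\<And>i. i \<in> S \<Longrightarrow> 0 < \<tau> i"
    and f: "\<And>i t x w. f i t x w = - d i t * x i + (\<Sum>l\<in>S. a i l t * x l) + g i t (w i)"
    and d: "\<And>i t. i \<in> S \<Longrightarrow> 0 \<le> t \<Longrightarrow> \<bar>d i t\<bar> \<le> K"
    and a: "\<And>i l t. i \<in> S \<Longrightarrow> l \<in> S \<Longrightarrow> 0 \<le> t \<Longrightarrow> 0 \<le> a i l t \<and> a i l t \<le> K"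
    and y: "is_delay_solution S \<tau> f \<phi> y" and x: "is_delay_solution S \<tau> f \<phi> x"
  shows "y = x"
proof -
  have yx: "y i t = x i t" if it: "i \<in> S" "0 - \<tau> i \<le> t" for i t
  proof (rule step_induct[where S = S and \<tau> = \<tau> and Q = "\<lambda>i t. y i t = x i t" and p = 0 and q = "t" and i = i, OF S \<tau>])
    show "y i t = x i t" if "i \<in> S" "0 - \<tau> i \<le> t" "t \<le> 0" for i t
      using y x that unfolding is_delay_solution_def by auto
  next
    fix r i t
    assume r: "0 \<le> r" and Q: "\<And>i t. i \<in> S \<Longrightarrow> 0 - \<tau> i \<le> t \<Longrightarrow> t \<le> r \<Longrightarrow> y i t = x i t"
      and i: "i \<in> S" and t: "r \<le> t" and del: "\<And>i. i \<in> S \<Longrightarrow> t - \<tau> i \<le> r"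
    have le: "0 \<le> y i t - x i t"
      if y: "is_delay_solution S \<tau> f \<phi> y" and x: "is_delay_solution S \<tau> f \<phi> x"
        and Q: "\<And>i t. i \<in> S \<Longrightarrow> 0 - \<tau> i \<le> t \<Longrightarrow> t \<le> r \<Longrightarrow> y i t = x i t" for x y
    proof (rule cooperative_ode_nonneg[where S = S and p = r and q = t and d = d and a = a and K = K and
          u = "\<lambda>i t. y i t - x i t" and u' = "\<lambda>i t. f i t (\<lambda>l. y l t) (\<lambda>l. y l (t - \<tau> l)) - f i t (\<lambda>l. x l t) (\<lambda>l. x l (t - \<tau> l))", OF S])
      fix i s assume i: "i \<in> S" and s: "r \<le> s" "s \<le> t"
      show "((\<lambda>t. y i t - x i t) has_real_derivative f i s (\<lambda>l. y l s) (\<lambda>l. y l (s - \<tau> l)) - f i s (\<lambda>l. x l s) (\<lambda>l. x l (s - \<tau> l)))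
          (at s within {0..})"
        using y x i s r unfolding is_delay_solution_def by (intro DERIV_diff) auto
      have "y i (s - \<tau> i) = x i (s - \<tau> i)" using s r del[OF i] by (intro Q i) auto
      then show "- d i s * (y i s - x i s) + (\<Sum>l\<in>S. a i l s * (y l s - x l s))
          \<le> f i s (\<lambda>l. y l s) (\<lambda>l. y l (s - \<tau> l)) - f i s (\<lambda>l. x l s) (\<lambda>l. x l (s - \<tau> l))"
        by (simp add: f algebra_simps sum_subtractf)
    next
      show "0 \<le> y i r - x i r" if "i \<in> S" for i using Q[OF that, of r] \<tau>[OF that] r by simp
    qed (use r t i d a in auto)
    have "0 \<le> y i t - x i t" using y x Q by (rule le)
    moreover have "0 \<le> x i t - y i t" using x y Q[symmetric] by (rule le)
    ultimately show "y i t = x i t" by simp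
  qed (use it in auto)
  show ?thesis
  proof (intro ext)
    fix i t show "y i t = x i t"
    proof (cases "i \<in> S \<and> - \<tau> i \<le> t")
      case True then show ?thesis using yx by simp
    next
      case False then show ?thesis using y x unfolding is_delay_solution_def by auto
    qed
  qed
qed

section \<open>Existence of solutions\<close>

lemma has_real_derivative_integral:
  fixes g :: "real \<Rightarrow> real"
  assumes g: "continuous_on {0..} g" and t: "0 \<le> t"
  shows "((\<lambda>t. integral {0..t} g) has_real_derivative g t) (at t within {0..})"
proof -
  have "((\<lambda>t. integral {0..t} g) has_real_derivative g t) (at t within {0..t + 1})"
    by (rule integral_has_real_derivative) (use t in \<open>auto intro: continuous_on_subset[OF g]\<close>)
  moreover have "at t within {0..t + 1} = at t within {0..}"
    by (rule at_within_nhd[of _ "{..<t + 1}"]) auto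
  ultimately show ?thesis by simp
qed

text \<open>In the norm weighted by \<open>exp (- \<Lambda> * t)\<close>, integration from 0 has
  norm at most \<open>1 / \<Lambda>\<close>; this produces the contraction factor of the Picard
  map.\<close>

lemma antiderivative_exp_bound:
  fixes G g :: "real \<Rightarrow> real"
  assumes der: "\<And>t. 0 \<le> t \<Longrightarrow> (G has_real_derivative g t) (at t within {0..})" and "G 0 = 0"
    and bd: "\<And>t. 0 \<le> t \<Longrightarrow> \<bar>g t\<bar> \<le> C * exp (\<Lambda> * t)" and \<Lambda>: "0 < \<Lambda>" and t: "0 \<le> t"
  shows "\<bar>G t\<bar> \<le> C / \<Lambda> * exp (\<Lambda> * t)"
proof -
  have C: "0 \<le> C / \<Lambda>" using bd[of 0] \<Lambda> by simp
  have e: "((\<lambda>t. C / \<Lambda> * exp (\<Lambda> * t)) has_real_derivative C * exp (\<Lambda> * s)) (at s within {0..})" for s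
    using \<Lambda> by (auto intro!: derivative_eq_intros)
  have "C / \<Lambda> * exp (\<Lambda> * 0) - G 0 \<le> C / \<Lambda> * exp (\<Lambda> * t) - G t"
  proof (rule has_real_derivative_nonneg_mono[where
        f = "\<lambda>t. C / \<Lambda> * exp (\<Lambda> * t) - G t" and f' = "\<lambda>s. C * exp (\<Lambda> * s) - g s"])
    show "((\<lambda>t. C / \<Lambda> * exp (\<Lambda> * t) - G t) has_real_derivative C * exp (\<Lambda> * s) - g s) (at s within {0..})"
      if "0 \<le> s" for s using DERIV_diff[OF e der[OF that]] .
    show "0 \<le> C * exp (\<Lambda> * s) - g s" if "0 \<le> s" for s using bd[OF that] by linarith
  qed (use t in auto)
  moreover have "C / \<Lambda> * exp (\<Lambda> * 0) + G 0 \<le> C / \<Lambda> * exp (\<Lambda> * t) + G t"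
  proof (rule has_real_derivative_nonneg_mono[where
        f = "\<lambda>t. C / \<Lambda> * exp (\<Lambda> * t) + G t" and f' = "\<lambda>s. C * exp (\<Lambda> * s) + g s"])
    show "((\<lambda>t. C / \<Lambda> * exp (\<Lambda> * t) + G t) has_real_derivative C * exp (\<Lambda> * s) + g s) (at s within {0..})"
      if "0 \<le> s" for s using DERIV_add[OF e der[OF that]] .
    show "0 \<le> C * exp (\<Lambda> * s) + g s" if "0 \<le> s" for s using bd[OF that] by linarith
  qed (use t in auto)
  ultimately show ?thesis using C \<open>G 0 = 0\<close> by simp
qed

text \<open>The product with a discrete space is a disjoint union of open copies of the line, so
  continuity can be checked on each copy.\<close>

lemma continuous_on_discrete_times:
  fixes h :: "nat discrete \<times> real \<Rightarrow> real"
  assumes "\<And>i. continuous_on UNIV (\<lambda>t. h (i, t))"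
  shows "continuous_on UNIV h"
proof -
  have "continuous_on (\<Union>i. {i} \<times> UNIV) h"
  proof (rule continuous_on_open_UN)
    show "open ({i} \<times> UNIV :: (nat discrete \<times> real) set)" for i
      by (intro open_Times Discrete_Topology.open_discrete open_UNIV)
    show "continuous_on ({i} \<times> UNIV) h" for i
    proof -
      have "continuous_on ({i} \<times> UNIV) (\<lambda>x. h (i, snd x))"
        by (rule continuous_on_compose2[OF assms[of i]]) (auto intro: continuous_intros)
      then show ?thesis by (rule continuous_on_eq) auto
    qed
  qed
  moreover have "(\<Union>i. {i} \<times> UNIV) = (UNIV :: (nat discrete \<times> real) set)" by auto
  ultimately show ?thesis by simp
qed

lemma phase_space_bounded:
  assumes "finite S" "\<phi> \<in> phase_space S \<tau>"
  shows "\<exists>B\<ge>0. \<forall>i\<in>S. \<forall>s\<in>{-\<tau> i..0}. \<bar>\<phi> i s\<bar> \<le> B"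
proof -
  have "\<exists>b. \<forall>s\<in>{-\<tau> i..0}. \<bar>\<phi> i s\<bar> \<le> b" if "i \<in> S" for i
  proof -
    have "compact (\<phi> i ` {-\<tau> i..0})"
      using assms(2) that unfolding phase_space_def by (intro compact_continuous_image) auto
    then have "bounded (\<phi> i ` {-\<tau> i..0})" by (rule compact_imp_bounded)
    then show ?thesis unfolding bounded_iff by auto
  qed
  then obtain b where b: "\<And>i s. i \<in> S \<Longrightarrow> s \<in> {-\<tau> i..0} \<Longrightarrow> \<bar>\<phi> i s\<bar> \<le> b i" by metis
  have "\<bar>\<phi> i s\<bar> \<le> (\<Sum>i\<in>S. \<bar>b i\<bar>)" if "i \<in> S" "s \<in> {-\<tau> i..0}" for i s
    using b[OF that] member_le_sum[of i S "\<lambda>i. \<bar>b i\<bar>"] that assms(1) by force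
  then show ?thesis by (intro exI[of _ "\<Sum>i\<in>S. \<bar>b i\<bar>"]) (auto intro: sum_nonneg)
qed

text \<open>The unknown of the contraction is \<open>v i t = exp (-\<Lambda> t) (y i t - \<phi> i 0)\<close>; the discrete index
  makes the space of such families an instance of bounded continuous functions.\<close>

lemma lipschitz_delay_solution_exists:
  fixes f :: "nat \<Rightarrow> real \<Rightarrow> (nat \<Rightarrow> real) \<Rightarrow> (nat \<Rightarrow> real) \<Rightarrow> real"
  assumes S: "finite S" and \<tau>: "\<And>i. i \<in> S \<Longrightarrow> 0 < \<tau> i" and \<phi>: "\<phi> \<in> phase_space S \<tau>"
    and cont: "\<And>i x w. i \<in> S \<Longrightarrow> (\<And>l. l \<in> S \<Longrightarrow> continuous_on {0..} (x l)) \<Longrightarrow>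
        (\<And>l. l \<in> S \<Longrightarrow> continuous_on {0..} (w l)) \<Longrightarrow>
        continuous_on {0..} (\<lambda>t. f i t (\<lambda>l. x l t) (\<lambda>l. w l t))"
    and lip: "\<And>i t x x' w w'. i \<in> S \<Longrightarrow> 0 \<le> t \<Longrightarrow>
        \<bar>f i t x w - f i t x' w'\<bar> \<le> K * (\<Sum>l\<in>S. \<bar>x l - x' l\<bar> + \<bar>w l - w' l\<bar>)"
    and K: "0 \<le> K"
    and zero: "\<And>i t. i \<in> S \<Longrightarrow> 0 \<le> t \<Longrightarrow> f i t (\<lambda>_. 0) (\<lambda>_. 0) = 0"
  shows "\<exists>y. is_delay_solution S \<tau> f \<phi> y"
proof -
  obtain B where B: "0 \<le> B" "\<And>i s. i \<in> S \<Longrightarrow> -\<tau> i \<le> s \<Longrightarrow> s \<le> 0 \<Longrightarrow> \<bar>\<phi> i s\<bar> \<le> B"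
    using phase_space_bounded[OF S \<phi>] by force
  define N where "N = K * (2 * real (card S))"
  have N: "0 \<le> N" using K by (simp add: N_def)
  \<comment> \<open>With \<open>N\<close> bounding the effect of present and delayed arguments
    together, the Picard map contracts by \<open>N / \<Lambda>\<close>, which is below 1/2.\<close>
  define \<Lambda> where "\<Lambda> = 2 * N + 1"
  have \<Lambda>: "0 < \<Lambda>" using N by (simp add: \<Lambda>_def)
  \<comment> \<open>Extends \<open>\<phi>\<close> continuously to the whole line by its end
    values.\<close>
  define e where "e i t = \<phi> i (max (-\<tau> i) (min t 0))" for i t
  have e_cont: "continuous_on UNIV (e i)" if "i \<in> S" for i
    unfolding e_def
    by (rule continuous_on_compose2[of "{-\<tau> i..0}" "\<phi> i"])
      (use \<phi> \<tau>[OF that] that in \<open>auto simp: phase_space_def intro!: continuous_intros\<close>)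
  have e_bd: "\<bar>e i t\<bar> \<le> B" if "i \<in> S" for i t
    unfolding e_def using \<tau>[OF that] by (intro B that) auto
  \<comment> \<open>The candidate solution coded by \<open>v\<close>. At negative times the unknown
    is frozen at its value at time 0, which vanishes for a fixed point and so restores the initial
    map.\<close>
  define Y where "Y v i t = e i t + exp (\<Lambda> * max t 0) * apply_bcontfun v (discrete i, max t 0)"
    for v :: "(nat discrete \<times> real) \<Rightarrow>\<^sub>C real" and i t
  have v_cont: "continuous_on UNIV (\<lambda>t. apply_bcontfun v (discrete i, max t 0))" for v :: "(nat discrete \<times> real) \<Rightarrow>\<^sub>C real" and i
    by (rule continuous_on_compose2[of UNIV "apply_bcontfun v"]) (auto intro!: continuous_intros)
  have Y_cont: "continuous_on UNIV (Y v i)" if "i \<in> S" for v i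
    unfolding Y_def by (intro continuous_intros e_cont that v_cont)
  define R where "R v i t = f i t (\<lambda>l. Y v l t) (\<lambda>l. Y v l (t - \<tau> l))" for v i t
  have R_cont: "continuous_on {0..} (R v i)" if "i \<in> S" for v i
    unfolding R_def
  proof (rule cont[OF that])
    show "continuous_on {0..} (Y v l)" if "l \<in> S" for l
      using Y_cont[OF that] continuous_on_subset by blast
    show "continuous_on {0..} (\<lambda>t. Y v l (t - \<tau> l))" if "l \<in> S" for l
      by (rule continuous_on_compose2[OF Y_cont[OF that]]) (auto intro!: continuous_intros)
  qed
  define G where "G v i t = integral {0..t} (R v i)" for v i t
  have G_der: "(G v i has_real_derivative R v i t) (at t within {0..})" if "i \<in> S" "0 \<le> t" for v i t
    unfolding G_def by (rule has_real_derivative_integral[OF R_cont that(2)]) (rule that)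
  have G0: "G v i 0 = 0" for v i by (simp add: G_def)
  have sum_le: "K * (\<Sum>l\<in>S. p l + q l) \<le> N * b" if "\<And>l. l \<in> S \<Longrightarrow> p l \<le> b" "\<And>l. l \<in> S \<Longrightarrow> q l \<le> b" for p q b
  proof -
    have "(\<Sum>l\<in>S. p l + q l) \<le> (\<Sum>l\<in>S. b + b)" by (intro sum_mono add_mono that)
    then show ?thesis using K by (simp add: N_def mult_left_mono algebra_simps)
  qed
  have exp_max: "exp (\<Lambda> * max (t - \<tau> l) 0) \<le> exp (\<Lambda> * t)" if "0 \<le> t" "l \<in> S" for t l
    using \<Lambda> \<tau>[OF that(2)] that by (auto intro!: mult_left_mono)
  have Y_bd: "\<bar>Y v l s\<bar> \<le> (B + norm v) * exp (\<Lambda> * t)"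
    if "l \<in> S" "max s 0 \<le> t" for v l s t
  proof -
    have "\<bar>Y v l s\<bar> \<le> \<bar>e l s\<bar> + \<bar>exp (\<Lambda> * max s 0) * apply_bcontfun v (discrete l, max s 0)\<bar>"
      unfolding Y_def by (rule abs_triangle_ineq)
    also have "\<dots> \<le> B * exp (\<Lambda> * t) + exp (\<Lambda> * t) * norm v"
    proof (rule add_mono)
      have "B * 1 \<le> B * exp (\<Lambda> * t)" using B(1) \<Lambda> that(2) by (intro mult_left_mono) auto
      then show "\<bar>e l s\<bar> \<le> B * exp (\<Lambda> * t)" using e_bd[OF that(1), of s] by simp
      have "\<bar>apply_bcontfun v (discrete l, max s 0)\<bar> \<le> norm v" using norm_bounded[of v "(discrete l, max s 0)"] by simp
      then show "\<bar>exp (\<Lambda> * max s 0) * apply_bcontfun v (discrete l, max s 0)\<bar> \<le> exp (\<Lambda> * t) * norm v"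
        using \<Lambda> that(2) by (auto simp: abs_mult intro!: mult_mono)
    qed
    finally show ?thesis by (simp add: algebra_simps)
  qed
  have Y_diff: "\<bar>Y v l s - Y w l s\<bar> \<le> exp (\<Lambda> * t) * dist v w" if "max s 0 \<le> t" for v w l s t
  proof -
    have "\<bar>Y v l s - Y w l s\<bar> = exp (\<Lambda> * max s 0) * dist (apply_bcontfun v (discrete l, max s 0)) (apply_bcontfun w (discrete l, max s 0))"
      by (simp add: Y_def dist_real_def abs_mult right_diff_distrib[symmetric])
    also have "\<dots> \<le> exp (\<Lambda> * t) * dist v w"
      using \<Lambda> that by (intro mult_mono dist_bounded) auto
    finally show ?thesis .
  qed
  have R_bd: "\<bar>R v i t\<bar> \<le> N * (B + norm v) * exp (\<Lambda> * t)" if "i \<in> S" "0 \<le> t" for v i t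
  proof -
    have "\<bar>R v i t\<bar> \<le> K * (\<Sum>l\<in>S. \<bar>Y v l t\<bar> + \<bar>Y v l (t - \<tau> l)\<bar>)"
      using lip[OF that, of "\<lambda>l. Y v l t" "\<lambda>l. Y v l (t - \<tau> l)" "\<lambda>_. 0" "\<lambda>_. 0"] zero[OF that]
      by (simp add: R_def)
    also have "\<dots> \<le> N * ((B + norm v) * exp (\<Lambda> * t))"
      by (rule sum_le; rule Y_bd) (use that \<tau> in \<open>auto simp: less_imp_le add_increasing2\<close>)
    finally show ?thesis by simp
  qed
  have R_diff: "\<bar>R v i t - R w i t\<bar> \<le> N * dist v w * exp (\<Lambda> * t)" if "i \<in> S" "0 \<le> t" for v w i t
  proof -
    have "\<bar>R v i t - R w i t\<bar> \<le> K * (\<Sum>l\<in>S. \<bar>Y v l t - Y w l t\<bar> + \<bar>Y v l (t - \<tau> l) - Y w l (t - \<tau> l)\<bar>)"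
      unfolding R_def by (rule lip[OF that])
    also have "\<dots> \<le> N * (exp (\<Lambda> * t) * dist v w)"
      by (rule sum_le; rule Y_diff) (use that \<tau> in \<open>auto simp: less_imp_le add_increasing2\<close>)
    finally show ?thesis by (simp add: algebra_simps)
  qed
  have cancel: "exp (- \<Lambda> * s) * (c * exp (\<Lambda> * s)) = c" for s c
    by (simp add: exp_minus)
  \<comment> \<open>The Picard map in the coordinates \<open>v\<close>, set to 0 at indices outside
    \<open>S\<close>.\<close>
  define H where "H v = (\<lambda>(j, t). if of_discrete j \<in> S then exp (- \<Lambda> * max t 0) * G v (of_discrete j) (max t 0) else 0)" for v
  have H_bd: "\<bar>H v x\<bar> \<le> N * (B + norm v) / \<Lambda>" for v x
  proof (cases x)
    case (Pair j t)
    define i where "i = of_discrete j"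
    show ?thesis
    proof (cases "i \<in> S")
      case True
      have "\<bar>G v i (max t 0)\<bar> \<le> N * (B + norm v) / \<Lambda> * exp (\<Lambda> * max t 0)"
        by (rule antiderivative_exp_bound[OF G_der G0 R_bd \<Lambda>]) (use True in auto)
      then have "exp (- \<Lambda> * max t 0) * \<bar>G v i (max t 0)\<bar> \<le> exp (- \<Lambda> * max t 0) * (N * (B + norm v) / \<Lambda> * exp (\<Lambda> * max t 0))"
        by (rule mult_left_mono) simp
      also have "\<dots> = N * (B + norm v) / \<Lambda>" by (rule cancel)
      finally show ?thesis using True by (simp add: H_def Pair abs_mult i_def)
    qed (use N B \<Lambda> in \<open>simp add: H_def Pair i_def\<close>)
  qed
  have "H v \<in> bcontfun" for v
  proof -
    have "continuous_on UNIV (H v)"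
    proof (rule continuous_on_discrete_times)
      fix j :: "nat discrete"
      define i where "i = of_discrete j"
      show "continuous_on UNIV (\<lambda>t. H v (j, t))"
      proof (cases "i \<in> S")
        case True
        have "continuous_on {0..} (G v i)"
          using G_der[OF True] by (intro DERIV_continuous_on) auto
        then have "continuous_on UNIV (\<lambda>t. G v i (max t 0))"
          by (rule continuous_on_compose2) (auto intro!: continuous_intros)
        then show ?thesis using True by (auto simp: H_def i_def intro!: continuous_intros)
      qed (simp add: H_def i_def)
    qed
    moreover have "bounded (range (H v))" using H_bd unfolding bounded_iff by auto
    ultimately show ?thesis by (simp add: bcontfun_def)
  qed
  then have HB: "apply_bcontfun (Bcontfun (H v)) = H v" for v by (rule Bcontfun_inverse)
  have "\<exists>!v. Bcontfun (H v) = v"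
  proof (rule banach_fix_type[where c = "1/2" and f = "\<lambda>v. Bcontfun (H v)"])
    show "\<forall>v w. dist (Bcontfun (H v)) (Bcontfun (H w)) \<le> 1 / 2 * dist v w"
    proof (intro allI)
    fix v w
    show "dist (Bcontfun (H v)) (Bcontfun (H w)) \<le> 1 / 2 * dist v w"
    proof (rule dist_bound)
      fix x :: "nat discrete \<times> real"
      obtain j t where x: "x = (j, t)" by (cases x)
      define i where "i = of_discrete j"
      have "\<bar>H v x - H w x\<bar> \<le> 1 / 2 * dist v w"
      proof (cases "i \<in> S")
        case True
        have "\<bar>G v i (max t 0) - G w i (max t 0)\<bar> \<le> N * dist v w / \<Lambda> * exp (\<Lambda> * max t 0)"
          by (rule antiderivative_exp_bound[where g = "\<lambda>t. R v i t - R w i t"])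
            (use True in \<open>auto intro!: DERIV_diff G_der R_diff simp: G0 \<Lambda>\<close>)
        then have "exp (- \<Lambda> * max t 0) * \<bar>G v i (max t 0) - G w i (max t 0)\<bar>
            \<le> exp (- \<Lambda> * max t 0) * (N * dist v w / \<Lambda> * exp (\<Lambda> * max t 0))"
          by (rule mult_left_mono) simp
        also have "\<dots> = N * dist v w / \<Lambda>" by (rule cancel)
        also have "\<dots> = N / \<Lambda> * dist v w" by simp
        also have "\<dots> \<le> 1 / 2 * dist v w"
          using N by (intro mult_right_mono) (auto simp: \<Lambda>_def field_simps)
        finally show ?thesis using True by (simp add: H_def x i_def abs_mult right_diff_distrib[symmetric])
      qed (simp add: H_def x i_def)
      then show "dist (apply_bcontfun (Bcontfun (H v)) x) (apply_bcontfun (Bcontfun (H w)) x) \<le> 1 / 2 * dist v w"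
        by (simp add: HB dist_real_def)
    qed
    qed
  qed auto
  then obtain v where "Bcontfun (H v) = v" by blast
  then have vH: "apply_bcontfun v = H v" using HB by metis
  have Y_nonneg: "Y v i t = \<phi> i 0 + G v i t" if "i \<in> S" "0 \<le> t" for i t
    using that \<tau>[OF that(1)] by (simp add: Y_def vH H_def discrete_inverse e_def exp_minus max_def min_def)
  have Y_nonpos: "Y v i t = \<phi> i t" if "i \<in> S" "-\<tau> i \<le> t" "t \<le> 0" for i t
    using that by (simp add: Y_def vH H_def discrete_inverse e_def G0)
  define y where "y i t = (if i \<in> S \<and> -\<tau> i \<le> t then Y v i t else 0)" for i t
  have "is_delay_solution S \<tau> f \<phi> y"
    unfolding is_delay_solution_def
  proof (intro conjI ballI allI impI)
    fix i s assume "i \<in> S" "s \<in> {-\<tau> i..0}"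
    then show "y i s = \<phi> i s" by (simp add: y_def Y_nonpos)
  next
    fix i and t :: real assume "i \<notin> S \<or> t < - \<tau> i"
    then show "y i t = 0" by (auto simp: y_def)
  next
    fix i and t :: real assume i: "i \<in> S" and t: "0 \<le> t"
    have eq: "y i s = \<phi> i 0 + G v i s" if "s \<in> {0..}" for s
      using that i \<tau>[OF i] by (simp add: y_def Y_nonneg)
    have "((\<lambda>s. \<phi> i 0 + G v i s) has_real_derivative R v i t) (at t within {0..})"
      using G_der[OF i t, of v] by (auto intro!: derivative_eq_intros)
    then have "(y i has_real_derivative R v i t) (at t within {0..})"
      by (rule has_field_derivative_transform_within[OF _ zero_less_one]) (use t eq in auto)
    moreover have "R v i t = f i t (\<lambda>l. y l t) (\<lambda>l. y l (t - \<tau> l))"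
    proof -
      have "y l t = Y v l t" "y l (t - \<tau> l) = Y v l (t - \<tau> l)" if "l \<in> S" for l
        using that t \<tau>[OF that] by (auto simp: y_def)
      then show ?thesis
        \<comment> \<open>The two families of arguments agree on \<open>S\<close>, so the Lipschitz
          bound forces equal values of \<open>f\<close> although they may differ off
          \<open>S\<close>.\<close>
        using lip[OF i t, of "\<lambda>l. Y v l t" "\<lambda>l. Y v l (t - \<tau> l)" "\<lambda>l. y l t" "\<lambda>l. y l (t - \<tau> l)"]
        by (simp add: R_def)
    qed
    ultimately show "(y i has_real_derivative f i t (\<lambda>l. y l t) (\<lambda>l. y l (t - \<tau> l))) (at t within {0..})"
      by simp
  qed
  then show ?thesis by blast
qed

section \<open>The Ricker nonlinearity\<close>

text \<open>The slope of \<open>u * exp (- c * u)\<close> on the nonnegative half line lies between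
  -1 and 1. Increases are bounded through the decreasing exponential factor, decreases through
  \<open>1 - exp (- x) \<le> x\<close> and \<open>x * exp (- x) \<le> 1\<close>.\<close>

lemma ricker_lipschitz:
  fixes c u v :: real
  assumes "0 \<le> c" "0 \<le> u" "0 \<le> v"
  shows "\<bar>u * exp (- c * u) - v * exp (- c * v)\<bar> \<le> \<bar>u - v\<bar>"
proof -
  have *: "\<bar>v * exp (- c * v) - u * exp (- c * u)\<bar> \<le> v - u" if "0 \<le> u" "u \<le> v" for u v :: real
  proof -
    have e: "exp (- c * v) \<le> exp (- c * u)" using that assms(1) by (simp add: mult_left_mono)
    have e1: "exp (- c * u) \<le> 1" using that assms(1) by simp
    have "v * exp (- c * v) - u * exp (- c * u) \<le> (v - u) * exp (- c * u)"
      using mult_left_mono[OF e, of v] that by (simp add: algebra_simps)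
    also have "\<dots> \<le> v - u" using mult_left_mono[OF e1, of "v - u"] that by simp
    finally have 1: "v * exp (- c * v) - u * exp (- c * u) \<le> v - u" .
    have "u * exp (- c * u) - v * exp (- c * v) \<le> u * exp (- c * u) - u * exp (- c * v)"
      using that by (simp add: mult_right_mono)
    also have "\<dots> = u * exp (- c * u) * (1 - exp (- c * (v - u)))"
    proof -
      have "exp (- c * v) = exp (- c * u) * exp (- c * (v - u))"
        by (simp add: exp_add[symmetric] algebra_simps)
      then show ?thesis by (simp add: algebra_simps)
    qed
    also have "\<dots> \<le> u * exp (- c * u) * (c * (v - u))"
      using that exp_ge_add_one_self[of "- c * (v - u)"] by (intro mult_left_mono) auto
    also have "\<dots> = (c * u * exp (- (c * u))) * (v - u)" by (simp add: algebra_simps)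
    also have "\<dots> \<le> 1 * (v - u)"
    proof (rule mult_right_mono)
      have "c * u \<le> exp (c * u)" using exp_ge_add_one_self[of "c * u"] by linarith
      then show "c * u * exp (- (c * u)) \<le> 1" by (simp add: exp_minus divide_simps)
    qed (use that in simp)
    finally show ?thesis using 1 unfolding abs_le_iff by simp
  qed
  show ?thesis using *[of u v] *[of v u] assms by (cases "u \<le> v") (auto simp: abs_minus_commute)
qed

lemma ricker_le_inverse:
  fixes c u :: real
  assumes "0 < c"
  shows "u * exp (- c * u) \<le> 1 / c"
proof -
  have "c * u \<le> exp (c * u)" using exp_ge_add_one_self[of "c * u"] by linarith
  then show ?thesis using assms by (simp add: exp_minus field_simps)
qed

section \<open>The Nicholson system: standing constants and well-posedness\<close>

text \<open>\<open>K\<close> and \<open>h\<close> collect upper bounds of all coefficients and all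
  delays. The functions \<open>\<beta> i\<close> and the margin in \<open>dissipative\<close> are
  positive at each nonnegative time, but not uniformly so.\<close>

locale nicholson_system =
  fixes n :: nat and \<tau> :: "nat \<Rightarrow> real" and d \<beta> c :: "nat \<Rightarrow> real \<Rightarrow> real"
    and a :: "nat \<Rightarrow> nat \<Rightarrow> real \<Rightarrow> real" and K h c0 :: real
  assumes delay: "i \<in> {1..n} \<Longrightarrow> 0 < \<tau> i" "i \<in> {1..n} \<Longrightarrow> \<tau> i \<le> h"
    and ap: "i \<in> {1..n} \<Longrightarrow> almost_periodic (d i)" "i \<in> {1..n} \<Longrightarrow> almost_periodic (\<beta> i)"
      "i \<in> {1..n} \<Longrightarrow> almost_periodic (c i)" "i \<in> {1..n} \<Longrightarrow> j \<in> {1..n} \<Longrightarrow> almost_periodic (a i j)"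
    and n: "1 \<le> n" and K: "0 < K" and h: "0 < h" and c0: "0 < c0"
    and d_nonneg: "i \<in> {1..n} \<Longrightarrow> 0 \<le> d i t" and d_le: "i \<in> {1..n} \<Longrightarrow> d i t \<le> K"
    and a_nonneg: "i \<in> {1..n} \<Longrightarrow> j \<in> {1..n} \<Longrightarrow> 0 \<le> a i j t"
    and a_le: "i \<in> {1..n} \<Longrightarrow> j \<in> {1..n} \<Longrightarrow> a i j t \<le> K"
    and \<beta>_pos: "i \<in> {1..n} \<Longrightarrow> 0 \<le> t \<Longrightarrow> 0 < \<beta> i t" and \<beta>_le: "i \<in> {1..n} \<Longrightarrow> \<beta> i t \<le> K"
    and c_ge: "i \<in> {1..n} \<Longrightarrow> 0 \<le> t \<Longrightarrow> c0 \<le> c i t" and c_le: "i \<in> {1..n} \<Longrightarrow> c i t \<le> K"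
    and dissipative: "i \<in> {1..n} \<Longrightarrow> 0 \<le> t \<Longrightarrow> 0 < d i t - (\<Sum>j=1..n. a j i t)"
begin

abbreviation "sol \<equiv> nicholson_solution n \<tau> d a \<beta> c"

abbreviation "undelayed S y i t \<equiv> - d i t * y i t + (\<Sum>l\<in>S. a i l t * y l t)"

abbreviation "birth y i t \<equiv> \<beta> i t * (y i (t - \<tau> i) * exp (- c i t * y i (t - \<tau> i)))"

lemma \<beta>_nonneg: "i \<in> {1..n} \<Longrightarrow> 0 \<le> t \<Longrightarrow> 0 \<le> \<beta> i t"
  using \<beta>_pos by (meson less_imp_le)

lemma c_nonneg: "i \<in> {1..n} \<Longrightarrow> 0 \<le> t \<Longrightarrow> 0 \<le> c i t"
  using c_ge c0 by (meson less_imp_le order_trans)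

text \<open>Keeping the delayed term as an abstract Lipschitz function \<open>g\<close> covers the
  linear system and the truncated Nicholson system at once.\<close>

lemma affine_solution_exists:
  fixes g :: "nat \<Rightarrow> real \<Rightarrow> real \<Rightarrow> real"
  assumes S: "S \<subseteq> {1..n}" and \<phi>: "\<phi> \<in> phase_space S \<tau>"
    and lip: "\<And>i t u v. i \<in> S \<Longrightarrow> 0 \<le> t \<Longrightarrow> \<bar>g i t u - g i t v\<bar> \<le> K * \<bar>u - v\<bar>"
    and zero: "\<And>i t. i \<in> S \<Longrightarrow> 0 \<le> t \<Longrightarrow> g i t 0 = 0"
    and cont: "\<And>i w. i \<in> S \<Longrightarrow> continuous_on {0..} w \<Longrightarrow> continuous_on {0..} (\<lambda>t. g i t (w t))"
  shows "\<exists>y. is_delay_solution S \<tau> (\<lambda>i t x w. - d i t * x i + (\<Sum>l\<in>S. a i l t * x l) + g i t (w i)) \<phi> y"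
proof (rule lipschitz_delay_solution_exists[where K = "2 * K"])
  have fin: "finite S" using S finite_subset by blast
  then show "finite S" .
  show "0 < \<tau> i" if "i \<in> S" for i using that S delay by blast
  show "0 \<le> 2 * K" using K by simp
  show "- d i t * 0 + (\<Sum>l\<in>S. a i l t * 0) + g i t 0 = 0" if "i \<in> S" "0 \<le> t" for i t
    using zero[OF that] by simp
  fix i assume i: "i \<in> S"
  show "continuous_on {0..} (\<lambda>t. undelayed S x i t + g i t (w i t))"
    if "\<And>l. l \<in> S \<Longrightarrow> continuous_on {0..} (x l)" "\<And>l. l \<in> S \<Longrightarrow> continuous_on {0..} (w l)" for x w
  proof (intro continuous_intros cont that i)
    show "continuous_on {0..} (d i)" "\<And>l. l \<in> S \<Longrightarrow> continuous_on {0..} (a i l)"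
      using i S by (auto intro!: almost_periodic_continuous ap)
  qed
  fix t :: real and x x' w w' :: "nat \<Rightarrow> real" assume t: "0 \<le> t"
  define D where "D l = \<bar>x l - x' l\<bar> + \<bar>w l - w' l\<bar>" for l
  have D: "0 \<le> D l" for l by (simp add: D_def)
  have "\<bar>- d i t * (x i - x' i) + (\<Sum>l\<in>S. a i l t * (x l - x' l)) + (g i t (w i) - g i t (w' i))\<bar>
      \<le> \<bar>- d i t * (x i - x' i)\<bar> + \<bar>\<Sum>l\<in>S. a i l t * (x l - x' l)\<bar> + \<bar>g i t (w i) - g i t (w' i)\<bar>"
    by linarith
  also have "\<dots> \<le> K * \<bar>x i - x' i\<bar> + (\<Sum>l\<in>S. K * D l) + K * \<bar>w i - w' i\<bar>"
  proof (intro add_mono lip i t)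
    show "\<bar>- d i t * (x i - x' i)\<bar> \<le> K * \<bar>x i - x' i\<bar>"
      unfolding abs_mult abs_minus_cancel using i S d_nonneg[of i t] d_le[of i t]
      by (intro mult_right_mono) auto
    have "\<bar>\<Sum>l\<in>S. a i l t * (x l - x' l)\<bar> \<le> (\<Sum>l\<in>S. \<bar>a i l t * (x l - x' l)\<bar>)" by (rule sum_abs)
    also have "\<dots> \<le> (\<Sum>l\<in>S. K * D l)"
      unfolding abs_mult using i S a_nonneg a_le K by (intro sum_mono mult_mono) (auto simp: D_def subset_iff)
    finally show "\<bar>\<Sum>l\<in>S. a i l t * (x l - x' l)\<bar> \<le> (\<Sum>l\<in>S. K * D l)" .
  qed
  also have "\<dots> = K * (D i + (\<Sum>l\<in>S. D l))" by (simp add: D_def algebra_simps sum_distrib_left)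
  \<comment> \<open>The component \<open>i\<close> occurs in the sum over \<open>S\<close> as well,
    whence the factor 2 in the Lipschitz constant.\<close>
  also have "\<dots> \<le> K * ((\<Sum>l\<in>S. D l) + (\<Sum>l\<in>S. D l))"
    using member_le_sum[of i S D] i fin D K by (intro mult_left_mono) auto
  finally show "\<bar>- d i t * x i + (\<Sum>l\<in>S. a i l t * x l) + g i t (w i) -
      (- d i t * x' i + (\<Sum>l\<in>S. a i l t * x' l) + g i t (w' i))\<bar>
      \<le> 2 * K * (\<Sum>l\<in>S. \<bar>x l - x' l\<bar> + \<bar>w l - w' l\<bar>)"
    by (simp add: D_def algebra_simps sum_subtractf)
qed (rule \<phi>)

lemma coeff_abs_le:
  assumes "S \<subseteq> {1..n}"
  shows "i \<in> S \<Longrightarrow> \<bar>d i t\<bar> \<le> K" "i \<in> S \<Longrightarrow> l \<in> S \<Longrightarrow> 0 \<le> a i l t \<and> a i l t \<le> K"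
proof -
  show "\<bar>d i t\<bar> \<le> K" if "i \<in> S" using that assms d_nonneg[of i t] d_le[of i t] by (auto simp: subset_iff)
  show "0 \<le> a i l t \<and> a i l t \<le> K" if "i \<in> S" "l \<in> S"
    using that assms a_nonneg[of i l t] a_le[of i l t] by (auto simp: subset_iff)
qed

lemma delay_solution_eqI:
  assumes S: "S \<subseteq> {1..n}"
    and f: "\<And>i t x w. f i t x w = - d i t * x i + (\<Sum>l\<in>S. a i l t * x l) + g i t (w i)"
    and y: "is_delay_solution S \<tau> f \<phi> y"
  shows "delay_solution S \<tau> f \<phi> = y"
  unfolding delay_solution_def
proof (rule the_equality)
  show "is_delay_solution S \<tau> f \<phi> y" by (rule y)
  fix x assume "is_delay_solution S \<tau> f \<phi> x"
  show "x = y"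
  proof (rule affine_delay_solution_unique[OF _ _ f _ _ \<open>is_delay_solution S \<tau> f \<phi> x\<close> y])
    show "finite S" using S finite_subset by blast
    show "0 < \<tau> i" if "i \<in> S" for i using that S delay by blast
  qed (use coeff_abs_le[OF S] in auto)
qed

lemma nonneg_of_affine_inequality:
  assumes S: "S \<subseteq> {1..n}"
    and der: "\<And>i t. i \<in> S \<Longrightarrow> 0 \<le> t \<Longrightarrow> (y i has_real_derivative y' i t) (at t within {0..})"
    and ini: "\<And>i t. i \<in> S \<Longrightarrow> - \<tau> i \<le> t \<Longrightarrow> t \<le> 0 \<Longrightarrow> 0 \<le> y i t"
    and ineq: "\<And>i t. i \<in> S \<Longrightarrow> 0 \<le> t \<Longrightarrow> 0 \<le> y i (t - \<tau> i) \<Longrightarrow>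
        undelayed S y i t \<le> y' i t"
    and it: "i \<in> S" "- \<tau> i \<le> t"
  shows "0 \<le> y i t"
proof (rule cooperative_delay_nonneg[where u = y and u' = y' and S = S and p = 0 and q = t and \<tau> = \<tau>
      and d = d and a = a and K = K and i = i])
  show "finite S" using S finite_subset by blast
  show "0 < \<tau> i" if "i \<in> S" for i using that S delay by blast
qed (use der ini ineq it coeff_abs_le[OF S] in auto)

text \<open>The birth term is not globally Lipschitz on the negative half line, so existence is
  shown for the truncation by \<open>max w 0\<close>. The solution obtained is nonnegative and
  therefore solves the original system; since uniqueness holds for any delayed term, it is the one
  selected by \<open>THE\<close>.\<close>

lemma nicholson_solution_exists:
  assumes \<phi>: "\<phi> \<in> phase_space {1..n} \<tau>" and nn: "phase_nonneg {1..n} \<tau> \<phi>"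
  defines "y \<equiv> sol \<phi>"
  shows "is_delay_solution {1..n} \<tau> (nicholson_rhs n d a \<beta> c) \<phi> y"
    and "\<And>i t. i \<in> {1..n} \<Longrightarrow> - \<tau> i \<le> t \<Longrightarrow> 0 \<le> y i t"
proof -
  define g where "g i t w = \<beta> i t * (max w 0 * exp (- c i t * max w 0))" for i and t w :: real
  define f where "f i t x w = - d i t * x i + (\<Sum>l\<in>{1..n}. a i l t * x l) + g i t (w i)"
    for i t and x w :: "nat \<Rightarrow> real"
  have "\<exists>z. is_delay_solution {1..n} \<tau> (\<lambda>i t x w. - d i t * x i + (\<Sum>l\<in>{1..n}. a i l t * x l) + g i t (w i)) \<phi> z"
  proof (rule affine_solution_exists[OF order_refl \<phi>])
    fix i assume i: "i \<in> {1..n}"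
    show "g i t 0 = 0" for t by (simp add: g_def)
    show "continuous_on {0..} (\<lambda>t. g i t (w t))" if "continuous_on {0..} w" for w
      unfolding g_def by (intro continuous_intros almost_periodic_continuous ap i that)
    show "\<bar>g i t u - g i t v\<bar> \<le> K * \<bar>u - v\<bar>" if t: "0 \<le> t" for t u v
    proof -
      have "\<bar>g i t u - g i t v\<bar> = \<bar>\<beta> i t\<bar> *
          \<bar>max u 0 * exp (- c i t * max u 0) - max v 0 * exp (- c i t * max v 0)\<bar>"
        unfolding g_def by (simp add: abs_mult[symmetric] right_diff_distrib)
      also have "\<dots> \<le> K * \<bar>max u 0 - max v 0\<bar>"
        using \<beta>_nonneg[OF i t] \<beta>_le[OF i, of t] K c_nonneg[OF i t]
        by (intro mult_mono ricker_lipschitz) auto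
      also have "\<dots> \<le> K * \<bar>u - v\<bar>" using K by (intro mult_left_mono) auto
      finally show ?thesis .
    qed
  qed
  then obtain z where z: "is_delay_solution {1..n} \<tau> f \<phi> z" unfolding f_def by blast
  have z_ini: "z i t = \<phi> i t" if "i \<in> {1..n}" "- \<tau> i \<le> t" "t \<le> 0" for i t
    using z that unfolding is_delay_solution_def by auto
  have z_der: "(z i has_real_derivative f i t (\<lambda>l. z l t) (\<lambda>l. z l (t - \<tau> l))) (at t within {0..})"
    if "i \<in> {1..n}" "0 \<le> t" for i t
    using z that unfolding is_delay_solution_def by blast
  have z_nn: "0 \<le> z i t" if it: "i \<in> {1..n}" "- \<tau> i \<le> t" for i t
  proof (rule nonneg_of_affine_inequality[OF order_refl z_der _ _ it])
    show "0 \<le> z i t" if "i \<in> {1..n}" "- \<tau> i \<le> t" "t \<le> 0" for i t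
      using z_ini[OF that] nn that unfolding phase_nonneg_def by auto
    show "undelayed {1..n} z i t \<le> f i t (\<lambda>l. z l t) (\<lambda>l. z l (t - \<tau> l))"
      if "i \<in> {1..n}" "0 \<le> t" for i t
      using \<beta>_nonneg[OF that] by (simp add: f_def g_def)
  qed
  have "f i t (\<lambda>l. z l t) (\<lambda>l. z l (t - \<tau> l)) = nicholson_rhs n d a \<beta> c i t (\<lambda>l. z l t) (\<lambda>l. z l (t - \<tau> l))"
    if "i \<in> {1..n}" "0 \<le> t" for i t
    using z_nn[OF that(1), of "t - \<tau> i"] that by (simp add: f_def g_def nicholson_rhs_def)
  then have sol: "is_delay_solution {1..n} \<tau> (nicholson_rhs n d a \<beta> c) \<phi> z"
    using z unfolding is_delay_solution_def by simp
  have "y = z"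
    unfolding y_def nicholson_solution_def
    by (rule delay_solution_eqI[OF order_refl _ sol, where g = "\<lambda>i t w. \<beta> i t * w * exp (- c i t * w)"])
      (simp add: nicholson_rhs_def)
  then show "is_delay_solution {1..n} \<tau> (nicholson_rhs n d a \<beta> c) \<phi> y"
    and "\<And>i t. i \<in> {1..n} \<Longrightarrow> - \<tau> i \<le> t \<Longrightarrow> 0 \<le> y i t"
    using sol z_nn by auto
qed

lemma linear_solution_exists:
  assumes S: "S \<subseteq> {1..n}" and \<phi>: "\<phi> \<in> phase_space S \<tau>"
  shows "is_delay_solution S \<tau> (linear_rhs S d a \<beta>) \<phi> (linear_solution S \<tau> d a \<beta> \<phi>)"
proof -
  have "\<exists>z. is_delay_solution S \<tau> (\<lambda>i t x w. - d i t * x i + (\<Sum>l\<in>S. a i l t * x l) + \<beta> i t * w i) \<phi> z"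
  proof (rule affine_solution_exists[OF S \<phi>])
    fix i assume i: "i \<in> S"
    show "continuous_on {0..} (\<lambda>t. \<beta> i t * w t)" if "continuous_on {0..} w" for w
      using i S by (intro continuous_intros almost_periodic_continuous ap that) auto
    show "\<bar>\<beta> i t * u - \<beta> i t * v\<bar> \<le> K * \<bar>u - v\<bar>" if t: "0 \<le> t" for t u v
      unfolding right_diff_distrib[symmetric] abs_mult
      using i S \<beta>_nonneg[of i t] \<beta>_le[of i t] t by (intro mult_right_mono) auto
  qed simp
  then obtain z where z: "is_delay_solution S \<tau> (linear_rhs S d a \<beta>) \<phi> z"
    unfolding linear_rhs_def[abs_def] by blast
  have "delay_solution S \<tau> (linear_rhs S d a \<beta>) \<phi> = z"
    by (rule delay_solution_eqI[OF S _ z]) (simp add: linear_rhs_def)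
  then show ?thesis using z by (simp add: linear_solution_def)
qed

end

lemma continuous_on_Min_image:
  fixes f :: "'i \<Rightarrow> 'b::topological_space \<Rightarrow> real"
  assumes "finite S" "S \<noteq> {}" "\<And>i. i \<in> S \<Longrightarrow> continuous_on A (f i)"
  shows "continuous_on A (\<lambda>t. Min ((\<lambda>i. f i t) ` S))"
  using assms
proof (induction S rule: finite_ne_induct)
  case (insert i S)
  then have "continuous_on A (\<lambda>t. min (f i t) (Min ((\<lambda>i. f i t) ` S)))"
    by (intro continuous_on_min) auto
  then show ?case using insert.hyps by simp
qed simp

text \<open>All the functions are positive at time 0, so they are bounded below on common recurrent
  windows, and the antiderivative \<open>M\<close> of their minimum grows at least linearly.
  \<open>M\<close> stands in for a constant rate where the minimum has no positive lower
  bound.\<close>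

lemma common_minorant:
  fixes f :: "'i \<Rightarrow> real \<Rightarrow> real"
  assumes S: "finite S" "S \<noteq> {}" and ap: "\<And>i. i \<in> S \<Longrightarrow> almost_periodic (f i)"
    and pos: "\<And>i t. i \<in> S \<Longrightarrow> 0 \<le> t \<Longrightarrow> 0 < f i t"
  shows "\<exists>M g \<alpha> C. 0 < \<alpha> \<and> (\<forall>s\<ge>0. \<forall>t\<ge>s. \<alpha> * (t - s) - C \<le> M t - M s) \<and>
     (\<forall>t\<ge>0. (M has_real_derivative g t) (at t within {0..}) \<and> 0 \<le> g t \<and> (\<forall>i\<in>S. g t \<le> f i t))"
proof -
  define g where "g t = Min ((\<lambda>i. f i t) ` S)" for t
  define M where "M t = integral {0..t} g" for t
  have cont: "continuous_on {0..} g"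
    unfolding g_def using S ap by (intro continuous_on_Min_image almost_periodic_continuous)
  have der: "(M has_real_derivative g t) (at t within {0..})" if "0 \<le> t" for t
    unfolding M_def using cont that by (rule has_real_derivative_integral)
  have g0: "0 \<le> g t" if "0 \<le> t" for t
    using S pos[OF _ that] by (auto simp: g_def less_imp_le)
  have gle: "g t \<le> f i t" if "i \<in> S" for i t using S that by (auto simp: g_def)
  have "\<exists>\<epsilon>>0. \<exists>\<eta>>0. \<exists>L>0. \<forall>x. \<exists>r. x \<le> r \<and> r \<le> x + L \<and>
      (\<forall>k\<in>f ` S. \<forall>t\<in>{r..r + \<eta>}. \<epsilon> \<le> k t)"
    by (rule almost_periodic_windows[where ?t0.0 = 0]) (use S ap pos in auto)
  then obtain \<epsilon> \<eta> L where w: "\<epsilon> > 0" "\<eta> > 0" "L > 0"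
    "\<And>x. \<exists>r. x \<le> r \<and> r \<le> x + L \<and> (\<forall>k\<in>f ` S. \<forall>t\<in>{r..r + \<eta>}. \<epsilon> \<le> k t)"
    by blast
  have "\<exists>r. x \<le> r \<and> r \<le> x + L \<and> (\<forall>t\<in>{r..r + \<eta>}. \<epsilon> \<le> g t)" for x
    using w(4)[of x] S by (auto simp: g_def)
  from linear_growth_of_windows[OF der g0 w(1-3) this]
  show ?thesis using der g0 gle by blast
qed

section \<open>Spreading of positivity and ultimate boundedness\<close>

context nicholson_system begin

text \<open>Births are dropped and equality is weakened, so that solutions of the linear and of the
  Nicholson system, and their restrictions to fewer components, fall into one class for which
  spreading is proved once.\<close>

definition supersolution :: "nat set \<Rightarrow> (nat \<Rightarrow> real \<Rightarrow> real) \<Rightarrow> bool" where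
  "supersolution S y \<longleftrightarrow> (\<forall>i\<in>S. \<forall>t\<ge>0. 0 \<le> y i t) \<and>
     (\<exists>y'. \<forall>i\<in>S. \<forall>t\<ge>0. (y i has_real_derivative y' i t) (at t within {0..}) \<and>
        undelayed S y i t \<le> y' i t)"

lemma supersolution_nonneg: "supersolution S y \<Longrightarrow> i \<in> S \<Longrightarrow> 0 \<le> t \<Longrightarrow> 0 \<le> y i t"
  unfolding supersolution_def by blast

text \<open>Nonnegative inputs only help, so a component decays at most at its own loss rate, which
  \<open>K\<close> bounds.\<close>

lemma supersolution_decay:
  assumes S: "S \<subseteq> {1..n}" and y: "supersolution S y" and i: "i \<in> S" and st: "0 \<le> s" "s \<le> t"
  shows "exp (- K * (t - s)) * y i s \<le> y i t"
proof -
  obtain y' where y': "\<And>i t. i \<in> S \<Longrightarrow> 0 \<le> t \<Longrightarrow> (y i has_real_derivative y' i t) (at t within {0..})"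
    "\<And>i t. i \<in> S \<Longrightarrow> 0 \<le> t \<Longrightarrow> undelayed S y i t \<le> y' i t"
    using y unfolding supersolution_def by blast
  show ?thesis
  proof (rule differential_inequality_lower[OF st])
    fix r assume "s \<le> r" "r \<le> t"
    then have r: "0 \<le> r" using st by simp
    show "(y i has_real_derivative y' i r) (at r within {0..})" by (rule y'(1)[OF i r])
    have "0 \<le> (\<Sum>l\<in>S. a i l r * y l r)"
      using supersolution_nonneg[OF y _ r] coeff_abs_le[OF S] i by (intro sum_nonneg mult_nonneg_nonneg) auto
    moreover have "d i r * y i r \<le> K * y i r"
      using supersolution_nonneg[OF y i r] i S by (intro mult_right_mono d_le) auto
    ultimately show "- K * y i r \<le> y' i r" using y'(2)[OF i r] by simp
  qed
qed

text \<open>\<open>T\<close> and \<open>\<kappa>\<close> are chosen before the solution and the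
  time; this uniformity gives the constants of the Harnack inequality and of persistence.\<close>

definition reaches :: "nat set \<Rightarrow> nat \<Rightarrow> nat \<Rightarrow> bool" where
  "reaches S l i \<longleftrightarrow> (\<exists>T\<ge>0. \<exists>\<kappa>>0. \<forall>y. supersolution S y \<longrightarrow> (\<forall>t\<ge>0. \<kappa> * y l t \<le> y i (t + T)))"

lemma reaches_refl: "reaches S i i"
  unfolding reaches_def by (intro exI[of _ 0] conjI exI[of _ 1]) auto

lemma reaches_trans:
  assumes "reaches S p q" "reaches S q r"
  shows "reaches S p r"
proof -
  obtain T \<kappa> where 1: "T \<ge> 0" "\<kappa> > 0" "\<And>y t. supersolution S y \<Longrightarrow> t \<ge> 0 \<Longrightarrow> \<kappa> * y p t \<le> y q (t + T)"
    using assms(1) unfolding reaches_def by blast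
  obtain T' \<kappa>' where 2: "T' \<ge> 0" "\<kappa>' > 0" "\<And>y t. supersolution S y \<Longrightarrow> t \<ge> 0 \<Longrightarrow> \<kappa>' * y q t \<le> y r (t + T')"
    using assms(2) unfolding reaches_def by blast
  have "\<kappa> * \<kappa>' * y p t \<le> y r (t + (T + T'))" if "supersolution S y" "t \<ge> 0" for y t
  proof -
    have "\<kappa>' * (\<kappa> * y p t) \<le> \<kappa>' * y q (t + T)" using 1(3)[OF that] 2(2) by (intro mult_left_mono) auto
    also have "\<dots> \<le> y r (t + T + T')" using 2(3)[OF that(1), of "t + T"] that 1(1) by simp
    finally show ?thesis by (simp add: algebra_simps)
  qed
  then show ?thesis unfolding reaches_def using 1(1,2) 2(1,2)
    by (intro exI[of _ "T + T'"] conjI exI[of _ "\<kappa> * \<kappa>'"]) auto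
qed

text \<open>Component \<open>l\<close> survives until a window on which the coupling is at least
  \<open>\<epsilon>\<close>, feeds \<open>i\<close> throughout the window, and the gain of
  \<open>i\<close> survives until \<open>t + T\<close>.\<close>

lemma reaches_edge:
  assumes S: "S \<subseteq> {1..n}" and il: "i \<in> S" "l \<in> S" and pos: "0 < a i l t0"
  shows "reaches S l i"
proof -
  have "almost_periodic (a i l)" using il S by (intro ap(4)) auto
  then have "\<exists>\<epsilon>>0. \<exists>\<eta>>0. \<exists>L>0. \<forall>x. \<exists>r. x \<le> r \<and> r \<le> x + L \<and>
      (\<forall>k\<in>{a i l}. \<forall>t\<in>{r..r + \<eta>}. \<epsilon> \<le> k t)"
    by (intro almost_periodic_windows[where ?t0.0 = t0]) (use pos in auto)
  then obtain \<epsilon> \<eta> L where w: "\<epsilon> > 0" "\<eta> > 0" "L > 0"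
    "\<And>x. \<exists>r. x \<le> r \<and> r \<le> x + L \<and> (\<forall>k\<in>{a i l}. \<forall>t\<in>{r..r + \<eta>}. \<epsilon> \<le> k t)"
    by blast
  \<comment> \<open>A window begins within \<open>L\<close> and lasts \<open>\<eta>\<close>, so it
    is over by \<open>t + T\<close>.\<close>
  define T where "T = L + \<eta>"
  \<comment> \<open>Read from the inside: survival of \<open>l\<close>, strength and length of the
    window, loss of \<open>i\<close> during the window, survival of \<open>i\<close>
    afterwards.\<close>
  define \<kappa> where "\<kappa> = exp (- K * T) * (exp (- K * \<eta>) * (\<eta> * (\<epsilon> * exp (- K * T))))"
  have "\<kappa> * y l t \<le> y i (t + T)" if y: "supersolution S y" and t: "0 \<le> t" for y t
  proof -
    obtain y' where y': "\<And>i t. i \<in> S \<Longrightarrow> 0 \<le> t \<Longrightarrow> (y i has_real_derivative y' i t) (at t within {0..})"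
      "\<And>i t. i \<in> S \<Longrightarrow> 0 \<le> t \<Longrightarrow> undelayed S y i t \<le> y' i t"
      using y unfolding supersolution_def by blast
    obtain r where r: "t \<le> r" "r \<le> t + L" "\<And>s. r \<le> s \<Longrightarrow> s \<le> r + \<eta> \<Longrightarrow> \<epsilon> \<le> a i l s"
      using w(4)[of t] by auto
    \<comment> \<open>A lower bound for the input from \<open>l\<close> to \<open>i\<close>
      throughout the window.\<close>
    define E where "E = \<epsilon> * (exp (- K * T) * y l t)"
    have yl: "0 \<le> y l t" by (rule supersolution_nonneg[OF y il(2) t])
    have E: "0 \<le> E" using yl w(1) by (simp add: E_def)
    have "exp (K * (r - r)) * y i r - E * r \<le> exp (K * (r + \<eta> - r)) * y i (r + \<eta>) - E * (r + \<eta>)"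
    proof (rule has_real_derivative_nonneg_mono[where f = "\<lambda>s. exp (K * (s - r)) * y i s - E * s" and
          f' = "\<lambda>s. exp (K * (s - r)) * (K * y i s + y' i s) - E"])
      fix s assume s: "r \<le> s" "s \<le> r + \<eta>"
      have s0: "0 \<le> s" using s r t by simp
      show "((\<lambda>s. exp (K * (s - r)) * y i s - E * s) has_real_derivative
          exp (K * (s - r)) * (K * y i s + y' i s) - E) (at s within {0..})"
        by (rule derivative_eq_intros y'(1)[OF il(1) s0] refl)+ (simp add: algebra_simps)
      have "E \<le> a i l s * y l s"
        unfolding E_def
      proof (rule mult_mono)
        show "\<epsilon> \<le> a i l s" by (rule r(3)[OF s])
        have "exp (- K * T) * y l t \<le> exp (- K * (s - t)) * y l t"
          using yl K s r by (intro mult_right_mono) (auto simp: T_def)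
        also have "\<dots> \<le> y l s" using s r by (intro supersolution_decay[OF S y il(2) t]) auto
        finally show "exp (- K * T) * y l t \<le> y l s" .
        show "0 \<le> a i l s" using coeff_abs_le(2)[OF S il] by blast
      qed (use yl in auto)
      also have "\<dots> \<le> (\<Sum>l\<in>S. a i l s * y l s)"
        using S finite_subset coeff_abs_le(2)[OF S il(1)] supersolution_nonneg[OF y _ s0]
        by (intro member_le_sum[OF il(2), of "\<lambda>l. a i l s * y l s"]) auto
      also have "\<dots> \<le> y' i s + d i s * y i s" using y'(2)[OF il(1) s0] by simp
      also have "\<dots> \<le> y' i s + K * y i s"
        using supersolution_nonneg[OF y il(1) s0] d_le[of i s] il S by (auto intro!: mult_right_mono)
      finally have *: "E \<le> K * y i s + y' i s" by simp
      also have "\<dots> \<le> exp (K * (s - r)) * (K * y i s + y' i s)"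
        using mult_right_mono[OF _ order_trans[OF E *], of 1 "exp (K * (s - r))"] K s by simp
      finally show "0 \<le> exp (K * (s - r)) * (K * y i s + y' i s) - E" by simp
    qed (use r t w in auto)
    moreover have "0 \<le> y i r" using r t by (intro supersolution_nonneg[OF y il(1)]) auto
    ultimately have "E * \<eta> \<le> exp (K * \<eta>) * y i (r + \<eta>)" by (simp add: algebra_simps)
    then have "exp (- K * \<eta>) * (E * \<eta>) \<le> exp (- K * \<eta>) * (exp (K * \<eta>) * y i (r + \<eta>))" by simp
    also have "\<dots> = y i (r + \<eta>)" by (simp add: exp_minus)
    finally have "exp (- K * \<eta>) * (E * \<eta>) \<le> y i (r + \<eta>)" .
    then have "exp (- K * T) * (exp (- K * \<eta>) * (E * \<eta>)) \<le> exp (- K * T) * y i (r + \<eta>)" by simp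
    also have "\<dots> \<le> exp (- K * (t + T - (r + \<eta>))) * y i (r + \<eta>)"
      using K r t w supersolution_nonneg[OF y il(1), of "r + \<eta>"]
      by (intro mult_right_mono) (auto simp: T_def)
    also have "\<dots> \<le> y i (t + T)"
      using r t w by (intro supersolution_decay[OF S y il(1)]) (auto simp: T_def)
    finally show ?thesis by (simp add: \<kappa>_def E_def mult_ac)
  qed
  moreover have "T \<ge> 0" "\<kappa> > 0" using w by (auto simp: T_def \<kappa>_def)
  ultimately show ?thesis unfolding reaches_def by blast
qed

text \<open>The sum of the waiting times of all pairs serves as a common one; the additional waiting
  costs at most the decay factor \<open>exp (- K * T')\<close>.\<close>

lemma reaches_uniform:
  assumes S: "S \<subseteq> {1..n}" and conn: "\<And>i l. i \<in> S \<Longrightarrow> l \<in> S \<Longrightarrow> reaches S l i"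
  shows "\<exists>T\<ge>0. \<exists>\<kappa>>0. \<forall>y. supersolution S y \<longrightarrow>
    (\<forall>i\<in>S. \<forall>l\<in>S. \<forall>t\<ge>0. \<kappa> * y l t \<le> y i (t + T))"
proof -
  have fin: "finite (S \<times> S)" using S finite_subset by blast
  have "\<forall>x. \<exists>T \<kappa>. x \<in> S \<times> S \<longrightarrow> T \<ge> 0 \<and> \<kappa> > 0 \<and>
      (\<forall>y t. supersolution S y \<longrightarrow> t \<ge> 0 \<longrightarrow> \<kappa> * y (snd x) t \<le> y (fst x) (t + T))"
    using conn unfolding reaches_def by (metis mem_Times_iff)
  then obtain T \<kappa> where T: "\<And>x. x \<in> S \<times> S \<Longrightarrow> T x \<ge> 0" "\<And>x. x \<in> S \<times> S \<Longrightarrow> \<kappa> x > 0"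
    and le: "\<And>x y t. x \<in> S \<times> S \<Longrightarrow> supersolution S y \<Longrightarrow> t \<ge> 0 \<Longrightarrow> \<kappa> x * y (snd x) t \<le> y (fst x) (t + T x)"
    by metis
  define T' where "T' = (\<Sum>x\<in>S \<times> S. T x)"
  define \<kappa>' where "\<kappa>' = exp (- K * T') * Min (insert 1 (\<kappa> ` (S \<times> S)))"
  have m: "0 < Min (insert 1 (\<kappa> ` (S \<times> S)))" using fin T(2) by (subst Min_gr_iff) auto
  have "\<kappa>' * y l t \<le> y i (t + T')" if y: "supersolution S y" and il: "i \<in> S" "l \<in> S" and t: "t \<ge> 0" for y i l t
  proof -
    have x: "(i, l) \<in> S \<times> S" using il by simp
    have TT: "0 \<le> T (i, l)" "T (i, l) \<le> T'"
      using T(1)[OF x] member_le_sum[OF x _ fin, of T] T(1) by (auto simp: T'_def)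
    have "Min (insert 1 (\<kappa> ` (S \<times> S))) * y l t \<le> \<kappa> (i, l) * y l t"
      using supersolution_nonneg[OF y il(2) t] fin x by (intro mult_right_mono Min_le) auto
    also have "\<dots> \<le> y i (t + T (i, l))" using le[OF x y t] by simp
    finally have "\<kappa>' * y l t \<le> exp (- K * T') * y i (t + T (i, l))" by (simp add: \<kappa>'_def)
    also have "\<dots> \<le> exp (- K * (t + T' - (t + T (i, l)))) * y i (t + T (i, l))"
      using K TT t supersolution_nonneg[OF y il(1), of "t + T (i, l)"] by (intro mult_right_mono) auto
    also have "\<dots> \<le> y i (t + T')" using TT t by (intro supersolution_decay[OF S y il(1)]) auto
    finally show ?thesis .
  qed
  moreover have "T' \<ge> 0" using T(1) by (auto simp: T'_def intro: sum_nonneg)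
  moreover have "\<kappa>' > 0" using m by (simp add: \<kappa>'_def)
  ultimately show ?thesis by blast
qed

section \<open>Ultimate boundedness of the Nicholson system\<close>

lemma nicholson_solution_props:
  assumes \<phi>: "\<phi> \<in> phase_space {1..n} \<tau>" and nn: "phase_nonneg {1..n} \<tau> \<phi>"
  defines "y \<equiv> sol \<phi>"
  shows "\<And>i t. i \<in> {1..n} \<Longrightarrow> - \<tau> i \<le> t \<Longrightarrow> t \<le> 0 \<Longrightarrow> y i t = \<phi> i t"
    and "\<And>i t. i \<in> {1..n} \<Longrightarrow> - \<tau> i \<le> t \<Longrightarrow> 0 \<le> y i t"
    and "\<And>i t. i \<in> {1..n} \<Longrightarrow> 0 \<le> t \<Longrightarrow> (y i has_real_derivative
      undelayed {1..n} y i t + birth y i t)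
      (at t within {0..})"
proof -
  note sol = nicholson_solution_exists[OF \<phi> nn, folded y_def]
  show "y i t = \<phi> i t" if "i \<in> {1..n}" "- \<tau> i \<le> t" "t \<le> 0" for i t
    using sol(1) that unfolding is_delay_solution_def by auto
  show "0 \<le> y i t" if "i \<in> {1..n}" "- \<tau> i \<le> t" for i t using sol(2)[OF that] .
  show "(y i has_real_derivative
      undelayed {1..n} y i t + birth y i t)
      (at t within {0..})" if "i \<in> {1..n}" "0 \<le> t" for i t
    using sol(1) that unfolding is_delay_solution_def nicholson_rhs_def mult.assoc by blast
qed

text \<open>In the total population the couplings collect into column sums, so its loss rate is at
  least the common minorant \<open>g\<close> of the dissipativity margins, while the births stay
  below a constant. The integrating factor \<open>exp (M t)\<close> grows at least exponentially,
  which eventually bounds the total independently of the initial map.\<close>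

lemma nicholson_ultimately_bounded:
  "\<exists>B>0. \<forall>\<phi>\<in>phase_space {1..n} \<tau>. phase_nonneg {1..n} \<tau> \<phi> \<longrightarrow>
     (\<exists>t0\<ge>0. \<forall>t\<ge>t0. \<forall>i\<in>{1..n}. sol \<phi> i t \<le> B)"
proof -
  have "\<exists>M g \<alpha> C. 0 < \<alpha> \<and> (\<forall>s\<ge>0. \<forall>t\<ge>s. \<alpha> * (t - s) - C \<le> M t - M s) \<and>
     (\<forall>t\<ge>0. (M has_real_derivative g t) (at t within {0..}) \<and> 0 \<le> g t \<and>
       (\<forall>i\<in>{1..n}. g t \<le> d i t - (\<Sum>j=1..n. a j i t)))"
    by (rule common_minorant)
      (use n dissipative in \<open>auto intro!: almost_periodic_diff almost_periodic_sum ap\<close>)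
  then obtain M g \<alpha> C where \<alpha>: "0 < \<alpha>" and M': "\<forall>s\<ge>0. \<forall>t\<ge>s. \<alpha> * (t - s) - C \<le> M t - M s"
    and g': "\<forall>t\<ge>0. (M has_real_derivative g t) (at t within {0..}) \<and> 0 \<le> g t \<and>
       (\<forall>i\<in>{1..n}. g t \<le> d i t - (\<Sum>j=1..n. a j i t))"
    by (elim exE conjE) (rule that)
  have M: "\<alpha> * (t - s) - C \<le> M t - M s" if "0 \<le> s" "s \<le> t" for s t using M' that by simp
  have g: "(M has_real_derivative g t) (at t within {0..})" "0 \<le> g t"
    "i \<in> {1..n} \<Longrightarrow> g t \<le> d i t - (\<Sum>j=1..n. a j i t)" if "0 \<le> t" for t i
    using g' that by blast+
  define D where "D = real n * (K * (1 / c0))"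
  have D: "0 \<le> D" using K c0 by (simp add: D_def)
  \<comment> \<open>\<open>D / \<alpha> * exp C\<close> balances births against the averaged loss
    rate \<open>\<alpha>\<close>; the 1 absorbs the transient.\<close>
  define B where "B = D / \<alpha> * exp C + 1"
  have "\<exists>t0\<ge>0. \<forall>t\<ge>t0. \<forall>i\<in>{1..n}. sol \<phi> i t \<le> B"
    if \<phi>: "\<phi> \<in> phase_space {1..n} \<tau>" and nn: "phase_nonneg {1..n} \<tau> \<phi>" for \<phi>
  proof -
    define y where "y = sol \<phi>"
    note y = nicholson_solution_props[OF \<phi> nn, folded y_def]
    have y0: "0 \<le> y i t" if "i \<in> {1..n}" "0 \<le> t" for i t using y(2)[OF that(1)] delay(1)[OF that(1)] that by simp
    define q where "q i t = birth y i t" for i t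
    define Y where "Y t = (\<Sum>i\<in>{1..n}. y i t)" for t
    define Y' where "Y' t = (\<Sum>i\<in>{1..n}. undelayed {1..n} y i t + q i t)" for t
    have Y0: "0 \<le> Y t" if "0 \<le> t" for t unfolding Y_def using y0[OF _ that] by (rule sum_nonneg)
    have derY: "(Y has_real_derivative Y' t) (at t within {0..})" if "0 \<le> t" for t
      unfolding Y_def Y'_def q_def by (intro DERIV_sum y(3) that)
    have Y'_le: "Y' t \<le> - g t * Y t + D" if t: "0 \<le> t" for t
    proof -
      have "(\<Sum>i\<in>{1..n}. \<Sum>l\<in>{1..n}. a i l t * y l t) = (\<Sum>i\<in>{1..n}. (\<Sum>j\<in>{1..n}. a j i t) * y i t)"
        by (subst sum.swap) (simp add: sum_distrib_right)
      then have "Y' t = (\<Sum>i\<in>{1..n}. - ((d i t - (\<Sum>j\<in>{1..n}. a j i t)) * y i t) + q i t)"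
        unfolding Y'_def by (simp add: sum.distrib sum_subtractf algebra_simps sum_negf)
      also have "\<dots> \<le> (\<Sum>i\<in>{1..n}. - (g t * y i t) + K * (1 / c0))"
      proof (intro sum_mono add_mono)
        fix i assume i: "i \<in> {1..n}"
        show "- ((d i t - (\<Sum>j\<in>{1..n}. a j i t)) * y i t) \<le> - (g t * y i t)"
          using g(3)[OF t i] y0[OF i t] by (simp add: mult_right_mono)
        have c: "0 < c i t" using c_ge[OF i t] c0 by simp
        have w: "0 \<le> y i (t - \<tau> i)" using y(2)[OF i] t by simp
        have "y i (t - \<tau> i) * exp (- c i t * y i (t - \<tau> i)) \<le> 1 / c i t" by (rule ricker_le_inverse[OF c])
        also have "\<dots> \<le> 1 / c0" using c_ge[OF i t] c0 by (simp add: frac_le)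
        finally show "q i t \<le> K * (1 / c0)"
          unfolding q_def using \<beta>_le[OF i, of t] \<beta>_nonneg[OF i t] K w by (intro mult_mono) auto
      qed
      also have "\<dots> = - g t * Y t + D"
        by (simp add: sum.distrib sum_subtractf sum_negf sum_distrib_left Y_def D_def)
      finally show ?thesis .
    qed
    have Y_le: "Y t \<le> exp (C - \<alpha> * t) * Y 0 + D / \<alpha> * exp C" if t: "0 \<le> t" for t
    proof -
      \<comment> \<open>Since \<open>M r \<le> M t + C - \<alpha> * (t - r)\<close>, the
        contribution \<open>exp (M r) * D\<close> of births at time \<open>r\<close> is dominated by
        an exponential whose integral over \<open>[0, t]\<close> is at most
        \<open>E\<close>.\<close>
      define E where "E = D / \<alpha> * exp (M t + C)"
      have "E * exp (- \<alpha> * (t - 0)) - exp (M 0) * Y 0 \<le> E * exp (- \<alpha> * (t - t)) - exp (M t) * Y t"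
      proof (rule has_real_derivative_nonneg_mono[where f = "\<lambda>r. E * exp (- \<alpha> * (t - r)) - exp (M r) * Y r"
            and f' = "\<lambda>r. \<alpha> * E * exp (- \<alpha> * (t - r)) - exp (M r) * (g r * Y r + Y' r)"])
        fix r assume r: "0 \<le> r" "r \<le> t"
        show "((\<lambda>r. E * exp (- \<alpha> * (t - r)) - exp (M r) * Y r) has_real_derivative
            \<alpha> * E * exp (- \<alpha> * (t - r)) - exp (M r) * (g r * Y r + Y' r)) (at r within {0..})"
          by (rule derivative_eq_intros g(1)[OF r(1)] derY[OF r(1)] refl)+ (simp add: algebra_simps)
        have "exp (M r) * (g r * Y r + Y' r) \<le> exp (M r) * D" using Y'_le[OF r(1)] by simp
        also have "\<dots> \<le> exp (M t + C - \<alpha> * (t - r)) * D"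
          using M[OF r] D by (intro mult_right_mono) auto
        also have "\<dots> = \<alpha> * E * exp (- \<alpha> * (t - r))"
        proof -
          have "exp (M t + C - \<alpha> * (t - r)) = exp (M t + C) * exp (- \<alpha> * (t - r))"
            by (simp add: exp_add[symmetric])
          then show ?thesis using \<alpha> by (simp add: E_def)
        qed
        finally show "0 \<le> \<alpha> * E * exp (- \<alpha> * (t - r)) - exp (M r) * (g r * Y r + Y' r)" by simp
      qed (use t in auto)
      moreover have "0 \<le> E * exp (- \<alpha> * (t - 0))" using D \<alpha> by (simp add: E_def)
      ultimately have "exp (M t) * Y t \<le> exp (M 0) * Y 0 + E" by simp
      also have "\<dots> \<le> exp (M t + C - \<alpha> * t) * Y 0 + E"
        using M[OF order_refl t] Y0[of 0] by (intro add_mono mult_right_mono) auto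
      also have "\<dots> = exp (M t) * (exp (C - \<alpha> * t) * Y 0 + D / \<alpha> * exp C)"
        by (simp add: E_def exp_add exp_diff algebra_simps)
      finally show ?thesis by simp
    qed
    \<comment> \<open>From \<open>t1\<close> on \<open>C - \<alpha> * t \<le> - Y 0\<close> holds,
      and \<open>exp (- x) * x < 1\<close> makes the transient smaller than 1.\<close>
    define t1 where "t1 = (C + Y 0) / \<alpha>"
    have t1: "exp (C - \<alpha> * t) * Y 0 < 1" if "t \<ge> t1" for t
    proof -
      have "C - \<alpha> * t \<le> - Y 0" using that \<alpha> by (simp add: t1_def field_simps)
      then have "exp (C - \<alpha> * t) * Y 0 \<le> exp (- Y 0) * Y 0" using Y0[of 0] by (intro mult_right_mono) auto
      also have "Y 0 < exp (Y 0)" using exp_ge_add_one_self[of "Y 0"] by linarith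
      then have "exp (- Y 0) * Y 0 < exp (- Y 0) * exp (Y 0)" by simp
      also have "\<dots> = 1" by (simp add: exp_minus)
      finally show ?thesis .
    qed
    have "y i t \<le> B" if "t \<ge> max 0 t1" "i \<in> {1..n}" for i t
    proof -
      have t: "0 \<le> t" using that by simp
      have "y i t \<le> Y t" unfolding Y_def
        using that(2) y0[OF _ t] by (intro member_le_sum[of i "{1..n}" "\<lambda>i. y i t"]) auto
      then show ?thesis using Y_le[OF t] t1[of t] that(1) by (simp add: B_def)
    qed
    then show ?thesis unfolding y_def by (intro exI[of _ "max 0 t1"]) auto
  qed
  moreover have "B > 0" using D \<alpha> by (simp add: B_def add_nonneg_pos)
  ultimately show ?thesis by blast
qed

end

section \<open>Lyapunov exponent of an irreducible block\<close>

text \<open>For a step \<open>T0\<close> so long that \<open>C \<le> e * T0\<close>, the constant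
  error of each step becomes proportional to its length. Cutting \<open>[0, t]\<close> into such
  steps gives the slope measured on a single one; the remainder is controlled by
  \<open>bd\<close>.\<close>

lemma linear_approximation_of_almost_additive:
  fixes F :: "real \<Rightarrow> real"
  assumes add: "\<And>\<epsilon>. \<epsilon> > 0 \<Longrightarrow> \<exists>C. \<forall>s\<ge>0. \<forall>T\<ge>0. \<bar>F (s + T) - F s - F T\<bar> \<le> \<epsilon> * T + C"
    and bd: "\<And>t. 0 \<le> t \<Longrightarrow> \<bar>F t\<bar> \<le> C0 * (t + 1)" and "\<epsilon> > 0"
  shows "\<exists>x D. \<forall>t\<ge>0. \<bar>F t - x * t\<bar> \<le> \<epsilon> * t + D"
proof -
  define e where "e = \<epsilon> / 2"
  have e: "e > 0" using \<open>\<epsilon> > 0\<close> by (simp add: e_def)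
  obtain C where C: "\<And>s T. 0 \<le> s \<Longrightarrow> 0 \<le> T \<Longrightarrow> \<bar>F (s + T) - F s - F T\<bar> \<le> e * T + C"
    using add[OF e] by blast
  have C0: "0 \<le> C0" using bd[of 0] by simp
  define T0 where "T0 = max 1 (C / e)"
  have T0: "1 \<le> T0" "C \<le> e * T0" using e by (auto simp: T0_def field_simps max_def)
  define x where "x = F T0 / T0"
  have "\<bar>F t - x * t\<bar> \<le> \<epsilon> * t + (C0 * (T0 + 1) + T0 * \<bar>x\<bar>)" if t: "0 \<le> t" for t
  proof -
    define k where "k = nat \<lfloor>t / T0\<rfloor>"
    have "0 \<le> t / T0" using t T0 by simp
    then have k: "real k \<le> t / T0" "t / T0 < real k + 1" unfolding k_def by linarith+
    define \<rho> where "\<rho> = t - real k * T0"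
    have \<rho>: "0 \<le> \<rho>" "\<rho> \<le> T0" using k T0 by (auto simp: \<rho>_def field_simps)
    have "\<bar>F (\<rho> + real j * T0) - F \<rho> - real j * F T0\<bar> \<le> real j * (\<epsilon> * T0)" for j
    proof (induction j)
      case (Suc j)
      have "\<bar>F (\<rho> + real j * T0 + T0) - F (\<rho> + real j * T0) - F T0\<bar> \<le> e * T0 + C"
        using \<rho> T0 by (intro C) auto
      also have "\<dots> \<le> \<epsilon> * T0" using T0(2) by (simp add: e_def)
      finally have "\<bar>F (\<rho> + real (Suc j) * T0) - F (\<rho> + real j * T0) - F T0\<bar> \<le> \<epsilon> * T0"
        by (simp add: algebra_simps)
      moreover have "real (Suc j) * F T0 = real j * F T0 + F T0"
        "real (Suc j) * (\<epsilon> * T0) = real j * (\<epsilon> * T0) + \<epsilon> * T0" by (simp_all add: algebra_simps)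
      ultimately show ?case using Suc.IH by linarith
    qed simp
    from this[of k] have 1: "\<bar>F t - F \<rho> - real k * F T0\<bar> \<le> real k * (\<epsilon> * T0)"
      by (simp add: \<rho>_def)
    have 2: "real k * (\<epsilon> * T0) \<le> \<epsilon> * t"
      using k(1) T0 \<open>\<epsilon> > 0\<close> by (simp add: field_simps)
    have "\<bar>F \<rho>\<bar> \<le> C0 * (\<rho> + 1)" by (rule bd[OF \<rho>(1)])
    also have "\<dots> \<le> C0 * (T0 + 1)" using \<rho> C0 by (intro mult_left_mono) auto
    finally have 3: "\<bar>F \<rho>\<bar> \<le> C0 * (T0 + 1)" .
    have "real k * F T0 - x * t = - \<rho> * x" using T0 by (simp add: x_def \<rho>_def field_simps)
    then have "\<bar>real k * F T0 - x * t\<bar> = \<rho> * \<bar>x\<bar>" using \<rho> by (simp add: abs_mult)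
    also have "\<dots> \<le> T0 * \<bar>x\<bar>" using \<rho> by (intro mult_right_mono) auto
    finally have 4: "\<bar>real k * F T0 - x * t\<bar> \<le> T0 * \<bar>x\<bar>" .
    show ?thesis using 1 2 3 4 by linarith
  qed
  then show ?thesis by blast
qed

text \<open>The slopes found for the tolerances \<open>1 / (m + 1)\<close> approximate the same
  function, so two of them differ by at most the sum of their tolerances. They form a Cauchy
  sequence, whose limit serves every tolerance.\<close>

lemma slope_of_almost_additive:
  fixes F :: "real \<Rightarrow> real"
  assumes add: "\<And>\<epsilon>. \<epsilon> > 0 \<Longrightarrow> \<exists>C. \<forall>s\<ge>0. \<forall>T\<ge>0. \<bar>F (s + T) - F s - F T\<bar> \<le> \<epsilon> * T + C"
    and bd: "\<And>t. 0 \<le> t \<Longrightarrow> \<bar>F t\<bar> \<le> C0 * (t + 1)"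
  shows "\<exists>lam. \<forall>\<epsilon>>0. \<exists>D. \<forall>t\<ge>0. \<bar>F t - lam * t\<bar> \<le> \<epsilon> * t + D"
proof -
  have "\<forall>m. \<exists>x D. \<forall>t\<ge>0. \<bar>F t - x * t\<bar> \<le> inverse (real (Suc m)) * t + D"
    using linear_approximation_of_almost_additive[OF add bd] by simp
  then obtain x D where xD: "\<And>m t. 0 \<le> t \<Longrightarrow> \<bar>F t - x m * t\<bar> \<le> inverse (real (Suc m)) * t + D m"
    by metis
  have close: "\<bar>x m - x j\<bar> \<le> inverse (real (Suc m)) + inverse (real (Suc j))" for m j
  proof (rule ccontr)
    define \<delta> where "\<delta> = \<bar>x m - x j\<bar> - (inverse (real (Suc m)) + inverse (real (Suc j)))"
    assume "\<not> ?thesis"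
    then have \<delta>: "\<delta> > 0" unfolding \<delta>_def by linarith
    \<comment> \<open>At this time the excess \<open>\<delta> * t\<close> outgrows both constants
      together.\<close>
    define t where "t = (\<bar>D m\<bar> + \<bar>D j\<bar> + 1) / \<delta>"
    have t: "0 \<le> t" using \<delta> by (simp add: t_def)
    have "\<bar>x m - x j\<bar> * t = \<bar>x m * t - x j * t\<bar>" using t by (simp add: abs_mult left_diff_distrib[symmetric])
    also have "\<dots> \<le> (inverse (real (Suc m)) + inverse (real (Suc j))) * t + D m + D j"
      using xD[OF t, of m] xD[OF t, of j] unfolding distrib_right by linarith
    finally have "\<delta> * t \<le> D m + D j" by (simp add: \<delta>_def algebra_simps)
    moreover have "\<delta> * t = \<bar>D m\<bar> + \<bar>D j\<bar> + 1" using \<delta> by (simp add: t_def)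
    ultimately show False by linarith
  qed
  have "Cauchy x"
  proof (rule CauchyI)
    fix e :: real assume "0 < e"
    then obtain N where N: "inverse (real (Suc N)) < e / 2" using reals_Archimedean[of "e / 2"] by auto
    have "norm (x m - x j) < e" if "m \<ge> N" "j \<ge> N" for m j
    proof -
      have "inverse (real (Suc m)) \<le> inverse (real (Suc N))" "inverse (real (Suc j)) \<le> inverse (real (Suc N))"
        using that by auto
      then show ?thesis using close[of m j] N unfolding real_norm_def by linarith
    qed
    then show "\<exists>M. \<forall>m\<ge>M. \<forall>n\<ge>M. norm (x m - x n) < e" by blast
  qed
  then obtain lam where lam: "x \<longlonglongrightarrow> lam" using Cauchy_convergent convergent_def by blast
  have lim: "\<bar>x m - lam\<bar> \<le> inverse (real (Suc m))" for m
  proof (rule LIMSEQ_le)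
    show "(\<lambda>j. \<bar>x m - x j\<bar>) \<longlonglongrightarrow> \<bar>x m - lam\<bar>" by (intro tendsto_intros lam)
    show "(\<lambda>j. inverse (real (Suc m)) + inverse (real (Suc j))) \<longlonglongrightarrow> inverse (real (Suc m))"
      using tendsto_add[OF tendsto_const LIMSEQ_inverse_real_of_nat] by simp
  qed (use close in blast)
  have "\<exists>D. \<forall>t\<ge>0. \<bar>F t - lam * t\<bar> \<le> \<epsilon> * t + D" if "\<epsilon> > 0" for \<epsilon>
  proof -
    have "0 < \<epsilon> / 2" using that by simp
    from reals_Archimedean[OF this] obtain m where m: "inverse (real (Suc m)) < \<epsilon> / 2" by blast
    have "\<bar>F t - lam * t\<bar> \<le> \<epsilon> * t + D m" if t: "0 \<le> t" for t
    proof -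
      have "\<bar>x m * t - lam * t\<bar> = \<bar>x m - lam\<bar> * t" using t by (simp add: abs_mult left_diff_distrib[symmetric])
      also have "\<dots> \<le> inverse (real (Suc m)) * t" using lim t by (rule mult_right_mono)
      finally have "\<bar>F t - lam * t\<bar> \<le> 2 * (inverse (real (Suc m)) * t) + D m"
        using xD[OF t, of m] by linarith
      moreover have "inverse (real (Suc m)) * t \<le> \<epsilon> / 2 * t" using m t by (intro mult_right_mono) auto
      ultimately show ?thesis by simp
    qed
    then show ?thesis by blast
  qed
  then show ?thesis by blast
qed

lemma exp_mult_cancel:
  fixes x y :: real
  shows "exp (- x) * (exp x * y) = y" "exp x * (exp (- x) * y) = y"
  by (simp_all add: mult.assoc[symmetric] exp_add[symmetric])

section \<open>The reference solution of a block and its Harnack inequality\<close>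

text \<open>Irreducibility is expressed as mutual reachability, so that the theory of a single block
  refers to no matrix.\<close>

locale irreducible_block = nicholson_system +
  fixes S :: "nat set"
  assumes S: "S \<subseteq> {1..n}" and S_ne: "S \<noteq> {}"
    and conn: "\<And>i l. i \<in> S \<Longrightarrow> l \<in> S \<Longrightarrow> reaches S l i"
begin

lemma S_fin: "finite S" using S finite_subset by blast

lemma block_delay: "i \<in> S \<Longrightarrow> 0 < \<tau> i" "i \<in> S \<Longrightarrow> \<tau> i \<le> h"
  using delay S by blast+

definition z :: "nat \<Rightarrow> real \<Rightarrow> real" where
  "z = linear_solution S \<tau> d a \<beta> (\<lambda>i s. 1)"

text \<open>The total is used in place of the sup norm because it satisfies a differential
  inequality; the Harnack inequality makes the two comparable.\<close>

definition \<sigma> :: "real \<Rightarrow> real" where "\<sigma> t = (\<Sum>i\<in>S. z i t)"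

lemma z_ini: "i \<in> S \<Longrightarrow> - \<tau> i \<le> t \<Longrightarrow> t \<le> 0 \<Longrightarrow> z i t = 1"
  and z_der: "i \<in> S \<Longrightarrow> 0 \<le> t \<Longrightarrow> (z i has_real_derivative
    undelayed S z i t + \<beta> i t * z i (t - \<tau> i)) (at t within {0..})"
proof -
  have "(\<lambda>i s. 1) \<in> phase_space S \<tau>" by (simp add: phase_space_def)
  then have sol: "is_delay_solution S \<tau> (linear_rhs S d a \<beta>) (\<lambda>i s. 1) z"
    unfolding z_def by (rule linear_solution_exists[OF S])
  show "z i t = 1" if "i \<in> S" "- \<tau> i \<le> t" "t \<le> 0"
    using sol that unfolding is_delay_solution_def by auto
  show "(z i has_real_derivative
    undelayed S z i t + \<beta> i t * z i (t - \<tau> i)) (at t within {0..})"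
    if "i \<in> S" "0 \<le> t"
    using sol that unfolding is_delay_solution_def linear_rhs_def by blast
qed

lemma z_nonneg: "i \<in> S \<Longrightarrow> - \<tau> i \<le> t \<Longrightarrow> 0 \<le> z i t"
proof (rule nonneg_of_affine_inequality[OF S z_der])
  show "undelayed S z i t
      \<le> undelayed S z i t + \<beta> i t * z i (t - \<tau> i)"
    if "i \<in> S" "0 \<le> t" "0 \<le> z i (t - \<tau> i)" for i t
    using that \<beta>_nonneg[of i t] S by auto
qed (auto simp: z_ini)

lemma z_supersolution: "supersolution S z"
  unfolding supersolution_def
proof (intro conjI ballI allI impI exI)
  fix i and t :: real assume it: "i \<in> S" "0 \<le> t"
  then have \<tau>: "- \<tau> i \<le> t" "- \<tau> i \<le> t - \<tau> i" using block_delay[of i] by auto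
  show "0 \<le> z i t" by (rule z_nonneg[OF it(1) \<tau>(1)])
  show "(z i has_real_derivative
    undelayed S z i t + \<beta> i t * z i (t - \<tau> i)) (at t within {0..})"
    by (rule z_der[OF it])
  show "undelayed S z i t
      \<le> undelayed S z i t + \<beta> i t * z i (t - \<tau> i)"
    using z_nonneg[OF it(1) \<tau>(2)] \<beta>_nonneg[of i t] it S by auto
qed

lemma z_lower: "i \<in> S \<Longrightarrow> 0 \<le> t \<Longrightarrow> exp (- K * t) \<le> z i t"
  using supersolution_decay[OF S z_supersolution, of i 0 t] z_ini[of i 0] block_delay[of i] by simp

text \<open>Over one delay a component shrinks at most by \<open>exp (- K * h)\<close>, so its
  present value controls the delayed ones. For negative \<open>s\<close> the initial value 1 is
  compared with \<open>z_lower\<close>.\<close>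

lemma z_le_later:
  assumes "i \<in> S" "0 \<le> t" "t - \<tau> i \<le> s" "s \<le> t"
  shows "z i s \<le> exp (K * h) * z i t"
proof -
  have *: "exp (- (K * h)) * z i s \<le> z i t"
  proof (cases "0 \<le> s")
    case True
    have "exp (- (K * h)) * z i s \<le> exp (- K * (t - s)) * z i s"
      using K block_delay[OF assms(1)] assms supersolution_nonneg[OF z_supersolution assms(1) True]
      by (intro mult_right_mono) auto
    also have "\<dots> \<le> z i t" by (rule supersolution_decay[OF S z_supersolution assms(1) True assms(4)])
    finally show ?thesis .
  next
    case False
    have "exp (- (K * h)) * z i s = exp (- (K * h))" using False assms by (simp add: z_ini)
    also have "\<dots> \<le> exp (- K * t)" using K False assms block_delay[OF assms(1)] by simp
    also have "\<dots> \<le> z i t" by (rule z_lower[OF assms(1,2)])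
    finally show ?thesis .
  qed
  have "exp (K * h) * (exp (- (K * h)) * z i s) \<le> exp (K * h) * z i t"
    using * by (intro mult_left_mono) auto
  then show ?thesis by (simp only: exp_mult_cancel)
qed

lemma \<sigma>_pos: "0 \<le> t \<Longrightarrow> 0 < \<sigma> t"
  unfolding \<sigma>_def using S_fin S_ne
  by (intro sum_pos less_le_trans[OF exp_gt_zero z_lower])

lemma z_le_\<sigma>: "i \<in> S \<Longrightarrow> 0 \<le> t \<Longrightarrow> z i t \<le> \<sigma> t"
  unfolding \<sigma>_def using S_fin supersolution_nonneg[OF z_supersolution]
  by (intro member_le_sum[of i S "\<lambda>i. z i t"]) auto

text \<open>The delayed term is dominated by the present value, so the delay equation has the Harnack
  inequality of an ordinary cooperative system, uniformly in time.\<close>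

lemma harnack:
  "\<exists>\<kappa> C. 0 < \<kappa> \<and> \<kappa> \<le> 1 \<and> 0 < C \<and>
     (\<forall>t\<ge>0. \<forall>i\<in>S. \<forall>s. t - \<tau> i \<le> s \<longrightarrow> s \<le> t \<longrightarrow> \<kappa> * \<sigma> t \<le> z i s \<and> \<kappa> * z i s \<le> \<sigma> t) \<and>
     (\<forall>s\<ge>0. \<forall>t\<ge>s. \<sigma> t \<le> exp (C * (t - s)) * \<sigma> s \<and> exp (- C * (t - s)) * \<sigma> s \<le> \<sigma> t)"
proof -
  define m where "m = real (card S)"
  have m: "1 \<le> m" using S_fin S_ne by (simp add: m_def Suc_leI card_gt_0_iff)
  \<comment> \<open>Growth rate of the total: \<open>m * K\<close> from the couplings and
    \<open>K * exp (K * h)\<close> from births, expressed through present values.\<close>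
  define C where "C = m * K + K * exp (K * h)"
  have KC: "K \<le> C" using m K by (simp add: C_def add_increasing2 mult_le_cancel_right1)
  have C: "0 < C" using KC K by simp
  have up: "\<sigma> t \<le> exp (C * (t - s)) * \<sigma> s" if st: "0 \<le> s" "s \<le> t" for s t
    unfolding \<sigma>_def
  proof (rule differential_inequality_upper[OF st])
    fix r assume "s \<le> r" "r \<le> t"
    then have r: "0 \<le> r" using st by simp
    show "((\<lambda>t. \<Sum>i\<in>S. z i t) has_real_derivative
        (\<Sum>i\<in>S. - d i r * z i r + (\<Sum>l\<in>S. a i l r * z l r) + \<beta> i r * z i (r - \<tau> i))) (at r within {0..})"
      by (intro DERIV_sum z_der r)
    have "(\<Sum>i\<in>S. - d i r * z i r + (\<Sum>l\<in>S. a i l r * z l r) + \<beta> i r * z i (r - \<tau> i))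
        \<le> (\<Sum>i\<in>S. 0 + (\<Sum>l\<in>S. K * z l r) + K * (exp (K * h) * z i r))"
    proof (intro sum_mono add_mono)
      fix i assume i: "i \<in> S"
      then have iN: "i \<in> {1..n}" using S by blast
      have nn: "0 \<le> z i r" by (rule supersolution_nonneg[OF z_supersolution i r])
      then show "- d i r * z i r \<le> 0" using d_nonneg[OF iN] by simp
      show "a i l r * z l r \<le> K * z l r" if "l \<in> S" for l
        using coeff_abs_le(2)[OF S i that] supersolution_nonneg[OF z_supersolution that r]
        by (intro mult_right_mono) auto
      show "\<beta> i r * z i (r - \<tau> i) \<le> K * (exp (K * h) * z i r)"
        using \<beta>_le[OF iN] K z_le_later[OF i r order_refl] z_nonneg[OF i] block_delay[OF i] r
        by (intro mult_mono) auto
    qed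
    also have "\<dots> = C * (\<Sum>i\<in>S. z i r)"
      by (simp add: C_def m_def sum.distrib sum_distrib_left[symmetric] algebra_simps)
    finally show "(\<Sum>i\<in>S. - d i r * z i r + (\<Sum>l\<in>S. a i l r * z l r) + \<beta> i r * z i (r - \<tau> i))
        \<le> C * (\<Sum>i\<in>S. z i r)" .
  qed
  have down: "exp (- C * (t - s)) * \<sigma> s \<le> \<sigma> t" if st: "0 \<le> s" "s \<le> t" for s t
  proof -
    have "exp (- C * (t - s)) * \<sigma> s \<le> exp (- K * (t - s)) * \<sigma> s"
      using KC st \<sigma>_pos[OF st(1)] by (intro mult_right_mono) (auto intro: mult_right_mono)
    also have "\<dots> \<le> \<sigma> t"
      unfolding \<sigma>_def sum_distrib_left by (intro sum_mono supersolution_decay[OF S z_supersolution _ st])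
    finally show ?thesis .
  qed
  obtain T \<kappa>1 where T: "T \<ge> 0" "\<kappa>1 > 0" and
    sp: "\<And>i l t. i \<in> S \<Longrightarrow> l \<in> S \<Longrightarrow> 0 \<le> t \<Longrightarrow> \<kappa>1 * z l t \<le> z i (t + T)"
    using reaches_uniform[OF S conn] z_supersolution by metis
  \<comment> \<open>From time \<open>T\<close> on, spreading with \<open>\<kappa>1\<close> applies;
    before it, \<open>exp (- K * T)\<close> comes from the initial value 1. The factor
    \<open>exp (- C * T)\<close> compensates the growth of \<open>\<sigma>\<close> over at most
    \<open>T\<close>, and \<open>m\<close> passes from the total to one component.\<close>
  define \<kappa>2 where "\<kappa>2 = min \<kappa>1 (exp (- K * T)) * exp (- C * T) / m"
  have \<kappa>2: "\<kappa>2 > 0" using T m by (simp add: \<kappa>2_def)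
  have \<sigma>0: "\<sigma> 0 = m" unfolding \<sigma>_def m_def using z_ini block_delay by (simp add: less_imp_le)
  have h1: "\<kappa>2 * \<sigma> t \<le> z i t" if i: "i \<in> S" and t: "0 \<le> t" for i t
  proof (cases "T \<le> t")
    case True
    have "\<kappa>1 * \<sigma> (t - T) = (\<Sum>l\<in>S. \<kappa>1 * z l (t - T))" by (simp add: \<sigma>_def sum_distrib_left)
    also have "\<dots> \<le> (\<Sum>l\<in>S. z i t)" using sp[OF i, of _ "t - T"] True by (intro sum_mono) auto
    also have "\<dots> = m * z i t" by (simp add: m_def)
    finally have 1: "\<kappa>1 * \<sigma> (t - T) / m \<le> z i t" using m by (simp add: field_simps)
    have "\<kappa>2 * \<sigma> t \<le> \<kappa>1 * exp (- C * T) / m * \<sigma> t"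
      unfolding \<kappa>2_def using m \<sigma>_pos[OF t] by (intro mult_right_mono divide_right_mono) auto
    also have "\<dots> \<le> \<kappa>1 * exp (- C * T) / m * (exp (C * T) * \<sigma> (t - T))"
      using up[of "t - T" t] True T m by (intro mult_left_mono) auto
    also have "\<dots> = \<kappa>1 * \<sigma> (t - T) / m" by (simp add: exp_minus)
    finally show ?thesis using 1 by simp
  next
    case False
    have "\<kappa>2 * \<sigma> t \<le> exp (- K * T) * exp (- C * T) / m * (exp (C * t) * m)"
      unfolding \<kappa>2_def using m \<sigma>_pos[OF t] up[of 0 t] t \<sigma>0 by (intro mult_mono divide_right_mono mult_right_mono) auto
    also have "\<dots> = exp (- K * T) * exp (- C * (T - t))" using m by (simp add: exp_add[symmetric] algebra_simps)
    also have "\<dots> \<le> exp (- K * t) * 1" using False K C by (intro mult_mono) auto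
    also have "\<dots> \<le> z i t" using z_lower[OF i t] by simp
    finally show ?thesis .
  qed
  have \<kappa>2m: "\<kappa>2 * m \<le> 1"
  proof -
    have "\<kappa>2 * m \<le> exp (- K * T) * exp (- C * T)" using m by (simp add: \<kappa>2_def mult_right_mono)
    also have "\<dots> \<le> 1 * 1" using K C T by (intro mult_mono) auto
    finally show ?thesis by simp
  qed
  \<comment> \<open>The first entry carries the lower bound from \<open>t\<close> back to a delayed
    time; the second yields the upper bound by \<open>z_le_later\<close>.\<close>
  define \<kappa> where "\<kappa> = min (\<kappa>2 * exp (- C * h)) (exp (- K * h))"
  have \<kappa>: "0 < \<kappa>" "\<kappa> \<le> 1" using \<kappa>2 K h by (auto simp: \<kappa>_def min_le_iff_disj)
  have main: "\<kappa> * \<sigma> t \<le> z i s \<and> \<kappa> * z i s \<le> \<sigma> t"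
    if t: "0 \<le> t" and i: "i \<in> S" and s: "t - \<tau> i \<le> s" "s \<le> t" for t i s
  proof
    have "\<kappa> * z i s \<le> exp (- K * h) * z i s"
      unfolding \<kappa>_def using z_nonneg[OF i, of s] s t by (intro mult_right_mono) auto
    also have "\<dots> \<le> exp (- K * h) * (exp (K * h) * z i t)" using z_le_later[OF i t s] by (intro mult_left_mono) auto
    also have "\<dots> \<le> \<sigma> t" using z_le_\<sigma>[OF i t] by (simp add: exp_mult_cancel)
    finally show "\<kappa> * z i s \<le> \<sigma> t" .
    have le: "\<kappa> * \<sigma> t \<le> \<kappa>2 * exp (- C * h) * \<sigma> t"
      unfolding \<kappa>_def using \<sigma>_pos[OF t] by (intro mult_right_mono) auto
    show "\<kappa> * \<sigma> t \<le> z i s"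
    proof (cases "0 \<le> s")
      case True
      have "\<sigma> t \<le> exp (C * (t - s)) * \<sigma> s" using up[OF True s(2)] .
      also have "\<dots> \<le> exp (C * h) * \<sigma> s"
        using C s block_delay[OF i] \<sigma>_pos[OF True] by (intro mult_right_mono) auto
      finally have "\<kappa>2 * exp (- C * h) * \<sigma> t \<le> \<kappa>2 * exp (- C * h) * (exp (C * h) * \<sigma> s)"
        using \<kappa>2 by (intro mult_left_mono) auto
      also have "\<dots> \<le> z i s" using h1[OF i True] by (simp add: mult.assoc exp_mult_cancel)
      finally show ?thesis using le by simp
    next
      case False
      have "\<sigma> t \<le> exp (C * t) * m" using up[OF order_refl t] \<sigma>0 by simp
      also have "\<dots> \<le> exp (C * h) * m" using C False s block_delay[OF i] m by (intro mult_right_mono) auto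
      finally have "\<kappa>2 * exp (- C * h) * \<sigma> t \<le> \<kappa>2 * exp (- C * h) * (exp (C * h) * m)"
        using \<kappa>2 by (intro mult_left_mono) auto
      also have "\<dots> \<le> 1" using \<kappa>2m by (simp add: mult.assoc exp_mult_cancel)
      also have "1 = z i s" using False s t z_ini[OF i, of s] by simp
      finally show ?thesis using le by simp
    qed
  qed
  show ?thesis using \<kappa> C main up down by blast
qed

end

section \<open>Growth over translated time intervals and the exponent\<close>

context irreducible_block begin

lemma z_shift_der:
  assumes "i \<in> S" "0 \<le> p" "0 \<le> t"
  shows "((\<lambda>t. z i (p + t)) has_real_derivative
    - d i (p + t) * z i (p + t) + (\<Sum>l\<in>S. a i l (p + t) * z l (p + t)) + \<beta> i (p + t) * z i (p + t - \<tau> i))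
    (at t within {0..})"
  using assms by (intro has_real_derivative_shift z_der) auto

text \<open>Multiplied by the exponential \<open>W\<close>, the solution along \<open>q\<close>
  becomes a supersolution of the equation along \<open>p\<close>. The coefficient errors act on
  components and delayed values that the Harnack inequality bounds by the present component, so the
  rate \<open>G * \<epsilon>\<close> absorbs them. \<open>A\<close> does not depend on the starting
  times.\<close>

lemma growth_comparison:
  "\<exists>A\<ge>0. \<forall>\<epsilon> p q T. 0 < \<epsilon> \<longrightarrow> \<epsilon> \<le> 1 \<longrightarrow> 0 \<le> p \<longrightarrow> 0 \<le> q \<longrightarrow> 0 \<le> T \<longrightarrow>
     (\<forall>t\<ge>0. \<forall>i\<in>S. \<bar>d i (p + t) - d i (q + t)\<bar> \<le> \<epsilon> \<and> \<bar>\<beta> i (p + t) - \<beta> i (q + t)\<bar> \<le> \<epsilon> \<and>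
        (\<forall>l\<in>S. \<bar>a i l (p + t) - a i l (q + t)\<bar> \<le> \<epsilon>)) \<longrightarrow>
     ln (\<sigma> (p + T)) - ln (\<sigma> p) \<le> ln (\<sigma> (q + T)) - ln (\<sigma> q) + A * \<epsilon> * T + A"
proof -
  obtain \<kappa> where \<kappa>: "0 < \<kappa>" "\<kappa> \<le> 1" and
    har': "\<forall>t\<ge>0. \<forall>i\<in>S. \<forall>s. t - \<tau> i \<le> s \<longrightarrow> s \<le> t \<longrightarrow> \<kappa> * \<sigma> t \<le> z i s \<and> \<kappa> * z i s \<le> \<sigma> t"
    using harnack by (elim exE conjE) (rule that)
  have har: "\<kappa> * \<sigma> t \<le> z i s" "\<kappa> * z i s \<le> \<sigma> t" if "0 \<le> t" "i \<in> S" "t - \<tau> i \<le> s" "s \<le> t" for t i s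
    using har' that by blast+
  \<comment> \<open>The errors in \<open>d\<close>, in the couplings and in \<open>\<beta>\<close>
    cost the factors 1, \<open>1 / \<kappa>\<close> and the square of \<open>1 / \<kappa>\<close>,
    of which the last is the largest.\<close>
  define G where "G = 3 / \<kappa>\<^sup>2"
  have G: "0 < G" using \<kappa> by (simp add: G_def)
  have G3: "1 + 1 / \<kappa> + 1 / \<kappa>\<^sup>2 \<le> G"
  proof -
    have "\<kappa>\<^sup>2 \<le> \<kappa>" using \<kappa> by (simp add: power2_eq_square mult_left_le)
    then have "1 / \<kappa> \<le> 1 / \<kappa>\<^sup>2" "1 \<le> 1 / \<kappa>\<^sup>2" using \<kappa> by (auto intro!: frac_le simp: power_le_one)
    then show ?thesis by (simp add: G_def)
  qed
  define A where "A = G * (1 + h) - 2 * ln \<kappa>"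
  have lnk: "ln \<kappa> \<le> 0" using \<kappa> by simp
  have A: "G \<le> A" "G * h - 2 * ln \<kappa> \<le> A" "0 \<le> A"
  proof -
    have "0 < G * h" using G h by simp
    then show "G \<le> A" "G * h - 2 * ln \<kappa> \<le> A" "0 \<le> A" using G lnk by (simp_all add: A_def distrib_left)
  qed
  have "ln (\<sigma> (p + T)) - ln (\<sigma> p) \<le> ln (\<sigma> (q + T)) - ln (\<sigma> q) + A * \<epsilon> * T + A"
    if \<epsilon>: "0 < \<epsilon>" "\<epsilon> \<le> 1" and p: "0 \<le> p" and q: "0 \<le> q" and T: "0 \<le> T"
      and cl: "\<forall>t\<ge>0. \<forall>i\<in>S. \<bar>d i (p + t) - d i (q + t)\<bar> \<le> \<epsilon> \<and> \<bar>\<beta> i (p + t) - \<beta> i (q + t)\<bar> \<le> \<epsilon> \<and>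
        (\<forall>l\<in>S. \<bar>a i l (p + t) - a i l (q + t)\<bar> \<le> \<epsilon>)" for \<epsilon> p q T
  proof -
    have close: "\<bar>d i (p + t) - d i (q + t)\<bar> \<le> \<epsilon>" "\<bar>\<beta> i (p + t) - \<beta> i (q + t)\<bar> \<le> \<epsilon>"
      "l \<in> S \<Longrightarrow> \<bar>a i l (p + t) - a i l (q + t)\<bar> \<le> \<epsilon>" if "0 \<le> t" "i \<in> S" for t i l
      using cl that by blast+
    \<comment> \<open>By the Harnack bounds at \<open>p\<close> and at \<open>q\<close>, this
      multiple of the segment at \<open>q\<close> dominates the segment at \<open>p\<close>.\<close>
    define B where "B = \<sigma> p / (\<kappa>\<^sup>2 * \<sigma> q)"
    have B: "0 < B" using \<sigma>_pos[OF p] \<sigma>_pos[OF q] \<kappa> by (simp add: B_def)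
    \<comment> \<open>The shift by \<open>h\<close> keeps \<open>W\<close> above \<open>B\<close> on
      the initial segment.\<close>
    define W where "W t = B * exp (G * \<epsilon> * (t + h))" for t
    have W: "0 < W t" for t using B by (simp add: W_def)
    have W_der: "(W has_real_derivative G * \<epsilon> * W t) (at t within {0..})" for t
      unfolding W_def by (rule derivative_eq_intros refl)+ simp
    have W_mono: "W s \<le> W t" if "s \<le> t" for s t
      using that B G \<epsilon> by (simp add: W_def mult_left_mono)
    have BW: "B \<le> W t" if "- h \<le> t" for t
      using that B G \<epsilon> by (simp add: W_def mult_le_cancel_left1)
    have "0 \<le> W T * z i (q + T) - z i (p + T)" if i: "i \<in> S" for i
    proof (rule cooperative_delay_nonneg[where p = 0 and q = T and S = S and K = K and \<tau> = \<tau> and i = i and t = T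
          and d = "\<lambda>i t. d i (p + t)" and a = "\<lambda>i l t. a i l (p + t)"
          and u = "\<lambda>i t. W t * z i (q + t) - z i (p + t)"
          and u' = "\<lambda>i t. (G * \<epsilon> * W t * z i (q + t) + W t *
             (- d i (q + t) * z i (q + t) + (\<Sum>l\<in>S. a i l (q + t) * z l (q + t)) + \<beta> i (q + t) * z i (q + t - \<tau> i)))
             - (- d i (p + t) * z i (p + t) + (\<Sum>l\<in>S. a i l (p + t) * z l (p + t)) + \<beta> i (p + t) * z i (p + t - \<tau> i))"])
      show "finite S" by (rule S_fin)
      show "0 < \<tau> i" if "i \<in> S" for i using block_delay that by blast
      show "0 - \<tau> i \<le> T" using block_delay[OF i] T by auto
    next
      fix i t assume i: "i \<in> S" and t: "0 \<le> t" "t \<le> T"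
      show "((\<lambda>t. W t * z i (q + t) - z i (p + t)) has_real_derivative
          (G * \<epsilon> * W t * z i (q + t) + W t *
             (- d i (q + t) * z i (q + t) + (\<Sum>l\<in>S. a i l (q + t) * z l (q + t)) + \<beta> i (q + t) * z i (q + t - \<tau> i)))
             - (- d i (p + t) * z i (p + t) + (\<Sum>l\<in>S. a i l (p + t) * z l (p + t)) + \<beta> i (p + t) * z i (p + t - \<tau> i)))
          (at t within {0..})"
        by (rule DERIV_diff[OF _ z_shift_der[OF i p t(1)]])
          (rule DERIV_cong[OF DERIV_mult[OF W_der z_shift_der[OF i q t(1)]]], simp add: algebra_simps)
    next
      fix i t assume i: "i \<in> S" and t: "0 - \<tau> i \<le> t" "t \<le> 0"
      have "z i (p + t) \<le> \<sigma> p / \<kappa>" using har(2)[OF p i, of "p + t"] t \<kappa> by (simp add: field_simps)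
      also have "\<dots> = B * (\<kappa> * \<sigma> q)" using \<kappa> \<sigma>_pos[OF q] by (simp add: B_def power2_eq_square)
      also have "\<dots> \<le> W t * z i (q + t)"
        using har(1)[OF q i, of "q + t"] BW[of t] B W[of t] \<kappa> \<sigma>_pos[OF q] t block_delay[OF i]
        by (intro mult_mono) auto
      finally show "0 \<le> W t * z i (q + t) - z i (p + t)" by simp
    next
      fix i t assume i: "i \<in> S" and t: "0 \<le> t" "t \<le> T"
        and del: "0 \<le> W (t - \<tau> i) * z i (q + (t - \<tau> i)) - z i (p + (t - \<tau> i))"
      have iN: "i \<in> {1..n}" using i S by blast
      have qt: "0 \<le> q + t" and pt: "0 \<le> p + t" using q p t by auto
      define x where "x = z i (q + t)"
      define w where "w = z i (q + t - \<tau> i)"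
      have x: "0 < x" using har(1)[OF qt i, of "q + t"] \<kappa> \<sigma>_pos[OF qt] block_delay[OF i]
        unfolding x_def by (meson less_le_trans mult_pos_pos diff_le_eq le_add_same_cancel1 less_imp_le order_refl)
      have \<sigma>x: "\<sigma> (q + t) \<le> x / \<kappa>" using har(1)[OF qt i, of "q + t"] \<kappa> block_delay[OF i]
        by (simp add: x_def field_simps)
      have w: "0 \<le> w" unfolding w_def using qt block_delay[OF i] by (intro z_nonneg[OF i]) auto
      have wx: "w \<le> x / \<kappa>\<^sup>2"
      proof -
        have "w \<le> \<sigma> (q + t) / \<kappa>" using har(2)[OF qt i, of "q + t - \<tau> i"] \<kappa> block_delay[OF i]
          by (simp add: w_def field_simps)
        also have "\<dots> \<le> x / \<kappa> / \<kappa>" using \<sigma>x \<kappa> by (intro divide_right_mono) auto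
        finally show ?thesis by (simp add: power2_eq_square)
      qed
      have "0 \<le> G * \<epsilon> * x + (d i (p + t) - d i (q + t)) * x
          + (\<Sum>l\<in>S. (a i l (q + t) - a i l (p + t)) * z l (q + t)) + (\<beta> i (q + t) - \<beta> i (p + t)) * w"
      proof -
        have 1: "- \<epsilon> * x \<le> (d i (p + t) - d i (q + t)) * x"
          using close(1)[OF t(1) i] x by (intro mult_right_mono) auto
        have "(\<Sum>l\<in>S. - \<epsilon> * z l (q + t)) \<le> (\<Sum>l\<in>S. (a i l (q + t) - a i l (p + t)) * z l (q + t))"
        proof (intro sum_mono mult_right_mono)
          fix l assume l: "l \<in> S"
          show "- \<epsilon> \<le> a i l (q + t) - a i l (p + t)" using close(3)[OF t(1) i l] by linarith
          show "0 \<le> z l (q + t)" by (rule supersolution_nonneg[OF z_supersolution l qt])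
        qed
        then have 2: "- \<epsilon> * \<sigma> (q + t) \<le> (\<Sum>l\<in>S. (a i l (q + t) - a i l (p + t)) * z l (q + t))"
          by (simp only: \<sigma>_def sum_distrib_left)
        have 4: "- \<epsilon> * (x / \<kappa>) \<le> - \<epsilon> * \<sigma> (q + t)" using \<sigma>x \<epsilon> by (intro mult_left_mono_neg) auto
        have "- \<epsilon> * (x / \<kappa>\<^sup>2) \<le> - \<epsilon> * w" using wx \<epsilon> by (intro mult_left_mono_neg) auto
        also have "\<dots> \<le> (\<beta> i (q + t) - \<beta> i (p + t)) * w"
          using close(2)[OF t(1) i] w by (intro mult_right_mono) auto
        finally have 3: "- \<epsilon> * (x / \<kappa>\<^sup>2) \<le> (\<beta> i (q + t) - \<beta> i (p + t)) * w" .
        have "(1 + 1 / \<kappa> + 1 / \<kappa>\<^sup>2) * (\<epsilon> * x) \<le> G * (\<epsilon> * x)" using G3 \<epsilon> x by (intro mult_right_mono) auto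
        moreover have "(1 + 1 / \<kappa> + 1 / \<kappa>\<^sup>2) * (\<epsilon> * x) = \<epsilon> * x + \<epsilon> * (x / \<kappa>) + \<epsilon> * (x / \<kappa>\<^sup>2)"
          by (simp add: algebra_simps)
        ultimately show ?thesis using 1 2 3 4 by simp
      qed
      then have "0 \<le> W t * (G * \<epsilon> * x + (d i (p + t) - d i (q + t)) * x
          + (\<Sum>l\<in>S. (a i l (q + t) - a i l (p + t)) * z l (q + t)) + (\<beta> i (q + t) - \<beta> i (p + t)) * w)"
        using W[of t] by (intro mult_nonneg_nonneg) auto
      moreover have "\<beta> i (p + t) * z i (p + t - \<tau> i) \<le> \<beta> i (p + t) * (W t * w)"
      proof (rule mult_left_mono)
        have "z i (p + t - \<tau> i) \<le> W (t - \<tau> i) * w" using del by (simp add: w_def algebra_simps)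
        \<comment> \<open>\<open>W\<close> is nondecreasing, so the delayed comparison survives with
          the present weight.\<close>
        also have "\<dots> \<le> W t * w" using W_mono[of "t - \<tau> i" t] block_delay[OF i] w by (intro mult_right_mono) auto
        finally show "z i (p + t - \<tau> i) \<le> W t * w" .
      qed (rule \<beta>_nonneg[OF iN pt])
      ultimately show "- d i (p + t) * (W t * z i (q + t) - z i (p + t)) +
          (\<Sum>l\<in>S. a i l (p + t) * (W t * z l (q + t) - z l (p + t)))
          \<le> (G * \<epsilon> * W t * z i (q + t) + W t *
             (- d i (q + t) * z i (q + t) + (\<Sum>l\<in>S. a i l (q + t) * z l (q + t)) + \<beta> i (q + t) * z i (q + t - \<tau> i)))
             - (- d i (p + t) * z i (p + t) + (\<Sum>l\<in>S. a i l (p + t) * z l (p + t)) + \<beta> i (p + t) * z i (p + t - \<tau> i))"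
        by (simp add: x_def[symmetric] w_def[symmetric] algebra_simps sum_subtractf sum_distrib_left)
    qed (use coeff_abs_le[OF S] T i in auto)
    then have "\<sigma> (p + T) \<le> W T * \<sigma> (q + T)"
      unfolding \<sigma>_def sum_distrib_left by (intro sum_mono) auto
    then have "ln (\<sigma> (p + T)) \<le> ln (W T * \<sigma> (q + T))" using \<sigma>_pos[of "p + T"] p T by simp
    also have "\<dots> = ln (\<sigma> p) - 2 * ln \<kappa> - ln (\<sigma> q) + G * \<epsilon> * (T + h) + ln (\<sigma> (q + T))"
      using B \<kappa> \<sigma>_pos[OF p] \<sigma>_pos[OF q] \<sigma>_pos[of "q + T"] q T
      by (simp add: W_def B_def ln_mult ln_div ln_realpow)
    also have "\<dots> \<le> ln (\<sigma> p) - ln (\<sigma> q) + A * \<epsilon> * T + A + ln (\<sigma> (q + T))"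
    proof -
      have "G * \<epsilon> * T \<le> A * \<epsilon> * T" using A(1) \<epsilon> T by (intro mult_right_mono) auto
      moreover have "G * \<epsilon> * h \<le> G * h" using G \<epsilon> h by (simp add: mult_le_cancel_left1)
      ultimately show ?thesis using A(2) by (simp add: algebra_simps)
    qed
    finally show ?thesis by simp
  qed
  then show ?thesis using A(3) by blast
qed

text \<open>A common almost period \<open>r\<close> of all coefficients lies at most
  \<open>L\<close> after \<open>s\<close>. Growth from \<open>r\<close> and growth from 0 agree by
  two applications of the comparison, and moving from \<open>r\<close> back to \<open>s\<close>
  costs \<open>2 * C * L\<close>, since \<open>ln \<sigma>\<close> is Lipschitz.\<close>

lemma ln_\<sigma>_almost_additive:
  assumes "0 < \<epsilon>"
  shows "\<exists>D. \<forall>s\<ge>0. \<forall>T\<ge>0. \<bar>ln (\<sigma> (s + T)) - ln (\<sigma> s) - ln (\<sigma> T)\<bar> \<le> \<epsilon> * T + D"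
proof -
  obtain A where A: "0 \<le> A" and cmp': "\<forall>\<epsilon> p q T. 0 < \<epsilon> \<longrightarrow> \<epsilon> \<le> 1 \<longrightarrow> 0 \<le> p \<longrightarrow> 0 \<le> q \<longrightarrow> 0 \<le> T \<longrightarrow>
     (\<forall>t\<ge>0. \<forall>i\<in>S. \<bar>d i (p + t) - d i (q + t)\<bar> \<le> \<epsilon> \<and> \<bar>\<beta> i (p + t) - \<beta> i (q + t)\<bar> \<le> \<epsilon> \<and>
        (\<forall>l\<in>S. \<bar>a i l (p + t) - a i l (q + t)\<bar> \<le> \<epsilon>)) \<longrightarrow>
     ln (\<sigma> (p + T)) - ln (\<sigma> p) \<le> ln (\<sigma> (q + T)) - ln (\<sigma> q) + A * \<epsilon> * T + A"
    using growth_comparison by (elim exE conjE) (rule that)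
  obtain C where C: "0 < C" and
    gr: "\<forall>s\<ge>0. \<forall>t\<ge>s. \<sigma> t \<le> exp (C * (t - s)) * \<sigma> s \<and> exp (- C * (t - s)) * \<sigma> s \<le> \<sigma> t"
    using harnack by (elim exE conjE) (rule that)
  have lip: "\<bar>ln (\<sigma> t) - ln (\<sigma> s)\<bar> \<le> C * (t - s)" if st: "0 \<le> s" "s \<le> t" for s t
  proof -
    have p: "0 < \<sigma> s" "0 < \<sigma> t" using st by (auto intro: \<sigma>_pos)
    have "\<sigma> t \<le> exp (C * (t - s)) * \<sigma> s" "exp (- C * (t - s)) * \<sigma> s \<le> \<sigma> t" using gr st by blast+
    then have "ln (\<sigma> t) \<le> ln (exp (C * (t - s)) * \<sigma> s)" "ln (exp (- C * (t - s)) * \<sigma> s) \<le> ln (\<sigma> t)"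
      using p by simp_all
    then show ?thesis using p by (simp add: ln_mult)
  qed
  \<comment> \<open>A tolerance with \<open>A * e \<le> \<epsilon>\<close>, capped at 1 as the
    comparison demands.\<close>
  define e where "e = min 1 (\<epsilon> / (A + 1))"
  have e: "0 < e" "e \<le> 1" using assms A by (auto simp: e_def)
  have Ae: "A * e \<le> \<epsilon>"
  proof -
    have "A * e \<le> (A + 1) * (\<epsilon> / (A + 1))" using A e by (intro mult_mono) (auto simp: e_def)
    then show ?thesis using A by simp
  qed
  define F where "F = d ` S \<union> \<beta> ` S \<union> (\<lambda>(i, l). a i l) ` (S \<times> S)"
  have "relatively_dense {r. \<forall>f\<in>F. \<forall>t. \<bar>f (t + r) - f t\<bar> < e}"
    by (rule common_almost_periods) (use S S_fin e ap in \<open>auto simp: F_def subset_iff\<close>)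
  then obtain L where L: "0 < L" "\<forall>x. \<exists>r\<in>{r. \<forall>f\<in>F. \<forall>t. \<bar>f (t + r) - f t\<bar> < e}. x \<le> r \<and> r \<le> x + L"
    unfolding relatively_dense_def by (elim exE conjE) (rule that)
  have "\<bar>ln (\<sigma> (s + T)) - ln (\<sigma> s) - ln (\<sigma> T)\<bar> \<le> \<epsilon> * T + (A + 2 * C * L + \<bar>ln (\<sigma> 0)\<bar>)"
    if s: "0 \<le> s" and T: "0 \<le> T" for s T
  proof -
    obtain r where r: "\<And>f t. f \<in> F \<Longrightarrow> \<bar>f (t + r) - f t\<bar> < e" "s \<le> r" "r \<le> s + L"
      using L(2) by blast
    have r0: "0 \<le> r" using r s by simp
    have per: "\<bar>f (r + t) - f (0 + t)\<bar> \<le> e \<and> \<bar>f (0 + t) - f (r + t)\<bar> \<le> e" if "f \<in> F" for f t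
      using r(1)[OF that, of t] by (simp add: add.commute abs_minus_commute)
    have F: "d i \<in> F" "\<beta> i \<in> F" "l \<in> S \<Longrightarrow> a i l \<in> F" if "i \<in> S" for i l
      using that by (auto simp: F_def)
    have "ln (\<sigma> (r + T)) - ln (\<sigma> r) \<le> ln (\<sigma> (0 + T)) - ln (\<sigma> 0) + A * e * T + A"
      by (rule cmp'[rule_format]) (use e r0 T per F in auto)
    moreover have "ln (\<sigma> (0 + T)) - ln (\<sigma> 0) \<le> ln (\<sigma> (r + T)) - ln (\<sigma> r) + A * e * T + A"
      by (rule cmp'[rule_format]) (use e r0 T per F in auto)
    moreover have "A * e * T \<le> \<epsilon> * T" using Ae T by (rule mult_right_mono)
    moreover have "\<bar>ln (\<sigma> (r + T)) - ln (\<sigma> (s + T))\<bar> \<le> C * L" "\<bar>ln (\<sigma> r) - ln (\<sigma> s)\<bar> \<le> C * L"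
    proof -
      have "C * (r - s) \<le> C * L" using C r by simp
      then show "\<bar>ln (\<sigma> (r + T)) - ln (\<sigma> (s + T))\<bar> \<le> C * L" "\<bar>ln (\<sigma> r) - ln (\<sigma> s)\<bar> \<le> C * L"
        using lip[of "s + T" "r + T"] lip[of s r] s r T by auto
    qed
    ultimately show ?thesis by simp
  qed
  then show ?thesis by blast
qed

text \<open>On a delay segment every value of every component is comparable with
  \<open>\<sigma> t\<close>, so the norm and the total have the same exponent.\<close>

lemma phase_norm_bounds:
  "\<exists>\<kappa>>0. \<forall>t\<ge>0. \<kappa> * \<sigma> t \<le> phase_norm S \<tau> (segment z t) \<and> \<kappa> * phase_norm S \<tau> (segment z t) \<le> \<sigma> t"
proof -
  obtain \<kappa> where \<kappa>: "0 < \<kappa>" "\<kappa> \<le> 1" and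
    har': "\<forall>t\<ge>0. \<forall>i\<in>S. \<forall>s. t - \<tau> i \<le> s \<longrightarrow> s \<le> t \<longrightarrow> \<kappa> * \<sigma> t \<le> z i s \<and> \<kappa> * z i s \<le> \<sigma> t"
    using harnack by (elim exE conjE) (rule that)
  have "\<kappa> * \<sigma> t \<le> phase_norm S \<tau> (segment z t) \<and> \<kappa> * phase_norm S \<tau> (segment z t) \<le> \<sigma> t" if t: "0 \<le> t" for t
  proof -
    define f where "f i = (SUP s\<in>{- \<tau> i..0}. \<bar>z i (t + s)\<bar>)" for i
    have N: "phase_norm S \<tau> (segment z t) = Max (f ` S)" by (simp add: phase_norm_def segment_def f_def)
    have bounds: "\<kappa> * \<sigma> t \<le> \<bar>z i (t + s)\<bar>" "\<bar>z i (t + s)\<bar> \<le> \<sigma> t / \<kappa>" if "i \<in> S" "s \<in> {- \<tau> i..0}" for i s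
    proof -
      have "\<kappa> * \<sigma> t \<le> z i (t + s) \<and> \<kappa> * z i (t + s) \<le> \<sigma> t" using har' t that by auto
      moreover have "0 \<le> z i (t + s)" using that t by (intro z_nonneg) auto
      ultimately show "\<kappa> * \<sigma> t \<le> \<bar>z i (t + s)\<bar>" "\<bar>z i (t + s)\<bar> \<le> \<sigma> t / \<kappa>" using \<kappa> by (auto simp: field_simps)
    qed
    have f: "\<kappa> * \<sigma> t \<le> f i" "f i \<le> \<sigma> t / \<kappa>" if i: "i \<in> S" for i
    proof -
      have 0: "0 \<in> {- \<tau> i..0}" using block_delay[OF i] by simp
      have bdd: "bdd_above ((\<lambda>s. \<bar>z i (t + s)\<bar>) ` {- \<tau> i..0})" using bounds(2)[OF i] by (rule bdd_aboveI2)
      show "\<kappa> * \<sigma> t \<le> f i" unfolding f_def by (rule cSUP_upper2[OF bdd 0 bounds(1)[OF i 0]])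
      show "f i \<le> \<sigma> t / \<kappa>" unfolding f_def using 0 bounds(2)[OF i] by (intro cSUP_least) auto
    qed
    have "\<kappa> * \<sigma> t \<le> Max (f ` S)" using f(1) S_fin S_ne by (subst Max_ge_iff) auto
    moreover have "Max (f ` S) \<le> \<sigma> t / \<kappa>" using f(2) S_fin S_ne by (subst Max_le_iff) auto
    ultimately show ?thesis unfolding N using \<kappa> by (simp add: field_simps)
  qed
  then show ?thesis using \<kappa>(1) by blast
qed

text \<open>The limit comes from the slope of \<open>ln \<sigma>\<close> seen from time 0. Almost
  additivity carries this slope over to every starting time with one constant \<open>D\<close>,
  which the limit alone would not give.\<close>

lemma lyapunov_exponent_exists:
  "\<exists>lam. ((\<lambda>t. ln (phase_norm S \<tau> (segment z t)) / t) \<longlongrightarrow> lam) at_top \<and>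
     (\<forall>\<epsilon>>0. \<exists>D. \<forall>s\<ge>0. \<forall>T\<ge>0. \<bar>ln (\<sigma> (s + T)) - ln (\<sigma> s) - lam * T\<bar> \<le> \<epsilon> * T + D)"
proof -
  obtain C where C: "0 < C" and
    gr: "\<forall>s\<ge>0. \<forall>t\<ge>s. \<sigma> t \<le> exp (C * (t - s)) * \<sigma> s \<and> exp (- C * (t - s)) * \<sigma> s \<le> \<sigma> t"
    using harnack by (elim exE conjE) (rule that)
  have bd: "\<bar>ln (\<sigma> t)\<bar> \<le> (C + \<bar>ln (\<sigma> 0)\<bar>) * (t + 1)" if t: "0 \<le> t" for t
  proof -
    have p: "0 < \<sigma> 0" "0 < \<sigma> t" using t by (auto intro: \<sigma>_pos)
    have "\<sigma> t \<le> exp (C * (t - 0)) * \<sigma> 0" "exp (- C * (t - 0)) * \<sigma> 0 \<le> \<sigma> t" using gr t by blast+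
    then have "ln (\<sigma> t) \<le> ln (exp (C * (t - 0)) * \<sigma> 0)" "ln (exp (- C * (t - 0)) * \<sigma> 0) \<le> ln (\<sigma> t)"
      using p by simp_all
    then have "\<bar>ln (\<sigma> t)\<bar> \<le> C * t + \<bar>ln (\<sigma> 0)\<bar>" using p by (simp add: ln_mult)
    moreover have "0 \<le> \<bar>ln (\<sigma> 0)\<bar> * t" using t by simp
    ultimately show ?thesis using C by (simp add: algebra_simps)
  qed
  obtain lam where lam: "\<And>\<epsilon>. 0 < \<epsilon> \<Longrightarrow> \<exists>D. \<forall>t\<ge>0. \<bar>ln (\<sigma> t) - lam * t\<bar> \<le> \<epsilon> * t + D"
    using slope_of_almost_additive[OF ln_\<sigma>_almost_additive bd] by blast
  obtain \<kappa> where \<kappa>: "\<kappa> > 0" and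
    pn': "\<forall>t\<ge>0. \<kappa> * \<sigma> t \<le> phase_norm S \<tau> (segment z t) \<and> \<kappa> * phase_norm S \<tau> (segment z t) \<le> \<sigma> t"
    using phase_norm_bounds by blast
  define N where "N t = phase_norm S \<tau> (segment z t)" for t
  have lnN: "\<bar>ln (N t) - ln (\<sigma> t)\<bar> \<le> \<bar>ln \<kappa>\<bar>" if t: "0 \<le> t" for t
  proof -
    have 1: "\<kappa> * \<sigma> t \<le> N t" "\<kappa> * N t \<le> \<sigma> t" using pn' t by (auto simp: N_def)
    have p: "0 < \<sigma> t" "0 < \<kappa> * \<sigma> t" using \<sigma>_pos[OF t] \<kappa> by auto
    have q: "0 < N t" using 1(1) p(2) by linarith
    have "ln (\<kappa> * \<sigma> t) \<le> ln (N t)" "ln (\<kappa> * N t) \<le> ln (\<sigma> t)"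
      using 1 p q \<kappa> by simp_all
    then show ?thesis using p(1) q \<kappa> by (simp add: ln_mult)
  qed
  have "((\<lambda>t. ln (N t) / t) \<longlongrightarrow> lam) at_top"
  proof (rule tendstoI)
    fix e :: real assume e: "0 < e"
    obtain D where D: "\<And>t. 0 \<le> t \<Longrightarrow> \<bar>ln (\<sigma> t) - lam * t\<bar> \<le> e / 2 * t + D" using lam[of "e / 2"] e by auto
    show "\<forall>\<^sub>F t in at_top. dist (ln (N t) / t) lam < e"
      using eventually_gt_at_top[of "max 1 (2 * (\<bar>D\<bar> + \<bar>ln \<kappa>\<bar>) / e)"]
    proof eventually_elim
      case (elim t)
      then have t: "1 < t" and tD: "\<bar>D\<bar> + \<bar>ln \<kappa>\<bar> < e / 2 * t" using e by (auto simp: field_simps)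
      have "\<bar>ln (N t) - lam * t\<bar> \<le> \<bar>ln \<kappa>\<bar> + e / 2 * t + D" using lnN[of t] D[of t] t by linarith
      also have "\<dots> < e * t" using tD by simp
      finally have "\<bar>(ln (N t) - lam * t) / t\<bar> < e" using t by (simp add: field_simps)
      moreover have "(ln (N t) - lam * t) / t = ln (N t) / t - lam" using t by (simp add: field_simps)
      ultimately show ?case by (simp add: dist_real_def)
    qed
  qed
  moreover have "\<exists>D. \<forall>s\<ge>0. \<forall>T\<ge>0. \<bar>ln (\<sigma> (s + T)) - ln (\<sigma> s) - lam * T\<bar> \<le> \<epsilon> * T + D" if "0 < \<epsilon>" for \<epsilon>
  proof -
    have e2: "0 < \<epsilon> / 2" using that by simp
    obtain D where D: "\<forall>s\<ge>0. \<forall>T\<ge>0. \<bar>ln (\<sigma> (s + T)) - ln (\<sigma> s) - ln (\<sigma> T)\<bar> \<le> \<epsilon> / 2 * T + D"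
      using ln_\<sigma>_almost_additive[OF e2] by blast
    obtain D' where D': "\<forall>t\<ge>0. \<bar>ln (\<sigma> t) - lam * t\<bar> \<le> \<epsilon> / 2 * t + D'" using lam[OF e2] by blast
    have "\<bar>ln (\<sigma> (s + T)) - ln (\<sigma> s) - lam * T\<bar> \<le> \<epsilon> * T + (D + D')" if "0 \<le> s" "0 \<le> T" for s T
    proof -
      have "\<bar>ln (\<sigma> (s + T)) - ln (\<sigma> s) - ln (\<sigma> T)\<bar> \<le> \<epsilon> / 2 * T + D" "\<bar>ln (\<sigma> T) - lam * T\<bar> \<le> \<epsilon> / 2 * T + D'"
        using D D' that by blast+
      then show ?thesis by simp
    qed
    then show ?thesis by blast
  qed
  ultimately show ?thesis unfolding N_def by blast
qed

end

section \<open>Persistence and extinction of a block\<close>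

text \<open>Up to the level \<open>\<delta>\<close> the Ricker term is nearly linear, and between
  \<open>\<delta>\<close> and \<open>B\<close> it has a positive lower bound. Hence only the
  comparison function has to be small in the doubling argument, while the solution itself may range
  up to \<open>B\<close>.\<close>

lemma ricker_ge_min:
  fixes w c K B \<delta> :: real
  assumes "0 \<le> w" "w \<le> B" "0 \<le> c" "c \<le> K" "0 \<le> \<delta>"
  shows "min (exp (- K * \<delta>) * w) (\<delta> * exp (- K * B)) \<le> w * exp (- c * w)"
proof (cases "w \<le> \<delta>")
  case True
  have "c * w \<le> K * \<delta>" using assms True by (intro mult_mono) auto
  then have "exp (- K * \<delta>) * w \<le> exp (- c * w) * w" using assms by (intro mult_right_mono) auto
  then show ?thesis by (simp add: min_le_iff_disj mult.commute)
next
  case False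
  have "c * w \<le> K * B" using assms by (intro mult_mono) auto
  then have "\<delta> * exp (- K * B) \<le> w * exp (- c * w)" using assms False by (intro mult_mono) auto
  then show ?thesis by (simp add: min_le_iff_disj)
qed

section \<open>Notions of persistence and extinction for a block\<close>

context nicholson_system begin

text \<open>The inequality leaves room for nonnegative inputs from other blocks.\<close>

definition nicholson_supersolution :: "nat set \<Rightarrow> (nat \<Rightarrow> real \<Rightarrow> real) \<Rightarrow> bool" where
  "nicholson_supersolution S y \<longleftrightarrow> (\<forall>i\<in>S. \<forall>t\<ge>- \<tau> i. 0 \<le> y i t) \<and>
     (\<exists>y'. \<forall>i\<in>S. \<forall>t\<ge>0. (y i has_real_derivative y' i t) (at t within {0..}) \<and>
        undelayed S y i t + birth y i t
          \<le> y' i t)"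

text \<open>Equality expresses that nothing enters \<open>S\<close> from outside, as a comparison
  from above requires.\<close>

definition closed_nicholson_solution :: "nat set \<Rightarrow> (nat \<Rightarrow> real \<Rightarrow> real) \<Rightarrow> bool" where
  "closed_nicholson_solution S y \<longleftrightarrow> (\<forall>i\<in>S. \<forall>t\<ge>- \<tau> i. 0 \<le> y i t) \<and>
     (\<forall>i\<in>S. \<forall>t\<ge>0. (y i has_real_derivative
        undelayed S y i t + birth y i t)
        (at t within {0..}))"

text \<open>The level \<open>m\<close> may depend on the eventual bound \<open>B\<close> but on
  nothing else of the solution; ultimate boundedness later supplies one \<open>B\<close> for
  all.\<close>

definition block_persists :: "nat set \<Rightarrow> bool" where
  "block_persists S \<longleftrightarrow> (\<forall>B>0. \<exists>m>0. \<forall>y. nicholson_supersolution S y \<longrightarrow>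
     (\<exists>tB\<ge>0. \<forall>t\<ge>tB. \<forall>i\<in>S. y i t \<le> B) \<longrightarrow>
     (\<exists>p\<in>S. \<exists>t\<ge>0. 0 < y p t) \<longrightarrow> (\<exists>t0\<ge>0. \<forall>t\<ge>t0. \<forall>i\<in>S. m \<le> y i t))"

text \<open>Weaker than convergence to 0: no component stays above a positive level. This is exactly
  what contradicts persistence.\<close>

definition block_goes_extinct :: "nat set \<Rightarrow> bool" where
  "block_goes_extinct S \<longleftrightarrow> (\<forall>y p m t0. closed_nicholson_solution S y \<longrightarrow> p \<in> S \<longrightarrow> 0 < m \<longrightarrow> 0 \<le> t0 \<longrightarrow>
     \<not> (\<forall>t\<ge>t0. m \<le> y p t))"

end

context irreducible_block begin

lemma nicholson_supersolution_imp_supersolution: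
  assumes "nicholson_supersolution S y"
  shows "supersolution S y"
proof -
  obtain y' where y': "\<forall>i\<in>S. \<forall>t\<ge>0. (y i has_real_derivative y' i t) (at t within {0..}) \<and>
        undelayed S y i t + birth y i t
          \<le> y' i t"
    using assms unfolding nicholson_supersolution_def by (elim exE conjE) (rule that)
  have nn: "0 \<le> y i t" if "i \<in> S" "- \<tau> i \<le> t" for i t
    using assms that unfolding nicholson_supersolution_def by blast
  show ?thesis
    unfolding supersolution_def
  proof (intro conjI ballI allI impI exI)
    fix i and t :: real assume it: "i \<in> S" "0 \<le> t"
    then have \<tau>: "- \<tau> i \<le> t" "- \<tau> i \<le> t - \<tau> i" using block_delay[of i] by auto
    show "0 \<le> y i t" by (rule nn[OF it(1) \<tau>(1)])
    show "(y i has_real_derivative y' i t) (at t within {0..})" using y' it by blast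
    have "0 \<le> birth y i t"
      using nn[OF it(1) \<tau>(2)] \<beta>_nonneg[of i t] it S by (intro mult_nonneg_nonneg) auto
    moreover have "undelayed S y i t
        + birth y i t \<le> y' i t"
      using y' it by blast
    ultimately show "undelayed S y i t \<le> y' i t" by linarith
  qed
qed

lemma block_spread:
  "\<exists>T\<ge>0. \<exists>\<kappa>>0. \<forall>y. supersolution S y \<longrightarrow> (\<forall>i\<in>S. \<forall>l\<in>S. \<forall>t\<ge>0. \<kappa> * y l t \<le> y i (t + T))"
  by (rule reaches_uniform[OF S]) (rule conn)

definition uniform_slope :: "real \<Rightarrow> bool" where
  "uniform_slope lam \<longleftrightarrow>
     (\<forall>\<epsilon>>0. \<exists>D. \<forall>s\<ge>0. \<forall>T\<ge>0. \<bar>ln (\<sigma> (s + T)) - ln (\<sigma> s) - lam * T\<bar> \<le> \<epsilon> * T + D)"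

text \<open>As long as \<open>y\<close> stays below a small level, \<open>y\<close> dominates the solution of the linear system
  with \<open>\<beta>\<close> replaced by \<open>\<gamma> \<beta>\<close>, and \<open>exp (- \<mu> t) z t\<close> is a subsolution of the latter if \<open>\<gamma>\<close>
  is close to 1; over a time span \<open>T\<close> this subsolution doubles.\<close>

lemma doubling:
  assumes lam: "0 < lam" and
    slope: "uniform_slope lam"
    and B: "0 < B"
  shows "\<exists>T>0. \<exists>\<eta>0>0. \<forall>y tB s \<eta>. nicholson_supersolution S y \<longrightarrow> 0 \<le> tB \<longrightarrow> (\<forall>t\<ge>tB. \<forall>i\<in>S. y i t \<le> B) \<longrightarrow>
     tB + h \<le> s \<longrightarrow> 0 < \<eta> \<longrightarrow> \<eta> \<le> \<eta>0 \<longrightarrow> (\<forall>i\<in>S. \<forall>t\<in>{s - \<tau> i..s}. \<eta> \<le> y i t) \<longrightarrow>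
     (\<forall>i\<in>S. \<forall>t\<in>{s + T - \<tau> i..s + T}. 2 * \<eta> \<le> y i t)"
proof -
  obtain \<kappa> C where \<kappa>: "0 < \<kappa>" "\<kappa> \<le> 1" and C: "0 < C" and
    har': "\<forall>t\<ge>0. \<forall>i\<in>S. \<forall>s. t - \<tau> i \<le> s \<longrightarrow> s \<le> t \<longrightarrow> \<kappa> * \<sigma> t \<le> z i s \<and> \<kappa> * z i s \<le> \<sigma> t"
    and gr: "\<forall>s\<ge>0. \<forall>t\<ge>s. \<sigma> t \<le> exp (C * (t - s)) * \<sigma> s \<and> exp (- C * (t - s)) * \<sigma> s \<le> \<sigma> t"
    using harnack by (elim exE conjE) (rule that)
  have har: "\<kappa> * \<sigma> t \<le> z i s" "\<kappa> * z i s \<le> \<sigma> t" if "0 \<le> t" "i \<in> S" "t - \<tau> i \<le> s" "s \<le> t" for t i s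
    using har' that by blast+
  \<comment> \<open>One quarter of the slope pays for the error in \<open>slope\<close>, one quarter
    for the damping of births, and one half remains for growth.\<close>
  define \<mu> where "\<mu> = lam / 4"
  have \<mu>: "0 < \<mu>" using lam by (simp add: \<mu>_def)
  obtain D where D: "\<forall>s\<ge>0. \<forall>T\<ge>0. \<bar>ln (\<sigma> (s + T)) - ln (\<sigma> s) - lam * T\<bar> \<le> \<mu> * T + D"
    using slope \<mu> unfolding uniform_slope_def by blast
  \<comment> \<open>By the Harnack inequality the loss of the fraction \<open>1 - \<gamma>\<close>
    of the births is at most \<open>\<mu>\<close> times the present component; 1/2 keeps
    \<open>\<gamma>\<close> positive.\<close>
  define \<gamma> where "\<gamma> = max (1 / 2) (1 - \<mu> * \<kappa>\<^sup>2 / K)"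
  have \<gamma>: "0 < \<gamma>" "\<gamma> < 1" "(1 - \<gamma>) * K \<le> \<mu> * \<kappa>\<^sup>2"
  proof -
    show "0 < \<gamma>" "\<gamma> < 1" using \<mu> \<kappa> K by (auto simp: \<gamma>_def less_max_iff_disj)
    have "1 - \<gamma> \<le> \<mu> * \<kappa>\<^sup>2 / K" by (simp add: \<gamma>_def)
    then show "(1 - \<gamma>) * K \<le> \<mu> * \<kappa>\<^sup>2" using K by (simp add: field_simps)
  qed
  define \<delta> where "\<delta> = - ln \<gamma> / K"
  have \<delta>: "0 < \<delta>" "exp (- K * \<delta>) = \<gamma>" using \<gamma> K by (auto simp: \<delta>_def divide_neg_pos)
  define \<delta>1 where "\<delta>1 = \<delta> * exp (- K * B)"
  have \<delta>1: "0 < \<delta>1" using \<delta> by (simp add: \<delta>1_def)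
  \<comment> \<open>Net growth at rate \<open>lam / 2\<close> has to yield the factor 2 after the
    Harnack losses and the shift by \<open>h\<close>; \<open>T \<ge> h\<close> keeps the target
    segment after \<open>s\<close>.\<close>
  define T where "T = max h ((ln (2 / \<kappa>\<^sup>2) + \<mu> * h + D) / (lam / 2))"
  have T: "h \<le> T" "0 < T" using h by (auto simp: T_def less_max_iff_disj)
  have TD: "ln (2 / \<kappa>\<^sup>2) \<le> lam / 2 * T - \<mu> * h - D"
  proof -
    have "(ln (2 / \<kappa>\<^sup>2) + \<mu> * h + D) / (lam / 2) \<le> T" by (simp add: T_def)
    then show ?thesis using lam by (simp add: field_simps)
  qed
  \<comment> \<open>The reference solution grows at most by \<open>exp (C * T)\<close> during the
    span, so a comparison function started at this level stays below
    \<open>\<delta>1\<close>.\<close>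
  define \<eta>0 where "\<eta>0 = \<delta>1 * exp (- C * T)"
  have \<eta>0: "0 < \<eta>0" using \<delta>1 by (simp add: \<eta>0_def)
  have "2 * \<eta> \<le> y i t"
    if y: "nicholson_supersolution S y" and tB: "0 \<le> tB" "\<forall>t\<ge>tB. \<forall>i\<in>S. y i t \<le> B" and s: "tB + h \<le> s"
      and \<eta>: "0 < \<eta>" "\<eta> \<le> \<eta>0" and ini: "\<forall>i\<in>S. \<forall>t\<in>{s - \<tau> i..s}. \<eta> \<le> y i t"
      and it: "i \<in> S" "t \<in> {s + T - \<tau> i..s + T}" for y tB s \<eta> i t
  proof -
    have s0: "0 \<le> s" using s tB h by simp
    obtain y' where y': "\<forall>i\<in>S. \<forall>t\<ge>0. (y i has_real_derivative y' i t) (at t within {0..}) \<and>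
        undelayed S y i t + birth y i t
          \<le> y' i t"
      using y unfolding nicholson_supersolution_def by (elim exE conjE) (rule that)
    have nn: "0 \<le> y i t" if "i \<in> S" "- \<tau> i \<le> t" for i t
      using y that unfolding nicholson_supersolution_def by blast
    \<comment> \<open>Normalized so that \<open>Q * z\<close> is at most \<open>\<eta>\<close> on
      the segment ending at \<open>s\<close>.\<close>
    define Q where "Q = \<eta> * \<kappa> / \<sigma> s"
    have Q: "0 < Q" using \<eta> \<kappa> \<sigma>_pos[OF s0] by (simp add: Q_def)
    define V where "V t = Q * exp (- \<mu> * (t - s + h))" for t
    have V: "0 < V t" for t using Q by (simp add: V_def)
    have V_der: "(V has_real_derivative - \<mu> * V t) (at t within {0..})" for t
      unfolding V_def by (rule derivative_eq_intros refl)+ simp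
    have V_le: "V t \<le> \<eta> * \<kappa> / \<sigma> s" if "s - h \<le> t" for t
      unfolding Q_def[symmetric] using that \<mu> Q by (simp add: V_def)
    have V_mono: "V t2 \<le> V t1" if "t1 \<le> t2" for t1 t2
      using that \<mu> Q by (simp add: V_def)
    have "0 \<le> y i t - V t * z i t"
    proof (rule cooperative_delay_nonneg[where p = s and q = "s + T" and S = S and K = K and \<tau> = \<tau> and i = i
          and t = t and d = d and a = a
          and u = "\<lambda>i t. y i t - V t * z i t"
          and u' = "\<lambda>i t. y' i t - (- \<mu> * V t * z i t + V t *
             (undelayed S z i t + \<beta> i t * z i (t - \<tau> i)))"])
      show "finite S" by (rule S_fin)
      show "0 < \<tau> i" if "i \<in> S" for i using block_delay that by blast
      show "s - \<tau> i \<le> t" "t \<le> s + T" using it T by auto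
    next
      fix i t assume i: "i \<in> S" and t: "s \<le> t" "t \<le> s + T"
      have t0: "0 \<le> t" using t s0 by simp
      show "((\<lambda>t. y i t - V t * z i t) has_real_derivative y' i t - (- \<mu> * V t * z i t + V t *
             (undelayed S z i t + \<beta> i t * z i (t - \<tau> i)))) (at t within {0..})"
      proof (rule DERIV_diff)
        show "(y i has_real_derivative y' i t) (at t within {0..})" using y' i t0 by blast
        show "((\<lambda>t. V t * z i t) has_real_derivative - \<mu> * V t * z i t + V t *
             (undelayed S z i t + \<beta> i t * z i (t - \<tau> i))) (at t within {0..})"
          by (rule DERIV_cong[OF DERIV_mult[OF V_der z_der[OF i t0]]]) (simp add: algebra_simps)
      qed
    next
      fix i t assume i: "i \<in> S" and t: "s - \<tau> i \<le> t" "t \<le> s"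
      have "V t * z i t \<le> \<eta> * \<kappa> / \<sigma> s * z i t"
        using t s0 block_delay[OF i] by (intro mult_right_mono V_le z_nonneg[OF i]) auto
      also have "\<dots> = \<eta> / \<sigma> s * (\<kappa> * z i t)" by simp
      also have "\<dots> \<le> \<eta> / \<sigma> s * \<sigma> s"
        using har(2)[OF s0 i t] \<eta> \<sigma>_pos[OF s0] by (intro mult_left_mono) auto
      also have "\<dots> = \<eta>" using \<sigma>_pos[OF s0] by simp
      also have "\<eta> \<le> y i t" using ini i t by simp
      finally show "0 \<le> y i t - V t * z i t" by simp
    next
      fix i t assume i: "i \<in> S" and t: "s \<le> t" "t \<le> s + T"
        and del: "0 \<le> y i (t - \<tau> i) - V (t - \<tau> i) * z i (t - \<tau> i)"
      have iN: "i \<in> {1..n}" using i S by blast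
      have t0: "0 \<le> t" using t s0 by simp
      define w where "w = z i (t - \<tau> i)"
      define q where "q = y i (t - \<tau> i)"
      have \<tau>i: "0 < \<tau> i" "\<tau> i \<le> h" using block_delay[OF i] by auto
      have w: "0 \<le> w" unfolding w_def using t0 by (intro z_nonneg[OF i]) auto
      have q: "0 \<le> q" unfolding q_def using t0 by (intro nn[OF i]) auto
      have qB: "q \<le> B" unfolding q_def using tB(2) i t s \<tau>i by simp
      have Vq: "V t * w \<le> q"
      proof -
        have "V t * w \<le> V (t - \<tau> i) * w" using \<tau>i w by (intro mult_right_mono V_mono) auto
        then show ?thesis using del by (simp add: w_def q_def)
      qed
      have Vw: "V t * w \<le> \<delta>1"
      proof -
        have "V t * w \<le> \<eta> * \<kappa> / \<sigma> s * w" using t h w by (intro mult_right_mono V_le) auto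
        also have "\<dots> = \<eta> / \<sigma> s * (\<kappa> * w)" by simp
        also have "\<dots> \<le> \<eta> / \<sigma> s * (exp (C * T) * \<sigma> s)"
        proof (rule mult_left_mono)
          have "\<kappa> * w \<le> \<sigma> t" unfolding w_def using \<tau>i by (intro har(2)[OF t0 i]) auto
          also have "\<dots> \<le> exp (C * (t - s)) * \<sigma> s" using gr s0 t by blast
          also have "\<dots> \<le> exp (C * T) * \<sigma> s" using C t \<sigma>_pos[OF s0] by (intro mult_right_mono) auto
          finally show "\<kappa> * w \<le> exp (C * T) * \<sigma> s" .
        qed (use \<eta> \<sigma>_pos[OF s0] in auto)
        also have "\<dots> = exp (C * T) * \<eta>" using \<sigma>_pos[OF s0] by simp
        also have "\<dots> \<le> exp (C * T) * (exp (- (C * T)) * \<delta>1)"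
          using \<eta>(2) by (intro mult_left_mono) (auto simp: \<eta>0_def mult.commute)
        also have "\<dots> = \<delta>1" by (rule exp_mult_cancel)
        finally show ?thesis .
      qed
      have "\<gamma> * (V t * w) \<le> min (\<gamma> * q) \<delta>1"
      proof -
        have "\<gamma> * (V t * w) \<le> 1 * (V t * w)" using \<gamma> V[of t] w by (intro mult_right_mono) auto
        then show ?thesis using Vw mult_left_mono[OF Vq, of \<gamma>] \<gamma> by simp
      qed
      also have "\<dots> \<le> q * exp (- c i t * q)"
        using ricker_ge_min[OF q qB c_nonneg[OF iN t0] c_le[OF iN], of \<delta>] \<delta> by (simp add: \<delta>1_def)
      finally have "\<beta> i t * (\<gamma> * (V t * w)) \<le> \<beta> i t * (q * exp (- c i t * q))"
        using \<beta>_nonneg[OF iN t0] by (rule mult_left_mono)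
      moreover have "V t * ((1 - \<gamma>) * \<beta> i t * w) \<le> V t * (\<mu> * z i t)"
      proof (rule mult_left_mono)
        have "(1 - \<gamma>) * \<beta> i t * w \<le> (1 - \<gamma>) * K * w"
          using \<gamma> \<beta>_le[OF iN] w by (intro mult_right_mono mult_left_mono) auto
        also have "\<dots> \<le> \<mu> * \<kappa>\<^sup>2 * w" using \<gamma>(3) w by (rule mult_right_mono)
        also have "\<dots> = \<mu> * \<kappa> * (\<kappa> * w)" by (simp add: power2_eq_square)
        also have "\<dots> \<le> \<mu> * \<kappa> * \<sigma> t"
          unfolding w_def using \<mu> \<kappa> \<tau>i by (intro mult_left_mono har(2)[OF t0 i]) auto
        also have "\<dots> = \<mu> * (\<kappa> * \<sigma> t)" by simp
        also have "\<dots> \<le> \<mu> * z i t" using \<mu> \<tau>i by (intro mult_left_mono har(1)[OF t0 i]) auto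
        finally show "(1 - \<gamma>) * \<beta> i t * w \<le> \<mu> * z i t" .
      qed (use V[of t] in simp)
      moreover have "undelayed S y i t + \<beta> i t * (q * exp (- c i t * q)) \<le> y' i t"
        using y' i t0 unfolding q_def by blast
      ultimately show "- d i t * (y i t - V t * z i t) + (\<Sum>l\<in>S. a i l t * (y l t - V t * z l t))
          \<le> y' i t - (- \<mu> * V t * z i t + V t *
             (undelayed S z i t + \<beta> i t * z i (t - \<tau> i)))"
        by (simp add: w_def[symmetric] algebra_simps sum_subtractf sum_distrib_left)
    qed (use coeff_abs_le[OF S] s0 it in auto)
    then have "V t * z i t \<le> y i t" by simp
    moreover have "2 * \<eta> \<le> V t * z i t"
    proof -
      have sT: "0 \<le> s + T" using s0 T by simp
      have ts: "s \<le> t" using it T block_delay[OF it(1)] by auto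
      have "\<bar>ln (\<sigma> (s + T)) - ln (\<sigma> s) - lam * T\<bar> \<le> \<mu> * T + D" using D s0 T by simp
      then have "lam * T - \<mu> * T - D \<le> ln (\<sigma> (s + T)) - ln (\<sigma> s)" by linarith
      then have "ln (2 / \<kappa>\<^sup>2) + \<mu> * T + \<mu> * h \<le> ln (\<sigma> (s + T)) - ln (\<sigma> s)"
        using TD by (simp add: \<mu>_def algebra_simps)
      also have "\<dots> = ln (\<sigma> (s + T) / \<sigma> s)" using \<sigma>_pos[OF s0] \<sigma>_pos[OF sT] by (simp add: ln_div)
      finally have "exp (ln (2 / \<kappa>\<^sup>2) + (\<mu> * T + \<mu> * h)) \<le> exp (ln (\<sigma> (s + T) / \<sigma> s))" by simp
      then have 1: "2 / \<kappa>\<^sup>2 * exp (\<mu> * (T + h)) \<le> \<sigma> (s + T) / \<sigma> s"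
        unfolding exp_add[of "ln _"] using \<kappa> \<sigma>_pos[OF s0] \<sigma>_pos[OF sT] by (simp add: distrib_left)
      have "2 * \<eta> = \<eta> * \<kappa>\<^sup>2 * exp (- \<mu> * (T + h)) * (2 / \<kappa>\<^sup>2 * exp (\<mu> * (T + h)))"
        using \<kappa> by (simp add: exp_minus)
      also have "\<dots> \<le> \<eta> * \<kappa>\<^sup>2 * exp (- \<mu> * (T + h)) * (\<sigma> (s + T) / \<sigma> s)"
        using 1 \<eta> by (intro mult_left_mono) auto
      also have "\<dots> = \<eta> * \<kappa> / \<sigma> s * exp (- \<mu> * (T + h)) * (\<kappa> * \<sigma> (s + T))"
        by (simp add: power2_eq_square)
      also have "\<dots> \<le> V t * z i t"
      proof (rule mult_mono)
        show "\<eta> * \<kappa> / \<sigma> s * exp (- \<mu> * (T + h)) \<le> V t"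
          unfolding V_def Q_def[symmetric] using \<mu> Q it by simp
        show "\<kappa> * \<sigma> (s + T) \<le> z i t" using it by (intro har(1)[OF sT it(1)]) auto
      qed (use V[of t] \<kappa> \<sigma>_pos[OF sT] in auto)
      finally show ?thesis .
    qed
    ultimately show ?thesis by linarith
  qed
  then show ?thesis using T(2) \<eta>0 by blast
qed

text \<open>Spreading gives a first positive bound on a whole segment; doubling raises it to
  \<open>\<eta>0\<close> and then maintains that level. Between consecutive segments at most the
  factor \<open>exp (- K * T)\<close> is lost, so \<open>m\<close> does not depend on the
  solution.\<close>

lemma block_persistence:
  assumes lam: "0 < lam" and
    slope: "uniform_slope lam"
    and B: "0 < B"
  shows "\<exists>m>0. \<forall>y. nicholson_supersolution S y \<longrightarrow> (\<exists>tB\<ge>0. \<forall>t\<ge>tB. \<forall>i\<in>S. y i t \<le> B) \<longrightarrow>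
     (\<exists>p\<in>S. \<exists>t\<ge>0. 0 < y p t) \<longrightarrow> (\<exists>t0\<ge>0. \<forall>t\<ge>t0. \<forall>i\<in>S. m \<le> y i t)"
proof -
  obtain T \<eta>0 where T: "0 < T" and \<eta>0: "0 < \<eta>0" and
    dbl': "\<forall>y tB s \<eta>. nicholson_supersolution S y \<longrightarrow> 0 \<le> tB \<longrightarrow> (\<forall>t\<ge>tB. \<forall>i\<in>S. y i t \<le> B) \<longrightarrow>
     tB + h \<le> s \<longrightarrow> 0 < \<eta> \<longrightarrow> \<eta> \<le> \<eta>0 \<longrightarrow> (\<forall>i\<in>S. \<forall>t\<in>{s - \<tau> i..s}. \<eta> \<le> y i t) \<longrightarrow>
     (\<forall>i\<in>S. \<forall>t\<in>{s + T - \<tau> i..s + T}. 2 * \<eta> \<le> y i t)"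
    using doubling[OF lam slope B] by (elim exE conjE) (rule that)
  obtain T1 \<kappa>1 where T1: "T1 \<ge> 0" "\<kappa>1 > 0" and
    sp: "\<forall>y. supersolution S y \<longrightarrow> (\<forall>i\<in>S. \<forall>l\<in>S. \<forall>t\<ge>0. \<kappa>1 * y l t \<le> y i (t + T1))"
    using block_spread by (elim exE conjE) (rule that)
  define m where "m = exp (- K * T) * \<eta>0"
  have "\<exists>t0\<ge>0. \<forall>t\<ge>t0. \<forall>i\<in>S. m \<le> y i t"
    if y: "nicholson_supersolution S y" and tB: "0 \<le> tB" "\<forall>t\<ge>tB. \<forall>i\<in>S. y i t \<le> B"
      and p: "p \<in> S" "0 \<le> t1" "0 < y p t1" for y tB p t1
  proof -
    note sup = nicholson_supersolution_imp_supersolution[OF y]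
    define t2 where "t2 = t1 + T1"
    \<comment> \<open>The extra \<open>h\<close> puts the whole segment ending at \<open>s0\<close>
      after both \<open>t2\<close> and \<open>tB\<close>.\<close>
    define s0 where "s0 = max t2 tB + h"
    define \<eta> where "\<eta> = min \<eta>0 (exp (- K * (s0 - t2)) * (\<kappa>1 * y p t1))"
    have \<eta>: "0 < \<eta>" "\<eta> \<le> \<eta>0" using \<eta>0 T1 p by (auto simp: \<eta>_def)
    have t2: "0 \<le> t2" using T1 p by (simp add: t2_def)
    have s00: "0 \<le> s0" using t2 h by (simp add: s0_def)
    \<comment> \<open>The cap is forced by \<open>doubling\<close>, which accepts only levels up to
      \<open>\<eta>0\<close>.\<close>
    have seg: "\<forall>i\<in>S. \<forall>t\<in>{s0 + real k * T - \<tau> i..s0 + real k * T}. min (2 ^ k * \<eta>) \<eta>0 \<le> y i t" for k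
    proof (induction k)
      case 0
      show ?case
      proof (intro ballI)
        fix i t assume i: "i \<in> S" and "t \<in> {s0 + real 0 * T - \<tau> i..s0 + real 0 * T}"
        then have t: "t2 \<le> t" "t \<le> s0" using block_delay[OF i] by (auto simp: s0_def)
        have nn: "0 \<le> \<kappa>1 * y p t1" using T1 p by simp
        have "\<eta> \<le> exp (- K * (s0 - t2)) * (\<kappa>1 * y p t1)" by (simp add: \<eta>_def)
        also have "\<dots> \<le> exp (- K * (t - t2)) * (\<kappa>1 * y p t1)" using K t nn by (intro mult_right_mono) auto
        also have "\<dots> \<le> exp (- K * (t - t2)) * y i t2"
          using sp sup i p unfolding t2_def by (intro mult_left_mono) auto
        also have "\<dots> \<le> y i t" by (rule supersolution_decay[OF S sup i t2 t(1)])
        finally show "min (2 ^ 0 * \<eta>) \<eta>0 \<le> y i t" by simp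
      qed
    next
      case (Suc k)
      define \<eta>k where "\<eta>k = min (2 ^ k * \<eta>) \<eta>0"
      define sk where "sk = s0 + real k * T"
      have "\<forall>i\<in>S. \<forall>t\<in>{sk + T - \<tau> i..sk + T}. 2 * \<eta>k \<le> y i t"
      proof -
        have "0 < \<eta>k" "\<eta>k \<le> \<eta>0" using \<eta> \<eta>0 by (auto simp: \<eta>k_def)
        moreover have "tB + h \<le> sk" using T by (simp add: sk_def s0_def add_increasing2)
        ultimately show ?thesis
          using dbl'[rule_format, OF y tB(1), of sk \<eta>k] tB(2) Suc unfolding \<eta>k_def sk_def by blast
      qed
      moreover have "min (2 ^ Suc k * \<eta>) \<eta>0 \<le> 2 * \<eta>k" using \<eta>0 by (auto simp: \<eta>k_def min_def)
      moreover have "s0 + real (Suc k) * T = sk + T" by (simp add: sk_def algebra_simps)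
      ultimately show ?case by (metis order_trans)
    qed
    obtain k0 where "\<eta>0 / \<eta> < 2 ^ k0" using real_arch_pow[of 2 "\<eta>0 / \<eta>"] by auto
    then have k0: "\<eta>0 \<le> 2 ^ k0 * \<eta>" using \<eta>(1) by (simp add: field_simps)
    have "m \<le> y i t" if t: "s0 + real k0 * T \<le> t" and i: "i \<in> S" for i t
    proof -
      define k where "k = nat \<lfloor>(t - s0) / T\<rfloor>"
      have q: "real k0 \<le> (t - s0) / T" using t T by (simp add: field_simps)
      then have k: "real k \<le> (t - s0) / T" "(t - s0) / T < real k + 1" "k0 \<le> k"
        unfolding k_def by linarith+
      define s where "s = s0 + real k * T"
      have s: "0 \<le> s" "s \<le> t" "t - s \<le> T" using k(1,2) T s00 by (auto simp: s_def field_simps)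
      have "(2::real) ^ k0 \<le> 2 ^ k" using k(3) by (intro power_increasing) auto
      then have "\<eta>0 \<le> 2 ^ k * \<eta>" using k0 \<eta>(1) by (meson mult_right_mono less_imp_le order_trans)
      moreover have "s \<in> {s0 + real k * T - \<tau> i..s0 + real k * T}"
        using block_delay[OF i] by (simp add: s_def)
      then have "min (2 ^ k * \<eta>) \<eta>0 \<le> y i s" using seg[of k] i by blast
      ultimately have "\<eta>0 \<le> y i s" by simp
      then have "m \<le> exp (- K * T) * y i s" by (simp add: m_def)
      also have "\<dots> \<le> exp (- K * (t - s)) * y i s"
        using K s supersolution_nonneg[OF sup i s(1)] by (intro mult_right_mono) auto
      also have "\<dots> \<le> y i t" by (rule supersolution_decay[OF S sup i s(1,2)])
      finally show ?thesis .
    qed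
    moreover have "0 \<le> s0 + real k0 * T" using s00 T by simp
    ultimately show ?thesis by blast
  qed
  moreover have "0 < m" using \<eta>0 by (simp add: m_def)
  ultimately show ?thesis by blast
qed

text \<open>A solution that stays above a level loses at least the fraction
  \<open>1 - \<gamma>\<close> of its births, so the linear solution times
  \<open>exp (- \<theta> * M t)\<close> dominates it. The loss is proportional to
  \<open>\<beta> i t\<close>; hence the decay is measured by the antiderivative \<open>M\<close> of
  a common minorant of the \<open>\<beta> i\<close> and not by time itself. For
  \<open>lam \<le> 0\<close> this decay beats the growth of the linear solution.\<close>

lemma block_extinction:
  assumes lam: "lam \<le> 0" and
    slope: "uniform_slope lam"
    and nn: "\<And>i t. i \<in> S \<Longrightarrow> - \<tau> i \<le> t \<Longrightarrow> 0 \<le> y i t"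
    and der: "\<And>i t. i \<in> S \<Longrightarrow> 0 \<le> t \<Longrightarrow> (y i has_real_derivative
      undelayed S y i t + birth y i t)
      (at t within {0..})"
    and p: "p \<in> S" and m: "0 < m" and t0: "0 \<le> t0" and ge: "\<And>t. t0 \<le> t \<Longrightarrow> m \<le> y p t"
  shows False
proof -
  have "nicholson_supersolution S y"
    unfolding nicholson_supersolution_def
  proof (intro conjI ballI allI impI exI)
    show "0 \<le> y i t" if "i \<in> S" "- \<tau> i \<le> t" for i t by (rule nn[OF that])
    show "(y i has_real_derivative
      undelayed S y i t + birth y i t)
      (at t within {0..})" if "i \<in> S" "0 \<le> t" for i t by (rule der[OF that])
  qed simp
  then have sup: "supersolution S y" by (rule nicholson_supersolution_imp_supersolution)
  obtain \<kappa> where \<kappa>: "0 < \<kappa>" "\<kappa> \<le> 1" and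
    har': "\<forall>t\<ge>0. \<forall>i\<in>S. \<forall>s. t - \<tau> i \<le> s \<longrightarrow> s \<le> t \<longrightarrow> \<kappa> * \<sigma> t \<le> z i s \<and> \<kappa> * z i s \<le> \<sigma> t"
    using harnack by (elim exE conjE) (rule that)
  have har: "\<kappa> * \<sigma> t \<le> z i s" "\<kappa> * z i s \<le> \<sigma> t" if "0 \<le> t" "i \<in> S" "t - \<tau> i \<le> s" "s \<le> t" for t i s
    using har' that by blast+
  obtain T \<kappa>1 where T: "T \<ge> 0" "\<kappa>1 > 0" and
    sp: "\<forall>y. supersolution S y \<longrightarrow> (\<forall>i\<in>S. \<forall>l\<in>S. \<forall>t\<ge>0. \<kappa>1 * y l t \<le> y i (t + T))"
    using block_spread by (elim exE conjE) (rule that)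
  \<comment> \<open>Spreading carries the lower bound from \<open>p\<close> to every
    component.\<close>
  define m' where "m' = \<kappa>1 * m"
  have m': "0 < m'" using T m by (simp add: m'_def)
  have y_ge: "m' \<le> y i t" if i: "i \<in> S" and t: "t0 + T \<le> t" for i t
  proof -
    have "m' \<le> \<kappa>1 * y p (t - T)" unfolding m'_def using T ge[of "t - T"] t by (intro mult_left_mono) auto
    also have "\<dots> \<le> y i (t - T + T)"
    proof -
      have "0 \<le> t - T" using t t0 by simp
      then show ?thesis using sp sup i p by blast
    qed
    finally show ?thesis by simp
  qed
  \<comment> \<open>Upper bound for the fraction of births that survives when the delayed population
    is at least \<open>m'\<close>.\<close>
  define \<gamma> where "\<gamma> = exp (- c0 * m')"
  have \<gamma>: "0 < \<gamma>" "\<gamma> < 1" using c0 m' by (auto simp: \<gamma>_def)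
  \<comment> \<open>From \<open>t1\<close> on, all delayed arguments lie where \<open>y_ge\<close>
    holds.\<close>
  define t1 where "t1 = t0 + T + h"
  have t1: "h \<le> t1" "0 \<le> t1" using t0 T h by (auto simp: t1_def)
  have "\<exists>M g \<alpha> C. 0 < \<alpha> \<and> (\<forall>s\<ge>0. \<forall>t\<ge>s. \<alpha> * (t - s) - C \<le> M t - M s) \<and>
     (\<forall>t\<ge>0. (M has_real_derivative g t) (at t within {0..}) \<and> 0 \<le> g t \<and> (\<forall>i\<in>S. g t \<le> \<beta> i t))"
    by (rule common_minorant) (use S_fin S_ne S ap(2) \<beta>_pos in \<open>auto simp: subset_iff\<close>)
  then obtain M g \<alpha> C where \<alpha>: "0 < \<alpha>" and M': "\<forall>s\<ge>0. \<forall>t\<ge>s. \<alpha> * (t - s) - C \<le> M t - M s"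
    and g': "\<forall>t\<ge>0. (M has_real_derivative g t) (at t within {0..}) \<and> 0 \<le> g t \<and> (\<forall>i\<in>S. g t \<le> \<beta> i t)"
    by (elim exE conjE) (rule that)
  have g: "(M has_real_derivative g t) (at t within {0..})" "0 \<le> g t"
    "i \<in> S \<Longrightarrow> g t \<le> \<beta> i t" if "0 \<le> t" for t i
    using g' that by blast+
  have gK: "g t \<le> K" if "0 \<le> t" for t
    using g(3)[OF that p] \<beta>_le[of p t] p S by (meson order_trans subsetD)
  have M_mono: "M s \<le> M t" if "0 \<le> s" "s \<le> t" for s t
    by (rule has_real_derivative_nonneg_mono[OF that, where f' = g]) (use g that in auto)
  have M_lip: "M t - M s \<le> K * (t - s)" if "0 \<le> s" "s \<le> t" for s t
  proof -
    have "K * s - M s \<le> K * t - M t"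
    proof (rule has_real_derivative_nonneg_mono[OF that, where f = "\<lambda>t. K * t - M t" and f' = "\<lambda>t. K - g t"])
      fix r assume "s \<le> r" "r \<le> t"
      then have r: "0 \<le> r" using that by simp
      show "((\<lambda>t. K * t - M t) has_real_derivative K - g r) (at r within {0..})"
        by (rule derivative_eq_intros g(1)[OF r] refl)+ simp
      show "0 \<le> K - g r" using gK[OF r] by simp
    qed
    then show ?thesis by (simp add: algebra_simps)
  qed
  \<comment> \<open>The first entry keeps \<open>\<gamma>\<close> times the ratio of the weights
    across one delay below \<open>(1 + \<gamma>) / 2\<close>; the second pays for the derivative of
    the weight out of the remaining fraction \<open>(1 - \<gamma>) / 2\<close> of the
    births.\<close>
  define \<theta> where "\<theta> = min (ln ((1 + \<gamma>) / (2 * \<gamma>)) / (K * h)) (\<kappa> * (1 - \<gamma>) / 2)"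
  have \<theta>: "0 < \<theta>" "\<theta> * (K * h) \<le> ln ((1 + \<gamma>) / (2 * \<gamma>))" "\<theta> \<le> \<kappa> * (1 - \<gamma>) / 2"
  proof -
    have "1 < (1 + \<gamma>) / (2 * \<gamma>)" using \<gamma> by (simp add: field_simps)
    then show "0 < \<theta>" unfolding \<theta>_def using K h \<kappa> \<gamma> by (simp add: ln_gt_zero)
    have "\<theta> \<le> ln ((1 + \<gamma>) / (2 * \<gamma>)) / (K * h)" by (simp add: \<theta>_def)
    then show "\<theta> * (K * h) \<le> ln ((1 + \<gamma>) / (2 * \<gamma>))" using K h by (simp add: pos_le_divide_eq)
    show "\<theta> \<le> \<kappa> * (1 - \<gamma>) / 2" unfolding \<theta>_def by (rule min.cobounded2)
  qed
  have exp_le: "\<gamma> * exp (\<theta> * r) \<le> (1 + \<gamma>) / 2" if "r \<le> K * h" for r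
  proof -
    have "\<theta> * r \<le> \<theta> * (K * h)" using that \<theta>(1) by simp
    then have "exp (\<theta> * r) \<le> exp (ln ((1 + \<gamma>) / (2 * \<gamma>)))" using \<theta>(2) by simp
    also have "\<dots> = (1 + \<gamma>) / (2 * \<gamma>)" using \<gamma> by (intro exp_ln) simp
    finally show ?thesis using \<gamma> by (simp add: field_simps)
  qed
  define Y1 where "Y1 = (\<Sum>i\<in>S. y i t1)"
  have yY: "y i t1 \<le> Y1" if "i \<in> S" for i
    unfolding Y1_def using S_fin that supersolution_nonneg[OF sup _ t1(2)]
    by (intro member_le_sum[of i S "\<lambda>i. y i t1"]) auto
  have Y1: "0 < Y1" using yY[OF p] ge[of t1] m T h t1 by (simp add: t1_def)
  \<comment> \<open>Makes \<open>V t * z i t\<close> dominate \<open>y i t\<close> on the delay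
    segment ending at \<open>t1\<close>.\<close>
  define B where "B = exp (K * h) * Y1 * exp (\<theta> * M t1) / (\<kappa> * \<sigma> t1)"
  have B: "0 < B" using Y1 \<kappa> \<sigma>_pos[OF t1(2)] by (simp add: B_def)
  define V where "V t = B * exp (- \<theta> * M t)" for t
  have V: "0 < V t" for t using B by (simp add: V_def)
  have le: "y i t \<le> V t * z i t" if it: "i \<in> S" "t1 \<le> t" for i t
  proof -
    have "0 \<le> V t * z i t - y i t"
    proof (rule cooperative_delay_nonneg[where p = t1 and q = t and S = S and K = K and \<tau> = \<tau> and i = i
          and t = t and d = d and a = a
          and u = "\<lambda>i t. V t * z i t - y i t"
          and u' = "\<lambda>i t. (- \<theta> * g t * V t * z i t + V t *
             (undelayed S z i t + \<beta> i t * z i (t - \<tau> i)))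
             - (undelayed S y i t + birth y i t)"])
      show "finite S" by (rule S_fin)
      show "0 < \<tau> i" if "i \<in> S" for i using block_delay that by blast
      show "t1 - \<tau> i \<le> t" using it block_delay[OF it(1)] by auto
    next
      fix i t assume i: "i \<in> S" and t: "t1 \<le> t"
      have t0: "0 \<le> t" using t t1 by simp
      show "((\<lambda>t. V t * z i t - y i t) has_real_derivative (- \<theta> * g t * V t * z i t + V t *
             (undelayed S z i t + \<beta> i t * z i (t - \<tau> i)))
             - (undelayed S y i t + birth y i t))
          (at t within {0..})"
      proof (rule DERIV_diff[OF _ der[OF i t0]])
        have "(V has_real_derivative - \<theta> * g t * V t) (at t within {0..})"
          unfolding V_def by (rule derivative_eq_intros g(1)[OF t0] refl)+ simp
        then show "((\<lambda>t. V t * z i t) has_real_derivative - \<theta> * g t * V t * z i t + V t *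
             (undelayed S z i t + \<beta> i t * z i (t - \<tau> i))) (at t within {0..})"
          by (rule DERIV_cong[OF DERIV_mult[OF _ z_der[OF i t0]]]) (simp add: algebra_simps)
      qed
    next
      fix i t assume i: "i \<in> S" and t: "t1 - \<tau> i \<le> t" "t \<le> t1"
      have t0: "0 \<le> t" using t t1 block_delay[OF i] by simp
      have "exp (- K * h) * y i t \<le> exp (- K * (t1 - t)) * y i t"
        using K t block_delay[OF i] supersolution_nonneg[OF sup i t0] by (intro mult_right_mono) auto
      also have "\<dots> \<le> y i t1" by (rule supersolution_decay[OF S sup i t0 t(2)])
      also have "\<dots> \<le> Y1" by (rule yY[OF i])
      finally have "exp (K * h) * (exp (- (K * h)) * y i t) \<le> exp (K * h) * Y1" by simp
      then have "y i t \<le> exp (K * h) * Y1" by (simp only: exp_mult_cancel)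
      also have "\<dots> = B * exp (- \<theta> * M t1) * (\<kappa> * \<sigma> t1)"
        using \<kappa> \<sigma>_pos[OF t1(2)] by (simp add: B_def exp_minus)
      also have "\<dots> \<le> V t * z i t"
        unfolding V_def using B \<theta>(1) M_mono[OF t0 t(2)] har(1)[OF t1(2) i t] \<kappa> \<sigma>_pos[OF t1(2)]
        by (intro mult_mono) auto
      finally show "0 \<le> V t * z i t - y i t" by simp
    next
      fix i t assume i: "i \<in> S" and t: "t1 \<le> t"
        and del: "0 \<le> V (t - \<tau> i) * z i (t - \<tau> i) - y i (t - \<tau> i)"
      have iN: "i \<in> {1..n}" using i S by blast
      have \<tau>i: "0 < \<tau> i" "\<tau> i \<le> h" using block_delay[OF i] by auto
      have tt: "0 \<le> t" "0 \<le> t - \<tau> i" "t0 + T \<le> t - \<tau> i" using t t1 \<tau>i by (auto simp: t1_def)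
      define w where "w = z i (t - \<tau> i)"
      define q where "q = y i (t - \<tau> i)"
      have w: "0 \<le> w" unfolding w_def using tt by (intro z_nonneg[OF i]) auto
      have q: "m' \<le> q" unfolding q_def by (rule y_ge[OF i tt(3)])
      have b: "0 \<le> \<beta> i t" by (rule \<beta>_nonneg[OF iN tt(1)])
      have "q * exp (- c i t * q) \<le> q * \<gamma>"
      proof (rule mult_left_mono)
        have "c0 * m' \<le> c i t * q" using c_ge[OF iN tt(1)] c0 q m' by (intro mult_mono) auto
        then show "exp (- c i t * q) \<le> \<gamma>" by (simp add: \<gamma>_def)
      qed (use q m' in simp)
      also have "\<dots> \<le> V (t - \<tau> i) * w * \<gamma>"
        using del \<gamma> by (intro mult_right_mono) (auto simp: w_def q_def)
      also have "\<dots> = V t * w * (\<gamma> * exp (\<theta> * (M t - M (t - \<tau> i))))"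
      proof -
        have "exp (- \<theta> * M (t - \<tau> i)) = exp (- \<theta> * M t) * exp (\<theta> * (M t - M (t - \<tau> i)))"
          by (simp add: exp_add[symmetric] algebra_simps)
        then show ?thesis by (simp add: V_def)
      qed
      also have "\<dots> \<le> V t * w * ((1 + \<gamma>) / 2)"
      proof (intro mult_left_mono exp_le)
        have "M t - M (t - \<tau> i) \<le> K * \<tau> i" using M_lip[OF tt(2), of t] \<tau>i by simp
        also have "\<dots> \<le> K * h" using K \<tau>i by simp
        finally show "M t - M (t - \<tau> i) \<le> K * h" .
      qed (use V[of t] w in auto)
      finally have 1: "\<beta> i t * (q * exp (- c i t * q)) \<le> \<beta> i t * (V t * w * ((1 + \<gamma>) / 2))"
        using b by (rule mult_left_mono)
      have "\<theta> * g t * z i t \<le> \<beta> i t * (w * ((1 - \<gamma>) / 2))"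
      proof -
        have zi: "0 \<le> z i t" using tt \<tau>i by (intro z_nonneg[OF i]) auto
        have "\<theta> * g t * z i t = g t * (\<theta> * z i t)" by simp
        also have "\<dots> \<le> \<beta> i t * (\<theta> * z i t)"
          using g(3)[OF tt(1) i] \<theta>(1) zi by (intro mult_right_mono) auto
        also have "\<dots> \<le> \<beta> i t * (w * ((1 - \<gamma>) / 2))"
        proof (rule mult_left_mono[OF _ b])
          have "\<theta> * z i t \<le> \<kappa> * (1 - \<gamma>) / 2 * z i t" using \<theta>(3) zi by (rule mult_right_mono)
          also have "\<dots> = (1 - \<gamma>) / 2 * (\<kappa> * z i t)" by simp
          also have "\<dots> \<le> (1 - \<gamma>) / 2 * w"
          proof (rule mult_left_mono)
            have "\<kappa> * z i t \<le> \<kappa> * \<sigma> t" using \<kappa> z_le_\<sigma>[OF i tt(1)] by simp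
            also have "\<dots> \<le> w" unfolding w_def using \<tau>i by (intro har(1)[OF tt(1) i]) auto
            finally show "\<kappa> * z i t \<le> w" .
          qed (use \<gamma> in simp)
          finally show "\<theta> * z i t \<le> w * ((1 - \<gamma>) / 2)" by (simp add: mult.commute)
        qed
        finally show ?thesis .
      qed
      then have "V t * (\<theta> * g t * z i t) \<le> V t * (\<beta> i t * (w * ((1 - \<gamma>) / 2)))"
        using V[of t] by (intro mult_left_mono) auto
      moreover have "V t * (\<beta> i t * (w * ((1 - \<gamma>) / 2))) + \<beta> i t * (V t * w * ((1 + \<gamma>) / 2)) = V t * (\<beta> i t * w)"
        by (simp add: field_simps)
      ultimately have "0 \<le> - (V t * (\<theta> * g t * z i t)) + V t * (\<beta> i t * w) - \<beta> i t * (q * exp (- c i t * q))"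
        using 1 by linarith
      then show "- d i t * (V t * z i t - y i t) + (\<Sum>l\<in>S. a i l t * (V t * z l t - y l t))
          \<le> (- \<theta> * g t * V t * z i t + V t *
             (undelayed S z i t + \<beta> i t * z i (t - \<tau> i)))
             - (undelayed S y i t + birth y i t)"
        by (simp add: w_def[symmetric] q_def[symmetric] algebra_simps sum_subtractf sum_distrib_left)
    qed (use coeff_abs_le[OF S] t1 it in auto)
    then show ?thesis by simp
  qed
  have \<theta>\<alpha>: "0 < \<theta> * \<alpha> / 2" using \<theta> \<alpha> by simp
  \<comment> \<open>Half of the mean decay rate \<open>\<theta> * \<alpha>\<close> is conceded to
    the error in the slope.\<close>
  obtain D where D: "\<forall>s\<ge>0. \<forall>T\<ge>0. \<bar>ln (\<sigma> (s + T)) - ln (\<sigma> s) - lam * T\<bar> \<le> \<theta> * \<alpha> / 2 * T + D"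
    using slope \<theta>\<alpha> unfolding uniform_slope_def by blast
  \<comment> \<open>Collects the logarithms of all constants in
    \<open>m' \<le> V t * \<sigma> t\<close>, which fails once
    \<open>\<theta> * \<alpha> / 2 * t\<close> exceeds \<open>E\<close>.\<close>
  define E where "E = ln B + ln (\<sigma> 0) + D + \<theta> * (C - M 0) - ln m'"
  define t where "t = max t1 (E / (\<theta> * \<alpha> / 2) + 1)"
  have t: "t1 \<le> t" "0 \<le> t" "E < \<theta> * \<alpha> / 2 * t"
  proof -
    show "t1 \<le> t" "0 \<le> t" using t1 by (auto simp: t_def)
    have "E / (\<theta> * \<alpha> / 2) < t" by (simp add: t_def less_max_iff_disj)
    then show "E < \<theta> * \<alpha> / 2 * t" using \<theta>\<alpha> by (simp add: pos_divide_less_eq mult.commute)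
  qed
  have "m' \<le> y p t" using t T h by (intro y_ge p) (auto simp: t1_def)
  also have "\<dots> \<le> V t * z p t" by (rule le[OF p t(1)])
  also have "\<dots> \<le> V t * \<sigma> t" using V[of t] z_le_\<sigma>[OF p t(2)] by (intro mult_left_mono) auto
  finally have "ln m' \<le> ln (V t * \<sigma> t)" using m' by simp
  also have "\<dots> = ln B - \<theta> * M t + ln (\<sigma> t)"
    using B \<sigma>_pos[OF t(2)] by (simp add: V_def ln_mult)
  also have "ln (\<sigma> t) \<le> ln (\<sigma> 0) + \<theta> * \<alpha> / 2 * t + D"
  proof -
    have "\<bar>ln (\<sigma> (0 + t)) - ln (\<sigma> 0) - lam * t\<bar> \<le> \<theta> * \<alpha> / 2 * t + D" using D t(2) by blast
    moreover have "lam * t \<le> 0" using lam t(2) by (simp add: mult_nonpos_nonneg)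
    ultimately show ?thesis by simp
  qed
  finally have "ln m' \<le> ln B - \<theta> * M t + (ln (\<sigma> 0) + \<theta> * \<alpha> / 2 * t + D)" by simp
  moreover have "\<theta> * (\<alpha> * t - C + M 0) \<le> \<theta> * M t"
  proof (rule mult_left_mono)
    have "\<alpha> * (t - 0) - C \<le> M t - M 0" using M' t(2) by blast
    then show "\<alpha> * t - C + M 0 \<le> M t" by simp
  qed (use \<theta> in simp)
  ultimately have "\<theta> * \<alpha> / 2 * t \<le> E" by (simp add: E_def algebra_simps)
  then show False using t(3) by simp
qed

lemma block_dichotomy:
  "\<exists>lam. ((\<lambda>t. ln (phase_norm S \<tau> (segment (linear_solution S \<tau> d a \<beta> (\<lambda>i s. 1)) t)) / t) \<longlongrightarrow> lam) at_top \<and>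
     (0 < lam \<longrightarrow> block_persists S) \<and> (lam \<le> 0 \<longrightarrow> block_goes_extinct S)"
proof -
  obtain lam where lim: "((\<lambda>t. ln (phase_norm S \<tau> (segment z t)) / t) \<longlongrightarrow> lam) at_top"
    and slope: "uniform_slope lam"
    using lyapunov_exponent_exists[folded uniform_slope_def] by (elim exE conjE) (rule that)
  have "block_persists S" if "0 < lam"
    unfolding block_persists_def
  proof (intro allI impI)
    fix B :: real assume "0 < B"
    from block_persistence[OF that slope this]
    show "\<exists>m>0. \<forall>y. nicholson_supersolution S y \<longrightarrow> (\<exists>tB\<ge>0. \<forall>t\<ge>tB. \<forall>i\<in>S. y i t \<le> B) \<longrightarrow>
      (\<exists>p\<in>S. \<exists>t\<ge>0. 0 < y p t) \<longrightarrow> (\<exists>t0\<ge>0. \<forall>t\<ge>t0. \<forall>i\<in>S. m \<le> y i t)" .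
  qed
  moreover have "block_goes_extinct S" if "lam \<le> 0"
    unfolding block_goes_extinct_def
  proof (intro allI impI notI)
    fix y p and m t0 :: real
    assume y: "closed_nicholson_solution S y" and p: "p \<in> S" "0 < m" "0 \<le> t0" and ge: "\<forall>t\<ge>t0. m \<le> y p t"
    show False
    proof (rule block_extinction[OF that slope _ _ p])
      show "0 \<le> y i t" if "i \<in> S" "- \<tau> i \<le> t" for i t
        using y that unfolding closed_nicholson_solution_def by blast
      show "(y i has_real_derivative
        undelayed S y i t + birth y i t)
        (at t within {0..})" if "i \<in> S" "0 \<le> t" for i t
        using y that unfolding closed_nicholson_solution_def by blast
      show "m \<le> y p t" if "t0 \<le> t" for t using ge that by blast
    qed
  qed
  ultimately show ?thesis using lim unfolding z_def by blast
qed

end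

section \<open>Block structure\<close>

lemma block_offset_Suc: "1 \<le> j \<Longrightarrow> block_offset ns (Suc j) = block_offset ns j + ns j"
proof -
  assume "1 \<le> j"
  then have "{1..<Suc j} = insert j {1..<j}" by auto
  then show ?thesis by (simp add: block_offset_def)
qed

lemma block_indicesE:
  assumes "x \<in> block_indices ns j"
  obtains p where "p \<in> {1..ns j}" "x = block_offset ns j + p"
proof
  show "x - block_offset ns j \<in> {1..ns j}" "x = block_offset ns j + (x - block_offset ns j)"
    using assms by (auto simp: block_indices_def)
qed

lemma block_indicesI: "p \<in> {1..ns j} \<Longrightarrow> block_offset ns j + p \<in> block_indices ns j"
  by (auto simp: block_indices_def)

lemma block_indices_subset:
  assumes "j \<in> {1..k}"
  shows "block_indices ns j \<subseteq> {1..\<Sum>l=1..k. ns l}"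
proof -
  have "block_offset ns (Suc j) \<le> (\<Sum>l=1..k. ns l)"
    unfolding block_offset_def using assms by (intro sum_mono2) auto
  moreover have "block_offset ns (Suc j) = block_offset ns j + ns j" using assms by (intro block_offset_Suc) simp
  ultimately show ?thesis by (auto simp: block_indices_def)
qed

lemma block_indices_cover:
  "x \<in> {1..\<Sum>l=1..k. ns l} \<Longrightarrow> \<exists>j\<in>{1..k}. x \<in> block_indices ns j"
proof (induction k)
  case (Suc k)
  show ?case
  proof (cases "x \<le> (\<Sum>l=1..k. ns l)")
    case True
    then show ?thesis using Suc by fastforce
  next
    case False
    have "{1..<Suc k} = {1..k}" by auto
    then have "x \<in> block_indices ns (Suc k)"
      using False Suc.prems by (simp add: block_indices_def block_offset_def)
    then show ?thesis by (intro bexI[of _ "Suc k"]) auto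
  qed
qed simp

lemma block_zeroD:
  assumes "block_zero ns A i j" "x \<in> block_indices ns i" "y \<in> block_indices ns j"
  shows "A x y = 0"
proof -
  obtain p where p: "p \<in> {1..ns i}" "x = block_offset ns i + p" using assms(2) by (rule block_indicesE)
  obtain q where q: "q \<in> {1..ns j}" "y = block_offset ns j + q" using assms(3) by (rule block_indicesE)
  show ?thesis using assms(1) p q unfolding block_zero_def mat_block_def by blast
qed

lemma not_block_zeroE:
  assumes "\<not> block_zero ns A i j"
  obtains x y where "x \<in> block_indices ns i" "y \<in> block_indices ns j" "A x y \<noteq> 0"
proof -
  obtain p q where "p \<in> {1..ns i}" "q \<in> {1..ns j}" "A (block_offset ns i + p) (block_offset ns j + q) \<noteq> 0"
    using assms unfolding block_zero_def mat_block_def by blast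
  then show ?thesis using that block_indicesI by blast
qed

text \<open>A permutation listing \<open>C\<close> first and its complement afterwards exhibits the
  zero block, so reducibility can be checked on index sets.\<close>

lemma reducible_matI:
  assumes C: "C \<subseteq> {1..m}" "C \<noteq> {}" "C \<noteq> {1..m}"
    and zero: "\<And>x y. x \<in> C \<Longrightarrow> y \<in> {1..m} - C \<Longrightarrow> A x y = 0"
  shows "reducible_mat m A"
proof -
  define r where "r = card C"
  have fin: "finite C" using C(1) finite_subset by blast
  have r: "1 \<le> r" "r < m"
  proof -
    show "1 \<le> r" using fin C(2) by (simp add: r_def Suc_leI card_gt_0_iff)
    have "card C < card {1..m}" using C by (intro psubset_card_mono) auto
    then show "r < m" by (simp add: r_def)
  qed
  have "card {1..r} = card C" by (simp add: r_def)
  then obtain f where f: "bij_betw f {1..r} C" using fin finite_same_card_bij[of "{1..r}" C] by blast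
  have "card {r+1..m} = card ({1..m} - C)" using C(1) fin by (simp add: r_def card_Diff_subset)
  then obtain g where g: "bij_betw g {r+1..m} ({1..m} - C)"
    using finite_same_card_bij[of "{r+1..m}" "{1..m} - C"] by blast
  define p where "p x = (if x \<in> {1..r} then f x else if x \<in> {r+1..m} then g x else x)" for x
  have 1: "bij_betw p {1..r} C" using f by (rule bij_betw_cong[THEN iffD1, rotated]) (simp add: p_def)
  have 2: "bij_betw p {r+1..m} ({1..m} - C)"
    using g by (rule bij_betw_cong[THEN iffD1, rotated]) (simp add: p_def)
  have "bij_betw p ({1..r} \<union> {r+1..m}) (C \<union> ({1..m} - C))" by (rule bij_betw_combine[OF 1 2]) auto
  moreover have "{1..r} \<union> {r+1..m} = {1..m}" "C \<union> ({1..m} - C) = {1..m}" using r C(1) by auto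
  ultimately have "bij_betw p {1..m} {1..m}" by simp
  then have "p permutes {1..m}" by (rule bij_imp_permutes) (use r in \<open>auto simp: p_def\<close>)
  moreover have "A (p i) (p j) = 0" if "i \<in> {1..r}" "j \<in> {r+1..m}" for i j
    using zero 1 2 that unfolding bij_betw_def by blast
  ultimately show ?thesis using r unfolding reducible_mat_def by blast
qed

lemma uniform_eventual_lower_bound:
  fixes P :: "(nat \<Rightarrow> real \<Rightarrow> real) \<Rightarrow> bool"
  assumes "finite F" "\<And>i. i \<in> F \<Longrightarrow> \<exists>m>0. \<forall>y. P y \<longrightarrow> (\<exists>t0\<ge>0. \<forall>t\<ge>t0. m \<le> y i t)"
  shows "\<exists>m>0. \<forall>y. P y \<longrightarrow> (\<exists>t0\<ge>0. \<forall>t\<ge>t0. \<forall>i\<in>F. m \<le> y i t)"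
  using assms
proof (induction F rule: finite_induct)
  case empty
  then show ?case by (intro exI[of _ 1]) auto
next
  case (insert i F)
  obtain m1 where m1: "0 < m1" "\<And>y. P y \<Longrightarrow> \<exists>t0\<ge>0. \<forall>t\<ge>t0. \<forall>i\<in>F. m1 \<le> y i t"
    using insert by auto
  obtain m2 where m2: "0 < m2" "\<And>y. P y \<Longrightarrow> \<exists>t0\<ge>0. \<forall>t\<ge>t0. m2 \<le> y i t"
    using insert.prems[OF insertI1] by blast
  have "\<exists>t0\<ge>0. \<forall>t\<ge>t0. \<forall>l\<in>insert i F. min m1 m2 \<le> y l t" if y: "P y" for y
  proof -
    obtain t1 where t1: "0 \<le> t1" "\<forall>t\<ge>t1. \<forall>i\<in>F. m1 \<le> y i t" using m1(2)[OF y] by blast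
    obtain t2 where t2: "0 \<le> t2" "\<forall>t\<ge>t2. m2 \<le> y i t" using m2(2)[OF y] by blast
    show ?thesis using t1 t2 by (intro exI[of _ "max t1 t2"]) (auto simp: min_le_iff_disj)
  qed
  then show ?case using m1(1) m2(1) by (intro exI[of _ "min m1 m2"]) simp
qed

section \<open>From the sup matrix to reachability, and restriction of solutions to blocks\<close>

context nicholson_system begin

text \<open>Nonnegativity lets a vanishing supremum force a vanishing coefficient;
  \<open>i \<noteq> l\<close> excludes the diagonal, where \<open>sup_matrix\<close> is 0 by
  convention.\<close>

lemma sup_matrix_zeroD:
  assumes il: "i \<in> {1..n}" "l \<in> {1..n}" "i \<noteq> l" and 0: "sup_matrix a i l = 0"
  shows "a i l t = 0"
proof -
  have "a i l t \<le> (SUP t. a i l t)" using a_le[OF il(1,2)] by (intro cSUP_upper bdd_aboveI2) auto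
  then show ?thesis using 0 il a_nonneg[OF il(1,2), of t] by (simp add: sup_matrix_def)
qed

lemma sup_matrix_nonzeroE:
  assumes il: "i \<in> {1..n}" "l \<in> {1..n}" and "sup_matrix a i l \<noteq> 0"
  obtains t where "0 < a i l t"
proof (rule ccontr)
  assume "\<not> thesis"
  then have "\<not> 0 < a i l t" for t using that by blast
  then have "a i l t = 0" for t using a_nonneg[OF il, of t] by (meson antisym_conv not_less)
  then show False using assms(3) by (auto simp: sup_matrix_def split: if_splits)
qed

lemma supersolution_subset:
  assumes ST: "S \<subseteq> T" "T \<subseteq> {1..n}" and y: "supersolution T y"
  shows "supersolution S y"
proof -
  obtain y' where y': "\<forall>i\<in>T. \<forall>t\<ge>0. (y i has_real_derivative y' i t) (at t within {0..}) \<and>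
        undelayed T y i t \<le> y' i t"
    using y unfolding supersolution_def by blast
  show ?thesis
    unfolding supersolution_def
  proof (intro conjI ballI allI impI exI)
    fix i and t :: real assume i: "i \<in> S" and t: "0 \<le> t"
    then have iT: "i \<in> T" using ST by blast
    show "0 \<le> y i t" by (rule supersolution_nonneg[OF y iT t])
    show "(y i has_real_derivative y' i t) (at t within {0..})" using y' iT t by blast
    have "(\<Sum>l\<in>S. a i l t * y l t) \<le> (\<Sum>l\<in>T. a i l t * y l t)"
      using ST finite_subset[OF ST(2)] coeff_abs_le(2)[OF ST(2) iT] supersolution_nonneg[OF y _ t]
      by (intro sum_mono2) auto
    moreover have "undelayed T y i t \<le> y' i t" using y' iT t by blast
    ultimately show "undelayed S y i t \<le> y' i t" by linarith
  qed
qed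

text \<open>Restricting a supersolution of the larger system drops nonnegative inputs and leaves a
  supersolution of the smaller one.\<close>

lemma reaches_mono:
  assumes "S \<subseteq> T" "T \<subseteq> {1..n}" "reaches S l i"
  shows "reaches T l i"
proof -
  obtain T' \<kappa> where T': "0 \<le> T'" "0 < \<kappa>"
    and sp: "\<forall>y. supersolution S y \<longrightarrow> (\<forall>t\<ge>0. \<kappa> * y l t \<le> y i (t + T'))"
    using assms(3) unfolding reaches_def by (elim exE conjE) (rule that)
  have "\<forall>t\<ge>0. \<kappa> * y l t \<le> y i (t + T')" if "supersolution T y" for y
    using sp supersolution_subset[OF assms(1,2) that] by blast
  then show ?thesis unfolding reaches_def using T' by (intro exI[of _ T'] conjI exI[of _ \<kappa>]) auto
qed

text \<open>Indices not reached from \<open>l\<close> receive nothing from reached ones, since an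
  edge would extend reachability. As \<open>l\<close> reaches itself, a nonempty set of such indices
  would make the block reducible.\<close>

lemma irreducible_imp_reaches:
  assumes sub: "block_indices ns j \<subseteq> {1..n}"
    and irr: "irreducible_mat (ns j) (mat_block ns (sup_matrix a) j j)"
    and il: "i \<in> block_indices ns j" "l \<in> block_indices ns j"
  shows "reaches (block_indices ns j) l i"
proof (rule ccontr)
  let ?S = "block_indices ns j"
  assume not: "\<not> reaches ?S l i"
  define C where "C = {p \<in> {1..ns j}. \<not> reaches ?S l (block_offset ns j + p)}"
  obtain p where p: "p \<in> {1..ns j}" "i = block_offset ns j + p" using il(1) by (rule block_indicesE)
  obtain q where q: "q \<in> {1..ns j}" "l = block_offset ns j + q" using il(2) by (rule block_indicesE)
  have "reducible_mat (ns j) (mat_block ns (sup_matrix a) j j)"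
  proof (rule reducible_matI[of C])
    show "C \<subseteq> {1..ns j}" by (auto simp: C_def)
    show "C \<noteq> {}" using p not by (auto simp: C_def)
    have "q \<notin> C" using q(2) reaches_refl[of ?S l] by (simp add: C_def)
    then show "C \<noteq> {1..ns j}" using q(1) by blast
    fix x y assume x: "x \<in> C" and y: "y \<in> {1..ns j} - C"
    let ?x = "block_offset ns j + x" and ?y = "block_offset ns j + y"
    have xS: "?x \<in> ?S" and yS: "?y \<in> ?S" using x y by (auto simp: C_def intro!: block_indicesI)
    show "mat_block ns (sup_matrix a) j j x y = 0"
    proof (rule ccontr)
      assume "mat_block ns (sup_matrix a) j j x y \<noteq> 0"
      then have "sup_matrix a ?x ?y \<noteq> 0" by (simp add: mat_block_def)
      then obtain t where "0 < a ?x ?y t" using sup_matrix_nonzeroE xS yS sub by blast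
      then have "reaches ?S ?y ?x" by (rule reaches_edge[OF sub xS yS])
      moreover have "reaches ?S l ?y" using y by (auto simp: C_def)
      ultimately have "reaches ?S l ?x" by (rule reaches_trans[rotated])
      then show False using x by (simp add: C_def)
    qed
  qed
  then show False using irr by simp
qed

lemma nicholson_solution_supersolution:
  assumes S: "S \<subseteq> {1..n}" and \<phi>: "\<phi> \<in> phase_space {1..n} \<tau>" "phase_nonneg {1..n} \<tau> \<phi>"
  defines "y \<equiv> sol \<phi>"
  shows "nicholson_supersolution S y" "supersolution {1..n} y"
proof -
  note y = nicholson_solution_props[OF \<phi>, folded y_def]
  have nn: "0 \<le> y i t" if "i \<in> {1..n}" "0 \<le> t" for i t
    using y(2)[OF that(1)] delay(1)[OF that(1)] that by simp
  have "nicholson_supersolution T y" if T: "T \<subseteq> {1..n}" for T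
    unfolding nicholson_supersolution_def
  proof (intro conjI ballI allI impI exI)
    show "0 \<le> y i t" if "i \<in> T" "- \<tau> i \<le> t" for i t using that T by (intro y(2)) auto
    fix i and t :: real assume i: "i \<in> T" and t: "0 \<le> t"
    then have iN: "i \<in> {1..n}" using T by blast
    show "(y i has_real_derivative undelayed {1..n} y i t
       + birth y i t) (at t within {0..})"
      by (rule y(3)[OF iN t])
    have "(\<Sum>l\<in>T. a i l t * y l t) \<le> (\<Sum>l\<in>{1..n}. a i l t * y l t)"
      using T a_nonneg[OF iN] nn[OF _ t] by (intro sum_mono2) auto
    then show "undelayed T y i t + birth y i t
        \<le> undelayed {1..n} y i t
       + birth y i t" by simp
  qed
  from this[OF S] show "nicholson_supersolution S y" .
  show "supersolution {1..n} y"
    unfolding supersolution_def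
  proof (intro conjI ballI allI impI exI)
    fix i and t :: real assume i: "i \<in> {1..n}" and t: "0 \<le> t"
    show "0 \<le> y i t" by (rule nn[OF i t])
    show "(y i has_real_derivative undelayed {1..n} y i t
       + birth y i t) (at t within {0..})"
      by (rule y(3)[OF i t])
    have "0 \<le> birth y i t"
      using \<beta>_nonneg[OF i t] y(2)[OF i, of "t - \<tau> i"] t by simp
    then show "undelayed {1..n} y i t \<le> undelayed {1..n} y i t
       + birth y i t" by simp
  qed
qed

text \<open>The hypothesis concerns the product \<open>a i l t * y l t\<close> because inputs vanish
  for two reasons: the coefficients are 0 for a source block, and the outer components are 0 when a
  sink block is populated alone.\<close>

lemma nicholson_solution_closed:
  assumes S: "S \<subseteq> {1..n}" and \<phi>: "\<phi> \<in> phase_space {1..n} \<tau>" "phase_nonneg {1..n} \<tau> \<phi>"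
  defines "y \<equiv> sol \<phi>"
  assumes zero: "\<And>i l t. i \<in> S \<Longrightarrow> l \<in> {1..n} - S \<Longrightarrow> 0 \<le> t \<Longrightarrow> a i l t * y l t = 0"
  shows "closed_nicholson_solution S y"
  unfolding closed_nicholson_solution_def
proof (intro conjI ballI allI impI)
  note y = nicholson_solution_props[OF \<phi>, folded y_def]
  show "0 \<le> y i t" if "i \<in> S" "- \<tau> i \<le> t" for i t using that S by (intro y(2)) auto
  fix i and t :: real assume i: "i \<in> S" and t: "0 \<le> t"
  then have iN: "i \<in> {1..n}" using S by blast
  have "(\<Sum>l\<in>{1..n}. a i l t * y l t) = (\<Sum>l\<in>S. a i l t * y l t)"
    using S zero[OF i _ t] by (intro sum.mono_neutral_right) auto
  then show "(y i has_real_derivative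
        undelayed S y i t + birth y i t)
        (at t within {0..})" using y(3)[OF iN t] by simp
qed

text \<open>While the delayed value is 0, \<open>- y\<close> satisfies the undelayed cooperative
  inequality, so comparison gives \<open>y \<le> 0\<close> in addition to nonnegativity.\<close>

lemma nicholson_solution_zero:
  assumes R: "R \<subseteq> {1..n}" and \<phi>: "\<phi> \<in> phase_space {1..n} \<tau>" "phase_nonneg {1..n} \<tau> \<phi>"
  defines "y \<equiv> sol \<phi>"
  assumes zero: "\<And>i l t. i \<in> R \<Longrightarrow> l \<in> {1..n} - R \<Longrightarrow> a i l t = 0"
    and ini: "\<And>i s. i \<in> R \<Longrightarrow> - \<tau> i \<le> s \<Longrightarrow> s \<le> 0 \<Longrightarrow> \<phi> i s = 0"
    and it: "i \<in> R" "- \<tau> i \<le> t"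
  shows "y i t = 0"
proof -
  note y = nicholson_solution_props[OF \<phi>, folded y_def]
  have "0 \<le> - y i t"
  proof (rule nonneg_of_affine_inequality[where S = R and y = "\<lambda>i t. - y i t", OF R _ _ _ it])
    show "((\<lambda>t. - y i t) has_real_derivative - (undelayed {1..n} y i t
       + birth y i t)) (at t within {0..})"
      if "i \<in> R" "0 \<le> t" for i t using that R by (intro DERIV_minus y(3)) auto
    show "0 \<le> - y i t" if "i \<in> R" "- \<tau> i \<le> t" "t \<le> 0" for i t
      using y(1)[of i t] ini[OF that] that R by auto
    fix i t assume i: "i \<in> R" and t: "0 \<le> t" and del: "0 \<le> - y i (t - \<tau> i)"
    then have iN: "i \<in> {1..n}" using R by blast
    have "y i (t - \<tau> i) = 0" using del y(2)[OF iN, of "t - \<tau> i"] t by simp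
    moreover have "(\<Sum>l\<in>{1..n}. a i l t * y l t) = (\<Sum>l\<in>R. a i l t * y l t)"
      using R zero[OF i] by (intro sum.mono_neutral_right) auto
    ultimately show "- d i t * - y i t + (\<Sum>l\<in>R. a i l t * - y l t) \<le> - (undelayed {1..n} y i t
       + birth y i t)"
      by (simp add: sum_negf)
  qed
  moreover have "0 \<le> y i t" using it R by (intro y(2)) auto
  ultimately show ?thesis by simp
qed

end

section \<open>Source blocks and sink blocks\<close>

locale block_structured_system = nicholson_system +
  fixes k :: nat and ns :: "nat \<Rightarrow> nat"
  assumes ns_pos: "\<And>j. j \<in> {1..k} \<Longrightarrow> 1 \<le> ns j" and ns_sum: "(\<Sum>j=1..k. ns j) = n"
    and triangular: "block_lower_triangular k ns (sup_matrix a)"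
    and irreducible: "\<And>j. j \<in> {1..k} \<Longrightarrow> irreducible_mat (ns j) (mat_block ns (sup_matrix a) j j)"
begin

abbreviation "blk \<equiv> block_indices ns"
abbreviation "source_blocks \<equiv> I_set k ns (sup_matrix a)"
abbreviation "sink_blocks \<equiv> J_set k ns (sup_matrix a)"

lemma blk_subset: "j \<in> {1..k} \<Longrightarrow> blk j \<subseteq> {1..n}"
  using block_indices_subset[of j k ns] ns_sum by simp

lemma blk_cover: "x \<in> {1..n} \<Longrightarrow> \<exists>j\<in>{1..k}. x \<in> blk j"
  using block_indices_cover[of x ns k] ns_sum by simp

lemma irreducible_block_blk:
  assumes "j \<in> {1..k}"
  shows "irreducible_block n \<tau> d \<beta> c a K h c0 (blk j)"
proof unfold_locales
  show "blk j \<subseteq> {1..n}" by (rule blk_subset[OF assms])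
  have "1 \<in> {1..ns j}" using ns_pos[OF assms] by simp
  then show "blk j \<noteq> {}" using block_indicesI by blast
  show "reaches (blk j) l i" if "i \<in> blk j" "l \<in> blk j" for i l
    by (rule irreducible_imp_reaches[OF blk_subset[OF assms] irreducible[OF assms] that])
qed

lemma reaches_within_block:
  assumes "j \<in> {1..k}" "i \<in> blk j" "l \<in> blk j"
  shows "reaches {1..n} l i"
  using irreducible_imp_reaches[OF blk_subset[OF assms(1)] irreducible[OF assms(1)] assms(2,3)]
  by (rule reaches_mono[OF blk_subset[OF assms(1)] order_refl])

lemma reaches_across_blocks:
  assumes "i \<in> {1..k}" "j \<in> {1..k}" "\<not> block_zero ns (sup_matrix a) i j" "x \<in> blk i" "y \<in> blk j"
  shows "reaches {1..n} y x"
proof -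
  obtain x' y' where xy: "x' \<in> blk i" "y' \<in> blk j" "sup_matrix a x' y' \<noteq> 0"
    using assms(3) by (rule not_block_zeroE)
  have N: "x' \<in> {1..n}" "y' \<in> {1..n}" using xy blk_subset assms(1,2) by blast+
  obtain t where "0 < a x' y' t" using sup_matrix_nonzeroE[OF N xy(3)] by blast
  then have "reaches {1..n} y' x'" by (rule reaches_edge[OF order_refl N])
  then show ?thesis
    using reaches_within_block[OF assms(2) xy(2) assms(5)] reaches_within_block[OF assms(1,4) xy(1)]
    by (blast intro: reaches_trans)
qed

text \<open>For \<open>k = 1\<close> the condition on the other blocks is vacuous, so the separate
  case of the definition disappears; the same happens for sinks.\<close>

lemma source_blocks_iff:
  "j \<in> source_blocks \<longleftrightarrow> j \<in> {1..k} \<and> (\<forall>i\<in>{1..k}. i \<noteq> j \<longrightarrow> block_zero ns (sup_matrix a) j i)"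
  by (auto simp: I_set_def)

lemma sink_blocks_iff:
  "j \<in> sink_blocks \<longleftrightarrow> j \<in> {1..k} \<and> (\<forall>i\<in>{1..k}. i \<noteq> j \<longrightarrow> block_zero ns (sup_matrix a) i j)"
  by (auto simp: J_set_def)

lemma triangularD: "i \<in> {1..k} \<Longrightarrow> j \<in> {1..k} \<Longrightarrow> \<not> block_zero ns (sup_matrix a) i j \<Longrightarrow> j \<le> i"
  using triangular unfolding block_lower_triangular_def by (meson not_le)

text \<open>By triangularity every input comes from a block of smaller index, so following inputs
  backwards ends in a block without any.\<close>

lemma reached_from_source:
  "j \<in> {1..k} \<Longrightarrow> \<exists>j'\<in>source_blocks. \<forall>x\<in>blk j. \<forall>y\<in>blk j'. reaches {1..n} y x"
proof (induction j rule: less_induct)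
  case (less j)
  show ?case
  proof (cases "j \<in> source_blocks")
    case True
    then show ?thesis using reaches_within_block[OF less.prems] by blast
  next
    case False
    then obtain i where i: "i \<in> {1..k}" "i \<noteq> j" "\<not> block_zero ns (sup_matrix a) j i"
      using less.prems source_blocks_iff by blast
    then have "i < j" using triangularD[OF less.prems i(1)] by simp
    then obtain j' where j': "j' \<in> source_blocks" "\<forall>x\<in>blk i. \<forall>y\<in>blk j'. reaches {1..n} y x"
      using less.IH i(1) by blast
    have "reaches {1..n} y x" if "x \<in> blk j" "y \<in> blk j'" for x y
    proof -
      have "1 \<in> {1..ns i}" using ns_pos[OF i(1)] by simp
      then obtain w where w: "w \<in> blk i" using block_indicesI by blast
      show ?thesis
        using j'(2) w that reaches_across_blocks[OF less.prems i(1,3) that(1) w] by (blast intro: reaches_trans)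
    qed
    then show ?thesis using j'(1) by blast
  qed
qed

text \<open>Outputs lead to larger indices, so the induction runs on \<open>k - j\<close>.\<close>

lemma reaches_sink:
  "j \<in> {1..k} \<Longrightarrow> \<exists>j'\<in>sink_blocks. \<forall>x\<in>blk j. \<forall>y\<in>blk j'. reaches {1..n} x y"
proof (induction "k - j" arbitrary: j rule: less_induct)
  case less
  show ?case
  proof (cases "j \<in> sink_blocks")
    case True
    then show ?thesis using reaches_within_block[OF less.prems] by blast
  next
    case False
    then obtain i where i: "i \<in> {1..k}" "i \<noteq> j" "\<not> block_zero ns (sup_matrix a) i j"
      using less.prems sink_blocks_iff by blast
    then have "j < i" using triangularD[OF i(1) less.prems] by simp
    then have "k - i < k - j" using i(1) by auto
    then obtain j' where j': "j' \<in> sink_blocks" "\<forall>x\<in>blk i. \<forall>y\<in>blk j'. reaches {1..n} x y"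
      using less.hyps i(1) by blast
    have "reaches {1..n} x y" if "x \<in> blk j" "y \<in> blk j'" for x y
    proof -
      have "1 \<in> {1..ns i}" using ns_pos[OF i(1)] by simp
      then obtain w where w: "w \<in> blk i" using block_indicesI by blast
      show ?thesis
        using j'(2) w that reaches_across_blocks[OF i(1) less.prems i(3) w that(1)] by (blast intro: reaches_trans)
    qed
    then show ?thesis using j'(1) by blast
  qed
qed

lemma coeff_zero_of_block_zero:
  assumes "i \<in> {1..k}" "j \<in> {1..k}" "block_zero ns (sup_matrix a) i j" "x \<in> blk i" "y \<in> blk j" "x \<noteq> y"
  shows "a x y t = 0"
  using sup_matrix_zeroD[OF _ _ assms(6) block_zeroD[OF assms(3-5)]] blk_subset assms by blast

abbreviation admissible :: "(nat \<Rightarrow> real \<Rightarrow> real) \<Rightarrow> bool" where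
  "admissible \<phi> \<equiv> \<phi> \<in> phase_space {1..n} \<tau> \<and> phase_nonneg {1..n} \<tau> \<phi>"

text \<open>Ultimate boundedness provides one \<open>B\<close> for all admissible initial maps,
  which frees \<open>m\<close> from the solution.\<close>

lemma block_persistsD:
  assumes j: "j \<in> {1..k}" and per: "block_persists (blk j)"
  shows "\<exists>m>0. \<forall>\<phi>. admissible \<phi> \<longrightarrow> (\<exists>p\<in>blk j. \<exists>t\<ge>0. 0 < sol \<phi> p t) \<longrightarrow>
     (\<exists>t0\<ge>0. \<forall>t\<ge>t0. \<forall>i\<in>blk j. m \<le> sol \<phi> i t)"
proof -
  obtain B where B: "0 < B" and bd: "\<forall>\<phi>\<in>phase_space {1..n} \<tau>. phase_nonneg {1..n} \<tau> \<phi> \<longrightarrow>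
     (\<exists>t0\<ge>0. \<forall>t\<ge>t0. \<forall>i\<in>{1..n}. sol \<phi> i t \<le> B)"
    using nicholson_ultimately_bounded by (elim exE conjE) (rule that)
  obtain m where m: "0 < m" and mB: "\<forall>y. nicholson_supersolution (blk j) y \<longrightarrow>
     (\<exists>tB\<ge>0. \<forall>t\<ge>tB. \<forall>i\<in>blk j. y i t \<le> B) \<longrightarrow>
     (\<exists>p\<in>blk j. \<exists>t\<ge>0. 0 < y p t) \<longrightarrow> (\<exists>t0\<ge>0. \<forall>t\<ge>t0. \<forall>i\<in>blk j. m \<le> y i t)"
    using per[unfolded block_persists_def, rule_format, OF B] by (elim exE conjE) (rule that)
  have "\<exists>t0\<ge>0. \<forall>t\<ge>t0. \<forall>i\<in>blk j. m \<le> sol \<phi> i t"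
    if \<phi>: "admissible \<phi>" and pos: "\<exists>p\<in>blk j. \<exists>t\<ge>0. 0 < sol \<phi> p t" for \<phi>
  proof -
    have "\<exists>tB\<ge>0. \<forall>t\<ge>tB. \<forall>i\<in>blk j. sol \<phi> i t \<le> B"
      using bd \<phi> blk_subset[OF j] by (meson subsetD)
    then show ?thesis
      using mB nicholson_solution_supersolution(1)[OF blk_subset[OF j]] \<phi> pos by blast
  qed
  then show ?thesis using m by blast
qed

text \<open>Each component is reached from a source block, and the level there arrives diminished by
  a factor and after a waiting time that do not depend on the solution.\<close>

lemma uniformly_persistentI:
  assumes per: "\<And>j. j \<in> source_blocks \<Longrightarrow> block_persists (blk j)"
  shows "uniformly_persistent n \<tau> d a \<beta> c"
proof -
  define P where "P y \<longleftrightarrow> (\<exists>\<phi>. admissible \<phi> \<and> vec_gg0 {1..n} (\<lambda>i. \<phi> i 0) \<and>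
    y = sol \<phi>)" for y
  have "\<exists>m>0. \<forall>y. P y \<longrightarrow> (\<exists>t0\<ge>0. \<forall>t\<ge>t0. \<forall>i\<in>{1..n}. m \<le> y i t)"
  proof (rule uniform_eventual_lower_bound)
    fix i assume i: "i \<in> {1..n}"
    obtain j where j: "j \<in> {1..k}" "i \<in> blk j" using blk_cover[OF i] by blast
    obtain j' where j': "j' \<in> source_blocks" "\<forall>x\<in>blk j. \<forall>y\<in>blk j'. reaches {1..n} y x"
      using reached_from_source[OF j(1)] by blast
    have j'k: "j' \<in> {1..k}" using j'(1) source_blocks_iff by blast
    have "1 \<in> {1..ns j'}" using ns_pos[OF j'k] by simp
    then obtain q where q: "q \<in> blk j'" using block_indicesI by blast
    have qN: "q \<in> {1..n}" using q blk_subset[OF j'k] by blast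
    obtain m where m: "0 < m" and mB: "\<forall>\<phi>. admissible \<phi> \<longrightarrow>
       (\<exists>p\<in>blk j'. \<exists>t\<ge>0. 0 < sol \<phi> p t) \<longrightarrow>
       (\<exists>t0\<ge>0. \<forall>t\<ge>t0. \<forall>i\<in>blk j'. m \<le> sol \<phi> i t)"
      using block_persistsD[OF j'k per[OF j'(1)]] by (elim exE conjE) (rule that)
    have "reaches {1..n} q i" using j'(2) j(2) q by blast
    then obtain T \<kappa> where T: "0 \<le> T" "0 < \<kappa>"
      and sp: "\<forall>y. supersolution {1..n} y \<longrightarrow> (\<forall>t\<ge>0. \<kappa> * y q t \<le> y i (t + T))"
      unfolding reaches_def by (elim exE conjE) (rule that)
    have "\<exists>t0\<ge>0. \<forall>t\<ge>t0. \<kappa> * m \<le> y i t" if Py: "P y" for y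
    proof -
      obtain \<phi> where \<phi>: "\<phi> \<in> phase_space {1..n} \<tau>" "phase_nonneg {1..n} \<tau> \<phi>"
        "vec_gg0 {1..n} (\<lambda>i. \<phi> i 0)" and y: "y = sol \<phi>"
        using Py unfolding P_def by blast
      have "y q 0 = \<phi> q 0"
        unfolding y using delay(1)[OF qN] by (intro nicholson_solution_props(1)[OF \<phi>(1,2) qN]) auto
      then have "0 < y q 0" using \<phi>(3) qN unfolding vec_gg0_def by simp
      then have "\<exists>p\<in>blk j'. \<exists>t\<ge>0. 0 < sol \<phi> p t" using q unfolding y by blast
      then obtain t0 where t0: "0 \<le> t0" "\<forall>t\<ge>t0. \<forall>i\<in>blk j'. m \<le> y i t" using mB \<phi> unfolding y by blast
      have sup: "supersolution {1..n} y"
        unfolding y by (rule nicholson_solution_supersolution(2)[OF order_refl \<phi>(1,2)])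
      have "\<kappa> * m \<le> y i t" if t: "t0 + T \<le> t" for t
      proof -
        have tT: "t0 \<le> t - T" "0 \<le> t - T" using t t0 by auto
        have "\<kappa> * m \<le> \<kappa> * y q (t - T)" using t0(2) tT q T by (intro mult_left_mono) auto
        also have "\<dots> \<le> y i (t - T + T)" using sp sup tT by blast
        finally show ?thesis by simp
      qed
      then show ?thesis using t0 T by (intro exI[of _ "t0 + T"]) auto
    qed
    then show "\<exists>m>0. \<forall>y. P y \<longrightarrow> (\<exists>t0\<ge>0. \<forall>t\<ge>t0. m \<le> y i t)" using m T by (intro exI[of _ "\<kappa> * m"]) auto
  qed simp
  then obtain m where m: "0 < m" and ev: "\<forall>y. P y \<longrightarrow> (\<exists>t0\<ge>0. \<forall>t\<ge>t0. \<forall>i\<in>{1..n}. m \<le> y i t)"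
    by (elim exE conjE) (rule that)
  show ?thesis unfolding uniformly_persistent_def
  proof (rule exI[of _ m], intro conjI ballI impI m)
    fix \<phi> assume "\<phi> \<in> phase_space {1..n} \<tau>" "phase_nonneg {1..n} \<tau> \<phi> \<and> vec_gg0 {1..n} (\<lambda>i. \<phi> i 0)"
    then have "P (sol \<phi>)" unfolding P_def by blast
    then show "\<exists>t0\<ge>0. \<forall>t\<ge>t0. \<forall>i\<in>{1..n}. m \<le> sol \<phi> i t" using ev by blast
  qed
qed

text \<open>A positive initial component populates some sink block through reachability, and that
  block then persists. Which sink it is depends on \<open>\<phi>\<close>, so the level is a minimum
  over all sinks.\<close>

lemma strictly_persistentI:
  assumes per: "\<And>j. j \<in> sink_blocks \<Longrightarrow> block_persists (blk j)"
  shows "strictly_persistent n \<tau> d a \<beta> c"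
proof -
  have fin: "finite sink_blocks" using sink_blocks_iff finite_subset[of sink_blocks "{1..k}"] by blast
  have "\<forall>j\<in>sink_blocks. \<exists>m>0. \<forall>\<phi>. admissible \<phi> \<longrightarrow>
       (\<exists>p\<in>blk j. \<exists>t\<ge>0. 0 < sol \<phi> p t) \<longrightarrow>
       (\<exists>t0\<ge>0. \<forall>t\<ge>t0. \<forall>i\<in>blk j. m \<le> sol \<phi> i t)"
    using block_persistsD per sink_blocks_iff by blast
  from bchoice[OF this] obtain m where m: "\<forall>j\<in>sink_blocks. 0 < m j \<and> (\<forall>\<phi>. admissible \<phi> \<longrightarrow>
       (\<exists>p\<in>blk j. \<exists>t\<ge>0. 0 < sol \<phi> p t) \<longrightarrow>
       (\<exists>t0\<ge>0. \<forall>t\<ge>t0. \<forall>i\<in>blk j. m j \<le> sol \<phi> i t))" by (elim exE) (rule that)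
  define m0 where "m0 = Min (insert 1 (m ` sink_blocks))"
  have m0: "0 < m0" using fin m unfolding m0_def by (subst Min_gr_iff) auto
  have m0_le: "m0 \<le> m j" if "j \<in> sink_blocks" for j using fin that unfolding m0_def by (intro Min_le) auto
  show ?thesis unfolding strictly_persistent_def
  proof (rule exI[of _ m0], intro conjI ballI impI m0)
    fix \<phi> assume \<phi>1: "\<phi> \<in> phase_space {1..n} \<tau>" and "phase_nonneg {1..n} \<tau> \<phi> \<and> vec_gt0 {1..n} (\<lambda>i. \<phi> i 0)"
    then have \<phi>2: "phase_nonneg {1..n} \<tau> \<phi>" and gt: "vec_gt0 {1..n} (\<lambda>i. \<phi> i 0)" by auto
    define y where "y = sol \<phi>"
    obtain q where q: "q \<in> {1..n}" "0 < \<phi> q 0" using gt unfolding vec_gt0_def by force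
    obtain j where j: "j \<in> {1..k}" "q \<in> blk j" using blk_cover[OF q(1)] by blast
    obtain j' where j': "j' \<in> sink_blocks" "\<forall>x\<in>blk j. \<forall>y\<in>blk j'. reaches {1..n} x y"
      using reaches_sink[OF j(1)] by blast
    have j'k: "j' \<in> {1..k}" using j'(1) sink_blocks_iff by blast
    have "1 \<in> {1..ns j'}" using ns_pos[OF j'k] by simp
    then obtain p where p: "p \<in> blk j'" using block_indicesI by blast
    have "reaches {1..n} q p" using j'(2) j(2) p by blast
    then obtain T \<kappa> where T: "0 \<le> T" "0 < \<kappa>"
      and sp: "\<forall>y. supersolution {1..n} y \<longrightarrow> (\<forall>t\<ge>0. \<kappa> * y q t \<le> y p (t + T))"
      unfolding reaches_def by (elim exE conjE) (rule that)
    have sup: "supersolution {1..n} y"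
      unfolding y_def by (rule nicholson_solution_supersolution(2)[OF order_refl \<phi>1 \<phi>2])
    have "y q 0 = \<phi> q 0"
      unfolding y_def using delay(1)[OF q(1)] by (intro nicholson_solution_props(1)[OF \<phi>1 \<phi>2 q(1)]) auto
    then have "0 < \<kappa> * y q 0" using q(2) T by simp
    also have "\<dots> \<le> y p (0 + T)" using sp sup by blast
    finally have "\<exists>p\<in>blk j'. \<exists>t\<ge>0. 0 < sol \<phi> p t"
      using p T(1) unfolding y_def by auto
    then obtain t0 where t0: "0 \<le> t0" "\<forall>t\<ge>t0. \<forall>i\<in>blk j'. m j' \<le> y i t"
      using m j'(1) \<phi>1 \<phi>2 unfolding y_def by blast
    have "\<forall>t\<ge>t0. m0 \<le> y p t" using t0(2) p m0_le[OF j'(1)] by (meson order_trans)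
    moreover have "p \<in> {1..n}" using p blk_subset[OF j'k] by blast
    ultimately show "\<exists>t0\<ge>0. \<exists>i\<in>{1..n}. \<forall>t\<ge>t0. m0 \<le> sol \<phi> i t"
      using t0(1) unfolding y_def by blast
  qed
qed

text \<open>A source block receives no input, so its part of any solution is closed and extinction
  applies to it; the constant map 1 serves as a witness.\<close>

lemma not_uniformly_persistent:
  assumes j: "j \<in> source_blocks" and ext: "block_goes_extinct (blk j)"
  shows "\<not> uniformly_persistent n \<tau> d a \<beta> c"
proof
  assume "uniformly_persistent n \<tau> d a \<beta> c"
  then obtain m where m: "0 < m" and per: "\<forall>\<phi>\<in>phase_space {1..n} \<tau>.
        phase_nonneg {1..n} \<tau> \<phi> \<and> vec_gg0 {1..n} (\<lambda>i. \<phi> i 0) \<longrightarrow>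
        (\<exists>t0\<ge>0. \<forall>t\<ge>t0. \<forall>i\<in>{1..n}. m \<le> sol \<phi> i t)"
    unfolding uniformly_persistent_def by (elim exE conjE) (rule that)
  define \<phi> where "\<phi> = (\<lambda>(i::nat) (s::real). 1::real)"
  define y where "y = sol \<phi>"
  have \<phi>: "\<phi> \<in> phase_space {1..n} \<tau>" "phase_nonneg {1..n} \<tau> \<phi>" "vec_gg0 {1..n} (\<lambda>i. \<phi> i 0)"
    by (auto simp: \<phi>_def phase_space_def phase_nonneg_def vec_gg0_def)
  obtain t0 where t0: "0 \<le> t0" "\<forall>t\<ge>t0. \<forall>i\<in>{1..n}. m \<le> y i t" using per \<phi> unfolding y_def by blast
  have jk: "j \<in> {1..k}" using j source_blocks_iff by blast
  have "closed_nicholson_solution (blk j) y"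
    unfolding y_def
  proof (rule nicholson_solution_closed[OF blk_subset[OF jk] \<phi>(1,2)])
    fix i l and t :: real assume i: "i \<in> blk j" and l: "l \<in> {1..n} - blk j"
    obtain j' where j': "j' \<in> {1..k}" "l \<in> blk j'" using blk_cover[of l] l by blast
    then have "j' \<noteq> j" using l by blast
    then have "block_zero ns (sup_matrix a) j j'" using j j'(1) source_blocks_iff by blast
    then have "a i l t = 0" using coeff_zero_of_block_zero[OF jk j'(1) _ i j'(2)] i l by blast
    then show "a i l t * sol \<phi> l t = 0" by simp
  qed
  moreover obtain p where p: "p \<in> blk j"
  proof -
    have "1 \<in> {1..ns j}" using ns_pos[OF jk] by simp
    then show ?thesis using block_indicesI that by blast
  qed
  moreover have "\<forall>t\<ge>t0. m \<le> y p t" using t0(2) p blk_subset[OF jk] by blast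
  ultimately show False using ext m t0(1) unfolding block_goes_extinct_def by blast
qed

text \<open>Started from 1 on the sink block and 0 elsewhere, the solution leaves the other blocks
  empty, because a sink exports nothing; it is then a closed solution on the block alone.\<close>

lemma not_strictly_persistent:
  assumes j: "j \<in> sink_blocks" and ext: "block_goes_extinct (blk j)"
  shows "\<not> strictly_persistent n \<tau> d a \<beta> c"
proof
  assume "strictly_persistent n \<tau> d a \<beta> c"
  then obtain m where m: "0 < m" and per: "\<forall>\<phi>\<in>phase_space {1..n} \<tau>.
        phase_nonneg {1..n} \<tau> \<phi> \<and> vec_gt0 {1..n} (\<lambda>i. \<phi> i 0) \<longrightarrow>
        (\<exists>t0\<ge>0. \<exists>i\<in>{1..n}. \<forall>t\<ge>t0. m \<le> sol \<phi> i t)"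
    unfolding strictly_persistent_def by (elim exE conjE) (rule that)
  define \<phi> where "\<phi> = (\<lambda>(i::nat) (s::real). if i \<in> blk j then 1 else 0::real)"
  define y where "y = sol \<phi>"
  have jk: "j \<in> {1..k}" using j sink_blocks_iff by blast
  have "1 \<in> {1..ns j}" using ns_pos[OF jk] by simp
  then obtain p where p: "p \<in> blk j" using block_indicesI by blast
  have \<phi>: "\<phi> \<in> phase_space {1..n} \<tau>" "phase_nonneg {1..n} \<tau> \<phi>"
    by (auto simp: \<phi>_def phase_space_def phase_nonneg_def)
  have "vec_gt0 {1..n} (\<lambda>i. \<phi> i 0)"
    using p blk_subset[OF jk] by (auto simp: \<phi>_def vec_gt0_def intro!: bexI[of _ p])
  then obtain t0 i where t0: "0 \<le> t0" "i \<in> {1..n}" "\<forall>t\<ge>t0. m \<le> y i t"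
    using per \<phi> unfolding y_def by blast
  have zero: "y l t = 0" if l: "l \<in> {1..n} - blk j" and t: "0 \<le> t" for l t
    unfolding y_def
  proof (rule nicholson_solution_zero[where R = "{1..n} - blk j", OF _ \<phi> _ _ l])
    show "- \<tau> l \<le> t" using delay(1)[of l] l t by auto
    fix x w and t :: real assume x: "x \<in> {1..n} - blk j" and w: "w \<in> {1..n} - ({1..n} - blk j)"
    obtain j' where j': "j' \<in> {1..k}" "x \<in> blk j'" using blk_cover[of x] x by blast
    then have "j' \<noteq> j" using x by blast
    then have "block_zero ns (sup_matrix a) j' j" using j j'(1) sink_blocks_iff by blast
    then show "a x w t = 0" using coeff_zero_of_block_zero[OF j'(1) jk _ j'(2)] x w by blast
  qed (auto simp: \<phi>_def)
  \<comment> \<open>The component that stays above \<open>m\<close> must belong to the block, as all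
    the others vanish.\<close>
  have "i \<in> blk j"
  proof (rule ccontr)
    assume "i \<notin> blk j"
    then have "y i t0 = 0" using t0 by (intro zero) auto
    then show False using t0(3) m by force
  qed
  moreover have "closed_nicholson_solution (blk j) y"
    unfolding y_def
    by (rule nicholson_solution_closed[OF blk_subset[OF jk] \<phi>]) (use zero in \<open>simp add: y_def\<close>)
  ultimately show False using ext m t0(1,3) unfolding block_goes_extinct_def by blast
qed

lemma persistence_characterization:
  "\<exists>lam :: nat \<Rightarrow> real.
    (\<forall>j\<in>{1..k}.
       ((\<lambda>t. ln (phase_norm (blk j) \<tau> (segment (linear_solution (blk j) \<tau> d a \<beta> (\<lambda>i s. 1)) t)) / t)
         \<longlongrightarrow> lam j) at_top) \<and>
    (uniformly_persistent n \<tau> d a \<beta> c \<longleftrightarrow> (\<forall>j\<in>source_blocks. 0 < lam j)) \<and>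
    (strictly_persistent n \<tau> d a \<beta> c \<longleftrightarrow> (\<forall>j\<in>sink_blocks. 0 < lam j))"
proof -
  have "\<forall>j\<in>{1..k}. \<exists>lam. ((\<lambda>t. ln (phase_norm (blk j) \<tau> (segment (linear_solution (blk j) \<tau> d a \<beta> (\<lambda>i s. 1)) t)) / t)
         \<longlongrightarrow> lam) at_top \<and> (0 < lam \<longrightarrow> block_persists (blk j)) \<and> (lam \<le> 0 \<longrightarrow> block_goes_extinct (blk j))"
    by (intro ballI) (rule irreducible_block.block_dichotomy[OF irreducible_block_blk])
  from bchoice[OF this] obtain lam where lam: "\<forall>j\<in>{1..k}.
      ((\<lambda>t. ln (phase_norm (blk j) \<tau> (segment (linear_solution (blk j) \<tau> d a \<beta> (\<lambda>i s. 1)) t)) / t)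
         \<longlongrightarrow> lam j) at_top \<and> (0 < lam j \<longrightarrow> block_persists (blk j)) \<and> (lam j \<le> 0 \<longrightarrow> block_goes_extinct (blk j))"
    by (elim exE) (rule that)
  have per: "block_persists (blk j)" if "j \<in> {1..k}" "0 < lam j" for j using lam that by blast
  have ext: "block_goes_extinct (blk j)" if "j \<in> {1..k}" "\<not> 0 < lam j" for j using lam that by (meson not_le)
  have "uniformly_persistent n \<tau> d a \<beta> c \<longleftrightarrow> (\<forall>j\<in>source_blocks. 0 < lam j)"
    using uniformly_persistentI not_uniformly_persistent per ext source_blocks_iff by blast
  moreover have "strictly_persistent n \<tau> d a \<beta> c \<longleftrightarrow> (\<forall>j\<in>sink_blocks. 0 < lam j)"
    using strictly_persistentI not_strictly_persistent per ext sink_blocks_iff by blast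
  ultimately show ?thesis using lam by (intro exI[of _ lam]) blast
qed

end

section \<open>The sign criterion under the original assumptions\<close>

theorem theorem3p5:
  fixes n k :: nat and ns :: "nat \<Rightarrow> nat" and \<tau> :: "nat \<Rightarrow> real"
    and d \<beta> c :: "nat \<Rightarrow> real \<Rightarrow> real" and a :: "nat \<Rightarrow> nat \<Rightarrow> real \<Rightarrow> real"
  assumes delays: "\<forall>i\<in>{1..n}. 0 < \<tau> i"
    and a1: "\<forall>i\<in>{1..n}. almost_periodic (d i) \<and> almost_periodic (c i) \<and> almost_periodic (\<beta> i) \<and>
               (\<forall>j\<in>{1..n}. almost_periodic (a i j))"
    and a2: "\<exists>d0>0. \<forall>i\<in>{1..n}. \<forall>t. d0 \<le> d i t"
    and a3: "\<forall>i\<in>{1..n}. (\<forall>j\<in>{1..n}. \<forall>t. 0 \<le> a i j t) \<and> (\<forall>t. a i i t = 0)"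
    and a4: "\<forall>i\<in>{1..n}. \<forall>t\<ge>0. 0 < \<beta> i t"
    and a5: "\<exists>c0>0. \<forall>i\<in>{1..n}. \<forall>t\<ge>0. c0 \<le> c i t"
    and a6: "\<forall>i\<in>{1..n}. \<forall>t\<ge>0. 0 < d i t - (\<Sum>j=1..n. a j i t)"
    and blocks: "1 \<le> k" "\<forall>j\<in>{1..k}. 1 \<le> ns j" "(\<Sum>j=1..k. ns j) = n"
    and triangular: "block_lower_triangular k ns (sup_matrix a)"
    and irreducible: "\<forall>j\<in>{1..k}. irreducible_mat (ns j) (mat_block ns (sup_matrix a) j j)"
  shows "\<exists>lam :: nat \<Rightarrow> real.
    (\<forall>j\<in>{1..k}.
       ((\<lambda>t. ln (phase_norm (block_indices ns j) \<tau>
                  (segment (linear_solution (block_indices ns j) \<tau> d a \<beta> (\<lambda>i s. 1)) t)) / t)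
         \<longlongrightarrow> lam j) at_top) \<and>
    (uniformly_persistent n \<tau> d a \<beta> c \<longleftrightarrow> (\<forall>j\<in>I_set k ns (sup_matrix a). 0 < lam j)) \<and>
    (strictly_persistent n \<tau> d a \<beta> c \<longleftrightarrow> (\<forall>j\<in>J_set k ns (sup_matrix a). 0 < lam j))"
proof -
  have "ns 1 \<le> (\<Sum>j=1..k. ns j)" using blocks(1) by (intro member_le_sum) auto
  moreover have "1 \<le> ns 1" using blocks(1,2) by simp
  ultimately have n: "1 \<le> n" using blocks(3) by simp
  define F where "F = d ` {1..n} \<union> c ` {1..n} \<union> \<beta> ` {1..n} \<union> (\<lambda>(i, j). a i j) ` ({1..n} \<times> {1..n})"
  have "\<forall>f\<in>F. \<exists>K. \<forall>t. \<bar>f t\<bar> \<le> K" using a1 by (auto simp: F_def intro!: almost_periodic_bounded)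
  from bchoice[OF this] obtain B where B: "\<forall>f\<in>F. \<forall>t. \<bar>f t\<bar> \<le> B f" by (elim exE) (rule that)
  \<comment> \<open>One bound for all coefficients; the 1 makes it positive.\<close>
  define K where "K = (\<Sum>f\<in>F. \<bar>B f\<bar>) + 1"
  have K0: "0 < K" by (simp add: K_def add_nonneg_pos sum_nonneg)
  have K: "f t \<le> K" if "f \<in> F" for f t
  proof -
    have "f t \<le> \<bar>B f\<bar>" using B that by (meson abs_le_D1 abs_ge_self order_trans)
    also have "\<dots> \<le> (\<Sum>f\<in>F. \<bar>B f\<bar>)" using that by (intro member_le_sum) (auto simp: F_def)
    finally show ?thesis by (simp add: K_def)
  qed
  have F: "i \<in> {1..n} \<Longrightarrow> d i \<in> F" "i \<in> {1..n} \<Longrightarrow> c i \<in> F" "i \<in> {1..n} \<Longrightarrow> \<beta> i \<in> F"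
    "i \<in> {1..n} \<Longrightarrow> j \<in> {1..n} \<Longrightarrow> a i j \<in> F" for i j by (auto simp: F_def)
  \<comment> \<open>The sum of the positive delays bounds each of them.\<close>
  define h where "h = (\<Sum>i\<in>{1..n}. \<tau> i)"
  have h: "\<tau> i \<le> h" if "i \<in> {1..n}" for i
    unfolding h_def using delays that by (intro member_le_sum) (auto simp: less_imp_le)
  have "1 \<in> {1..n}" using n by simp
  then have h0: "0 < h" using h delays by (meson less_le_trans)
  obtain c0 where c0: "0 < c0" "\<forall>i\<in>{1..n}. \<forall>t\<ge>0. c0 \<le> c i t" using a5 by blast
  obtain d0 where d0: "0 < d0" "\<forall>i\<in>{1..n}. \<forall>t. d0 \<le> d i t" using a2 by blast
  interpret block_structured_system n \<tau> d \<beta> c a K h c0 k ns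
  proof unfold_locales
    fix i and t :: real assume i: "i \<in> {1..n}"
    show "0 < \<tau> i" using delays i by blast
    show "\<tau> i \<le> h" by (rule h[OF i])
    show "almost_periodic (d i)" "almost_periodic (\<beta> i)" "almost_periodic (c i)" using a1 i by blast+
    show "0 \<le> d i t" using d0 i by (meson less_imp_le order_trans)
    show "d i t \<le> K" "\<beta> i t \<le> K" "c i t \<le> K" using K F i by blast+
    show "0 < \<beta> i t" if "0 \<le> t" using a4 i that by blast
    show "c0 \<le> c i t" if "0 \<le> t" using c0(2) i that by blast
    show "0 < d i t - (\<Sum>j = 1..n. a j i t)" if "0 \<le> t" using a6 i that by blast
    fix j assume j: "j \<in> {1..n}"
    show "almost_periodic (a i j)" using a1 i j by blast
    show "0 \<le> a i j t" using a3 i j by blast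
    show "a i j t \<le> K" using K F(4)[OF i j] by blast
  next
    show "1 \<le> ns j" if "j \<in> {1..k}" for j using blocks(2) that by blast
    show "irreducible_mat (ns j) (mat_block ns (sup_matrix a) j j)" if "j \<in> {1..k}" for j
      using irreducible that by blast
  qed (rule n K0 h0 c0(1) blocks(3) triangular)+
  show ?thesis by (rule persistence_characterization)
qed

end
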